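(* Let $v_1,v_2,\dots$ be a bounded sequence of independent identically distributed real random variables. For $n\ge 1$ and $g\ge 0$ let $H_n(g)$ be the operator on $\mathbb{C}^n$ given by $$(H_n(g)\psi)_k=e^{-g}\psi_{k-1}+e^{g}\psi_{k+1}+v_k\psi_k,\quad 1\le k\le n,\qquad \psi_0=\psi_n,\ \ \psi_{n+1}=\psi_1,$$ with eigenvalues $\lambda_1(g),\dots,\lambda_n(g)$, and let $\gamma$ be the associated Lyapunov exponent. Then there exists $\varepsilon_0>0$ such that for every $0<\varepsilon<\varepsilon_0$ there exist $c=c(\varepsilon)>0$ and $N_0=N_0(\varepsilon)$ such that, for every $n>N_0$, the following holds with probability greater than $1-e^{-cn}$: for every $1\le j\le n$ and every $g$ with $0\le g\le \gamma(\lambda_j(0))-\varepsilon$, the eigenvalue $\lambda_j(g)$ is real and $$(1-e^{-ng})^{2}\,e^{-(\gamma(\lambda_j(0))-g+\varepsilon)n}\ \le\ |\lambda_j(g)-\lambda_j(0)|\ <\ e^{-(\gamma(\lambda_j(0))-g-\varepsilon)n}.$$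
   Context: The Lyapunov exponent is $$\gamma(E)=\lim_{n\to\infty}\frac1n\,\mathbb{E}\log\|A_{E,n}\cdots A_{E,1}\|,\qquad A_{E,k}=\begin{pmatrix}E-v_k&-1\\1&0\end{pmatrix},$$ where $\mathbb{E}$ denotes expectation. "Bounded" means that there is a deterministic constant $C$ with $|v_k|\le C$ almost surely for all $k$. The operator $H_n(0)$ is Hermitian, so its eigenvalues are real; they are ordered as $\lambda_1(0)\le\lambda_2(0)\le\dots\le\lambda_n(0)$. For $g>0$ the operator $H_n(g)$ is in general non-Hermitian, so its eigenvalues need not be real. The eigenvalues of $H_n(g)$ (with algebraic multiplicity) are labelled $\lambda_1(g),\dots,\lambda_n(g)$ so that each $g\mapsto\lambda_j(g)$ is continuous on $[0,\infty)$ and starts at $\lambda_j(0)$. The constants $\varepsilon_0$, $c(\varepsilon)$, $N_0(\varepsilon)$ may depend on the common distribution of the $v_k$, but not on $n$, $j$ or $g$. *)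

theory Defs
  imports "HOL-Probability.Probability" "Jordan_Normal_Form.Char_Poly"
begin

definition iid_sequence :: "'a measure \<Rightarrow> (nat \<Rightarrow> 'a \<Rightarrow> real) \<Rightarrow> bool" where
  "iid_sequence M v \<longleftrightarrow>
     prob_space.indep_vars M (\<lambda>_. borel) v {1..} \<and>
     (\<forall>k\<ge>1. distr M borel (v k) = distr M borel (v 1))"

definition bounded_sequence :: "'a measure \<Rightarrow> (nat \<Rightarrow> 'a \<Rightarrow> real) \<Rightarrow> bool" where
  "bounded_sequence M v \<longleftrightarrow> (\<exists>C::real. \<forall>k\<ge>1. AE \<omega> in M. \<bar>v k \<omega>\<bar> \<le> C)"

definition transfer_matrix :: "real \<Rightarrow> real \<Rightarrow> real^2^2" where
  "transfer_matrix E x = vector [vector [E - x, -1], vector [1, 0]]"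

primrec transfer_product :: "real \<Rightarrow> (nat \<Rightarrow> real) \<Rightarrow> nat \<Rightarrow> real^2^2" where
  "transfer_product E x 0 = Finite_Cartesian_Product.mat 1"
| "transfer_product E x (Suc n) = transfer_matrix E (x (Suc n)) ** transfer_product E x n"

definition lyapunov_exponent :: "'a measure \<Rightarrow> (nat \<Rightarrow> 'a \<Rightarrow> real) \<Rightarrow> real \<Rightarrow> real" where
  "lyapunov_exponent M v E =
     lim (\<lambda>n. (\<integral>\<omega>. ln (onorm ((*v) (transfer_product E (\<lambda>k. v k \<omega>) n))) \<partial>M) / real n)"

text \<open>
  Matrix rows and columns are numbered from 0, so row \<open>i\<close> is site \<open>i + 1\<close>. The three
  contributions are added because neighbouring sites coincide for \<open>n \<le> 2\<close>.
\<close>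

definition hatano_nelson :: "(nat \<Rightarrow> real) \<Rightarrow> nat \<Rightarrow> real \<Rightarrow> complex Matrix.mat" where
  "hatano_nelson x n g = Matrix.mat n n (\<lambda>(i, j).
     (if j = (i + n - 1) mod n then complex_of_real (exp (- g)) else 0) +
     (if j = (i + 1) mod n then complex_of_real (exp g) else 0) +
     (if j = i then complex_of_real (x (i + 1)) else 0))"

lemma hatano_nelson_mult_vec:
  assumes "\<psi> \<in> carrier_vec n" and "i < n"
  shows "vec_index (hatano_nelson x n g *\<^sub>v \<psi>) i =
           complex_of_real (exp (- g)) * vec_index \<psi> ((i + n - 1) mod n) +
           complex_of_real (exp g) * vec_index \<psi> ((i + 1) mod n) +
           complex_of_real (x (i + 1)) * vec_index \<psi> i"
proof -
  have "(i + n - 1) mod n < n" "(i + 1) mod n < n"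
    using assms(2) by auto
  then show ?thesis
    using assms
    by (simp add: hatano_nelson_def mult_mat_vec_def scalar_prod_def distrib_right
        sum.distrib if_distrib[where f = "\<lambda>a. a * _"] cong: if_cong)
qed

text \<open>
  A labelling of all eigenvalues, with algebraic multiplicity, by continuous branches on
  \<open>[0, \<infinity>)\<close>. The matrix at \<open>g = 0\<close> is Hermitian, so comparing real parts there orders the
  eigenvalues themselves.
\<close>

definition eigenvalue_branches ::
    "(nat \<Rightarrow> real) \<Rightarrow> nat \<Rightarrow> (nat \<Rightarrow> real \<Rightarrow> complex) \<Rightarrow> bool" where
  "eigenvalue_branches x n \<Lambda> \<longleftrightarrow>
     (\<forall>g\<ge>0. char_poly (hatano_nelson x n g) = (\<Prod>j=1..n. [:- \<Lambda> j g, 1:])) \<and>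
     (\<forall>j\<in>{1..n}. continuous_on {0..} (\<Lambda> j)) \<and>
     (\<forall>i\<in>{1..n}. \<forall>j\<in>{1..n}. i \<le> j \<longrightarrow> Re (\<Lambda> i 0) \<le> Re (\<Lambda> j 0))"

end

theory Submission
  imports Defs "HOL-Real_Asymp.Real_Asymp" "HOL-Complex_Analysis.Conformal_Mappings"
begin

text \<open>The eigenvalues of \<open>H\<^sub>n(g)\<close> are the solutions \<open>\<lambda>\<close> of \<open>tr T\<^sub>n(\<lambda>) = 2 cosh (n g)\<close>, where \<open>T\<^sub>n\<close> is
  the transfer matrix around the ring. At \<open>\<lambda>\<^sub>j(0)\<close> the trace is \<open>2\<close>, so its derivative there is a sum
  of terms of one sign, and it is bounded below, up to constants, by the norm of the transfer matrix
  around the ring cut open at any site. With probability exponentially close to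
  one no two long disjoint blocks have a deficient transfer matrix at the same energy; the avalanche
  principle then gives growth \<open>exp ((\<gamma> - \<epsilon>) n)\<close> around a suitably cut ring. Uniform upper large
  deviations control the trace and its derivatives near \<open>\<lambda>\<^sub>j(0)\<close>. Hence the trace climbs from \<open>2\<close> to
  \<open>2 cosh (n g)\<close> within the claimed distance, and the continuous branch \<open>\<lambda>\<^sub>j\<close> has to follow this real
  solution. The large deviation bounds rest on the fact that all vectors grow at rate \<open>\<gamma>\<close> in the mean.
  If \<open>v\<^sub>k\<close> is almost surely constant, \<open>\<gamma>\<close> vanishes on the spectrum and there is nothing to prove.\<close>

no_notation vec_index (infixl "$" 100)

section \<open>Products of two-by-two Schroedinger matrices\<close>

text \<open>The energy \<lambda>_j(0) is random and depends on the whole potential, so a large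
  deviation bound at one fixed energy says nothing about it. Upper bounds become uniform over
  energies because norms are submultiplicative: blocks of fixed length are Lipschitz in the energy,
  and a finite net suffices. Lower bounds cannot be had this way, since a product of large factors
  may be small at exceptional energies. What does hold is that two disjoint blocks hardly ever share
  such an energy; hence at each energy the defect of the ring sits in one place, which depends on
  the energy, and cyclicity of the trace allows the ring to be cut there. The trace equals 2 at
  \<lambda>_j(0) although the transfer matrix is exponentially large, so its value carries no
  information and only its slope does. The slope is about exp(\<gamma> n), while the trace has to
  gain 2 cosh(n g) - 2 = exp(n g) (1 - exp(-n g))^2. This is the origin of the squared factor in the
  claim, and the quotient is the displacement. All rates are proved with losses that are fixed
  fractions of \<epsilon> and are added up at the end.\<close>

definition schr_step :: "'a::comm_ring_1 \<Rightarrow> 'a^2^2" where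
  "schr_step t = vector [vector [t, -1], vector [1, 0]]"

text \<open>Polymorphic in the ring because eigenvalues are complex until they are shown to be real,
  whereas growth is studied over the reals. The argument \<open>u i\<close> stands for the energy
  minus the potential, so shifted blocks and rotated rings are mere reindexings of
  \<open>u\<close>.\<close>

primrec schr_prod :: "(nat \<Rightarrow> 'a::comm_ring_1) \<Rightarrow> nat \<Rightarrow> 'a^2^2" where
  "schr_prod u 0 = Finite_Cartesian_Product.mat 1"
| "schr_prod u (Suc n) = schr_step (u n) ** schr_prod u n"

lemma mat2_eq_iff: "(A::'a^2^2) = B \<longleftrightarrow>
    A $ 1 $ 1 = B $ 1 $ 1 \<and> A $ 1 $ 2 = B $ 1 $ 2 \<and> A $ 2 $ 1 = B $ 2 $ 1 \<and> A $ 2 $ 2 = B $ 2 $ 2"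
  by (simp add: Finite_Cartesian_Product.vec_eq_iff forall_2)

lemma mat2_mult_nth [simp]:
  fixes A B :: "'a::semiring_1^2^2"
  shows "(A ** B) $ i $ j = A $ i $ 1 * B $ 1 $ j + A $ i $ 2 * B $ 2 $ j"
  by (simp add: matrix_matrix_mult_def sum_2)

lemma mat2_one_nth:
  "(Finite_Cartesian_Product.mat 1 :: 'a::zero_neq_one^2^2) $ i $ j = (if i = j then 1 else 0)"
  by (simp add: Finite_Cartesian_Product.mat_def)

lemma schr_step_nth [simp]:
  "schr_step t $ 1 $ 1 = t" "schr_step t $ 1 $ 2 = -1"
  "schr_step t $ 2 $ 1 = 1" "schr_step t $ 2 $ 2 = 0"
  by (simp_all add: schr_step_def)

lemma schr_prod_Suc_nth:
  "schr_prod u (Suc n) $ 1 $ j = u n * schr_prod u n $ 1 $ j - schr_prod u n $ 2 $ j"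
  "schr_prod u (Suc n) $ 2 $ j = schr_prod u n $ 1 $ j"
  by simp_all

lemma schr_prod_cong: "(\<And>i. i < n \<Longrightarrow> u i = w i) \<Longrightarrow> schr_prod u n = schr_prod w n"
  by (induction n) auto

lemma schr_prod_add:
  "schr_prod u (a + n) = schr_prod (\<lambda>i. u (a + i)) n ** schr_prod u a"
  by (induction n) (auto simp: matrix_mul_assoc)

definition mat2_det :: "'a::comm_ring_1^2^2 \<Rightarrow> 'a" where
  "mat2_det A = A $ 1 $ 1 * A $ 2 $ 2 - A $ 1 $ 2 * A $ 2 $ 1"

lemma mat2_det_mult: "mat2_det (A ** B) = mat2_det A * mat2_det B"
  by (simp add: mat2_det_def algebra_simps)

lemma mat2_det_schr_step [simp]: "mat2_det (schr_step t) = 1"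
  by (simp add: mat2_det_def)

lemma mat2_det_schr_prod [simp]: "mat2_det (schr_prod u n) = 1"
proof (induction n)
  case 0
  show ?case by (simp add: mat2_det_def mat2_one_nth)
next
  case (Suc n)
  then show ?case by (simp add: mat2_det_mult)
qed

lemma mat2_trace: "trace (A::'a::comm_ring_1^2^2) = A $ 1 $ 1 + A $ 2 $ 2"
  by (simp add: trace_def sum_2)

text \<open>Both products consist of the same two factors, cut at \<open>a\<close>, in opposite
  order, and the trace is cyclic.\<close>

lemma trace_schr_prod_rotate:
  assumes "a \<le> n"
  shows "trace (schr_prod (\<lambda>k. u ((a + k) mod n)) n) = trace (schr_prod u n)"
proof (cases "n = 0")
  case False
  define w where "w = (\<lambda>k. u ((a + k) mod n))"
  have n: "n = a + (n - a)" "n = (n - a) + a" using assms by auto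
  have "schr_prod u n = schr_prod (\<lambda>i. u (a + i)) (n - a) ** schr_prod u a"
    using schr_prod_add[of u a "n - a"] n by simp
  moreover have "schr_prod w n = schr_prod (\<lambda>i. w (n - a + i)) a ** schr_prod w (n - a)"
    using schr_prod_add[of w "n - a" a] n by simp
  moreover have "schr_prod w (n - a) = schr_prod (\<lambda>i. u (a + i)) (n - a)"
    by (rule schr_prod_cong) (simp add: w_def)
  moreover have "schr_prod (\<lambda>i. w (n - a + i)) a = schr_prod u a"
    by (rule schr_prod_cong) (use assms in \<open>simp add: w_def\<close>)
  ultimately have "schr_prod u n = schr_prod (\<lambda>i. u (a + i)) (n - a) ** schr_prod u a"
    "schr_prod w n = schr_prod u a ** schr_prod (\<lambda>i. u (a + i)) (n - a)"
    by simp_all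
  then show ?thesis unfolding w_def[symmetric] by (metis trace_mul_sym)
qed simp

subsection \<open>Norms of two-by-two matrices\<close>

lemma norm_vec2_sq: "(norm (x::real^2))\<^sup>2 = (x $ 1)\<^sup>2 + (x $ 2)\<^sup>2"
  by (simp add: norm_vec_def L2_set_def sum_2)

text \<open>The norm on \<open>real^2^2\<close> is the Frobenius norm. Its square is polynomial in
  the entries, which later allows roots in the energy to be counted, and it differs from the
  operator norm by a factor of at most 2.\<close>

lemma norm_mat2_sq:
  "(norm (A::real^2^2))\<^sup>2 = (A $ 1 $ 1)\<^sup>2 + (A $ 1 $ 2)\<^sup>2 + (A $ 2 $ 1)\<^sup>2 + (A $ 2 $ 2)\<^sup>2"
  by (simp add: norm_vec_def[of A] L2_set_def sum_2 norm_vec2_sq)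

lemma mat2_mult_vec_nth [simp]:
  fixes A :: "'a::semiring_1^2^2"
  shows "(A *v x) $ i = A $ i $ 1 * x $ 1 + A $ i $ 2 * x $ 2"
  by (simp add: matrix_vector_mult_def sum_2)

lemma cauchy_schwarz_2: "(a * c + b * d)\<^sup>2 \<le> (a\<^sup>2 + b\<^sup>2) * (c\<^sup>2 + (d::real)\<^sup>2)"
proof -
  have "(a\<^sup>2 + b\<^sup>2) * (c\<^sup>2 + d\<^sup>2) - (a * c + b * d)\<^sup>2 = (a * d - b * c)\<^sup>2"
    by (simp add: power2_eq_square algebra_simps)
  then show ?thesis by (metis diff_ge_0_iff_ge zero_le_power2)
qed

lemma norm_mat2_mult_vec_le: "norm ((A::real^2^2) *v x) \<le> norm A * norm x"
proof (rule power2_le_imp_le)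
  show "(norm (A *v x))\<^sup>2 \<le> (norm A * norm x)\<^sup>2"
    using cauchy_schwarz_2[of "A $ 1 $ 1" "x $ 1" "A $ 1 $ 2" "x $ 2"]
      cauchy_schwarz_2[of "A $ 2 $ 1" "x $ 1" "A $ 2 $ 2" "x $ 2"]
    by (simp add: power_mult_distrib norm_mat2_sq norm_vec2_sq algebra_simps)
qed simp

lemma norm_mat2_mult_le: "norm ((A::real^2^2) ** (B::real^2^2)) \<le> norm A * norm B"
proof (rule power2_le_imp_le)
  show "(norm (A ** B))\<^sup>2 \<le> (norm A * norm B)\<^sup>2"
    using cauchy_schwarz_2[of "A $ 1 $ 1" "B $ 1 $ 1" "A $ 1 $ 2" "B $ 2 $ 1"]
      cauchy_schwarz_2[of "A $ 1 $ 1" "B $ 1 $ 2" "A $ 1 $ 2" "B $ 2 $ 2"]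
      cauchy_schwarz_2[of "A $ 2 $ 1" "B $ 1 $ 1" "A $ 2 $ 2" "B $ 2 $ 1"]
      cauchy_schwarz_2[of "A $ 2 $ 1" "B $ 1 $ 2" "A $ 2 $ 2" "B $ 2 $ 2"]
    by (simp add: power_mult_distrib norm_mat2_sq algebra_simps)
qed simp

lemma abs_nth_le_norm_mat2: "\<bar>(A::real^2^2) $ i $ j\<bar> \<le> norm A"
  by (metis Finite_Cartesian_Product.norm_nth_le order_trans real_norm_def)

lemma norm_mat2_le_entry: "\<exists>i j. norm (A::real^2^2) \<le> 2 * \<bar>A $ i $ j\<bar>"
proof (rule ccontr)
  assume "\<not> ?thesis"
  then have lt: "\<And>i j. (2 * \<bar>A $ i $ j\<bar>)\<^sup>2 < (norm A)\<^sup>2"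
    by (intro power_strict_mono) (auto simp: not_le)
  have "4 * (A $ i $ j)\<^sup>2 < (norm A)\<^sup>2" for i j
    using lt[of i j] by (simp add: power_mult_distrib)
  from this[of 1 1] this[of 1 2] this[of 2 1] this[of 2 2] show False
    using norm_mat2_sq[of A] by linarith
qed

lemma norm_mat2_ge_1:
  assumes "mat2_det (A::real^2^2) = 1" shows "1 \<le> norm A"
proof (rule power2_le_imp_le)
  have "0 \<le> (A $ 1 $ 1 - A $ 2 $ 2)\<^sup>2 + (A $ 1 $ 2 + A $ 2 $ 1)\<^sup>2" by simp
  also have "\<dots> = (norm A)\<^sup>2 - 2 * mat2_det A"
    unfolding norm_mat2_sq mat2_det_def by (simp add: power2_eq_square algebra_simps)
  finally show "1\<^sup>2 \<le> (norm A)\<^sup>2" using assms by simp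
qed simp

text \<open>The adjugate inverts a unimodular matrix and has the same Frobenius norm. Hence such a
  matrix shrinks nothing by more than its own norm.\<close>

lemma mat2_left_inverse:
  assumes "mat2_det (A::real^2^2) = 1"
  obtains B where "norm B = norm A" "B ** A = Finite_Cartesian_Product.mat 1"
proof -
  define B :: "real^2^2" where
    "B = vector [vector [A $ 2 $ 2, - A $ 1 $ 2], vector [- A $ 2 $ 1, A $ 1 $ 1]]"
  have B: "B $ 1 $ 1 = A $ 2 $ 2" "B $ 1 $ 2 = - A $ 1 $ 2"
      "B $ 2 $ 1 = - A $ 2 $ 1" "B $ 2 $ 2 = A $ 1 $ 1"
    by (simp_all add: B_def)
  have "norm B = norm A"
    by (rule power2_eq_imp_eq) (auto simp: norm_mat2_sq B)
  moreover have "B ** A = Finite_Cartesian_Product.mat 1"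
    using assms unfolding mat2_eq_iff by (simp add: B mat2_one_nth mat2_det_def algebra_simps)
  ultimately show ?thesis by (rule that)
qed

lemma norm_le_norm_mat2_mult_vec:
  assumes "mat2_det (A::real^2^2) = 1"
  shows "norm x \<le> norm A * norm (A *v x)"
proof -
  obtain B where B: "norm B = norm A" "B ** A = Finite_Cartesian_Product.mat 1"
    using mat2_left_inverse[OF assms] .
  have "B *v (A *v x) = x" unfolding matrix_vector_mul_assoc B(2) by (rule matrix_vector_mul_lid)
  then show ?thesis using norm_mat2_mult_vec_le[of B "A *v x"] B(1) by simp
qed

lemma norm_le_norm_mat2_mult:
  assumes "mat2_det (B::real^2^2) = 1" shows "norm (A::real^2^2) \<le> norm B * norm (B ** A)"
proof -
  obtain C where C: "norm C = norm B" "C ** B = Finite_Cartesian_Product.mat 1"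
    using mat2_left_inverse[OF assms] .
  have "C ** (B ** A) = A" unfolding matrix_mul_assoc C(2) by (rule matrix_mul_lid)
  then show ?thesis using norm_mat2_mult_le[of C "B ** A"] C(1) by simp
qed

definition wedge :: "real^2 \<Rightarrow> real^2 \<Rightarrow> real" where
  "wedge x y = x $ 1 * y $ 2 - x $ 2 * y $ 1"

lemma wedge_mult: "wedge (A *v x) (A *v y) = mat2_det A * wedge x y"
  by (simp add: wedge_def mat2_det_def algebra_simps)

text \<open>Cramer's rule: the wedge of \<open>x\<close> and \<open>y\<close> times a column of
  \<open>T\<close> is a combination of the images of \<open>x\<close> and \<open>y\<close>. So a
  large \<open>T\<close> must stretch at least one of two transversal vectors.\<close>

lemma wedge_norm_le:
  "\<bar>wedge x y\<bar> * norm (T::real^2^2) \<le> 2 * (norm y * norm (T *v x) + norm x * norm (T *v y))"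
proof -
  obtain i j where ij: "norm T \<le> 2 * \<bar>T $ i $ j\<bar>" using norm_mat2_le_entry by blast
  have c: "\<bar>x $ k\<bar> \<le> norm x" "\<bar>y $ k\<bar> \<le> norm y"
      "\<bar>(T *v x) $ k\<bar> \<le> norm (T *v x)" "\<bar>(T *v y) $ k\<bar> \<le> norm (T *v y)" for k
    using Finite_Cartesian_Product.norm_nth_le real_norm_def by metis+
  have "\<exists>k. \<bar>wedge x y * T $ i $ j\<bar> \<le> \<bar>y $ k\<bar> * \<bar>(T *v x) $ i\<bar> + \<bar>x $ k\<bar> * \<bar>(T *v y) $ i\<bar>"
  proof (cases "j = 1")
    case True
    have "wedge x y * T $ i $ 1 = y $ 2 * (T *v x) $ i - x $ 2 * (T *v y) $ i"
      by (simp add: wedge_def algebra_simps)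
    then show ?thesis using True by (metis abs_mult abs_triangle_ineq4)
  next
    case False
    then have "j = 2" using exhaust_2 by blast
    have "wedge x y * T $ i $ 2 = x $ 1 * (T *v y) $ i - y $ 1 * (T *v x) $ i"
      by (simp add: wedge_def algebra_simps)
    then show ?thesis using \<open>j = 2\<close> by (metis abs_mult abs_triangle_ineq4 add.commute)
  qed
  then obtain k where "\<bar>wedge x y * T $ i $ j\<bar> \<le> \<bar>y $ k\<bar> * \<bar>(T *v x) $ i\<bar> + \<bar>x $ k\<bar> * \<bar>(T *v y) $ i\<bar>"
    by blast
  also have "\<dots> \<le> norm y * norm (T *v x) + norm x * norm (T *v y)"
    by (intro add_mono mult_mono c) auto
  finally have 1: "\<bar>wedge x y\<bar> * \<bar>T $ i $ j\<bar> \<le> norm y * norm (T *v x) + norm x * norm (T *v y)"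
    by (simp add: abs_mult)
  have "\<bar>wedge x y\<bar> * norm T \<le> \<bar>wedge x y\<bar> * (2 * \<bar>T $ i $ j\<bar>)"
    by (intro mult_left_mono ij) auto
  also have "\<dots> = 2 * (\<bar>wedge x y\<bar> * \<bar>T $ i $ j\<bar>)" by simp
  also have "\<dots> \<le> 2 * (norm y * norm (T *v x) + norm x * norm (T *v y))"
    by (intro mult_left_mono 1) simp
  finally show ?thesis .
qed

text \<open>For \<open>det B = 1\<close> one has \<open>(a B c)(x B y) = (a B y)(x B c) + (a \<and> x)(c \<and> y)\<close>; this is applied
  with \<open>a\<close> a row of \<open>A\<close>, \<open>c\<close> a column of \<open>C\<close> and \<open>x, y\<close> coordinate vectors.\<close>

lemma norm_triple_product_ge:
  fixes A B C :: "real^2^2"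
  assumes "mat2_det B = 1"
  shows "norm (A ** B) * norm (B ** C) / 4 - norm A * norm C \<le> norm (A ** B ** C) * norm B"
proof -
  obtain i l where il: "norm (A ** B) \<le> 2 * \<bar>(A ** B) $ i $ l\<bar>" using norm_mat2_le_entry by blast
  obtain k j where kj: "norm (B ** C) \<le> 2 * \<bar>(B ** C) $ k $ j\<bar>" using norm_mat2_le_entry by blast
  \<comment> \<open>Against a coordinate vector a wedge is, up to sign, the entry with the
    complementary index.\<close>
  define k' :: 2 where "k' = (if k = 1 then 2 else 1)"
  define l' :: 2 where "l' = (if l = 1 then 2 else 1)"
  have "\<bar>(A ** B) $ i $ l * (B ** C) $ k $ j\<bar> - \<bar>A $ i $ k' * C $ l' $ j\<bar>
      \<le> \<bar>(A ** B ** C) $ i $ j * B $ k $ l\<bar>"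
  proof -
    have kl: "k = 1 \<or> k = 2" "l = 1 \<or> l = 2" using exhaust_2 by auto
    have "(A ** B) $ i $ l * (B ** C) $ k $ j =
        (A ** B ** C) $ i $ j * B $ k $ l - mat2_det B * (if k = l then 1 else -1) * (A $ i $ k' * C $ l' $ j)
      " using kl by (elim disjE) (simp_all add: k'_def l'_def mat2_det_def algebra_simps)
    then show ?thesis using assms by (auto split: if_splits)
  qed
  also have "\<dots> \<le> norm (A ** B ** C) * norm B"
    unfolding abs_mult by (intro mult_mono abs_nth_le_norm_mat2) auto
  finally have 1: "\<bar>(A ** B) $ i $ l\<bar> * \<bar>(B ** C) $ k $ j\<bar> - \<bar>A $ i $ k'\<bar> * \<bar>C $ l' $ j\<bar>
      \<le> norm (A ** B ** C) * norm B" by (simp only: abs_mult)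
  have "\<bar>A $ i $ k'\<bar> * \<bar>C $ l' $ j\<bar> \<le> norm A * norm C"
    by (intro mult_mono abs_nth_le_norm_mat2) auto
  moreover have "norm (A ** B) * norm (B ** C) \<le> (2 * \<bar>(A ** B) $ i $ l\<bar>) * (2 * \<bar>(B ** C) $ k $ j\<bar>)"
    by (intro mult_mono il kj) auto
  ultimately show ?thesis using 1 by simp
qed

section \<open>The avalanche principle for chains of unimodular matrices\<close>

primrec chain_prod :: "(nat \<Rightarrow> real^2^2) \<Rightarrow> nat \<Rightarrow> real^2^2" where
  "chain_prod B 0 = Finite_Cartesian_Product.mat 1"
| "chain_prod B (Suc n) = B n ** chain_prod B n"

lemma mat2_det_chain_prod:
  "(\<And>i. i < n \<Longrightarrow> mat2_det (B i) = 1) \<Longrightarrow> mat2_det (chain_prod B n) = 1"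
proof (induction n)
  case 0
  show ?case by (simp add: mat2_det_def mat2_one_nth)
qed (auto simp: mat2_det_mult)

lemma schr_prod_eq_chain_prod:
  assumes "\<And>i. i < q \<Longrightarrow> t i \<le> t (Suc i)"
  shows "chain_prod (\<lambda>i. schr_prod (\<lambda>k. u (t i + k)) (t (Suc i) - t i)) q
      = schr_prod (\<lambda>k. u (t 0 + k)) (t q - t 0)"
  using assms
proof (induction q)
  case (Suc q)
  have "t 0 \<le> t m" if "m \<le> q" for m
    using that by (induction m) (use Suc.prems in \<open>auto intro: order_trans\<close>)
  then have "t 0 \<le> t q" by simp
  moreover have "t q \<le> t (Suc q)" using Suc.prems by simp
  ultimately show ?case
    using Suc schr_prod_add[of "\<lambda>k. u (t 0 + k)" "t q - t 0" "t (Suc q) - t q"]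
    by (simp add: add.assoc[symmetric])
qed simp

text \<open>A one-sided avalanche principle: each new factor multiplies the norm by at least
  \<kappa> = W / (8 U). Apply \<open>norm_triple_product_ge\<close> to the next factor, the current
  factor and the prefix before it. The product term contributes 2 \<kappa> times the current norm,
  and the subtracted term costs at most \<kappa> times that norm because the prefix has not been
  larger so far. The 8 is the 4 of that lemma times 2 for this absorption.\<close>

lemma avalanche:
  fixes U W :: real
  assumes det: "\<And>i. i < q \<Longrightarrow> mat2_det (B i) = 1"
    and U: "\<And>i. i < q \<Longrightarrow> norm (B i) \<le> U"
    and W: "\<And>i. Suc i < q \<Longrightarrow> W \<le> norm (B (Suc i) ** B i)"
    and "1 \<le> q" "8 * U \<le> W" "0 < U"
  shows "(W / (8 * U)) ^ (q - 1) \<le> norm (chain_prod B q)"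
proof -
  define P where "P = chain_prod B"
  define \<kappa> where "\<kappa> = W / (8 * U)"
  have \<kappa>: "1 \<le> \<kappa>" using assms by (simp add: \<kappa>_def)
  have step: "\<kappa> * norm (P j) \<le> norm (P (Suc j))" if "1 \<le> j" "Suc j \<le> q" for j
    using that
  proof (induction j rule: nat_induct_at_least)
    case base
    have "norm (P 1) \<le> U" using U[of 0] base by (simp add: P_def)
    then have "\<kappa> * norm (P 1) \<le> \<kappa> * U" using \<kappa> by (intro mult_left_mono) auto
    also have "\<dots> \<le> W" using assms(5,6) by (simp add: \<kappa>_def)
    also have "\<dots> \<le> norm (P (Suc 1))" using W[of 0] base by (simp add: P_def)
    finally show ?case .
  next
    case (Suc j)
    have IH: "\<kappa> * norm (P j) \<le> norm (P (Suc j))" using Suc by simp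
    have dj: "mat2_det (B j) = 1" "norm (B j) \<le> U" "norm (B (Suc j)) \<le> U" "W \<le> norm (B (Suc j) ** B j)"
      using Suc.prems det U W by simp_all
    have "W * norm (P (Suc j)) / 4 - U * norm (P j)
        \<le> norm (B (Suc j) ** B j) * norm (B j ** P j) / 4 - norm (B (Suc j)) * norm (P j)"
      using dj mult_right_mono[OF dj(4), of "norm (B j ** P j)"] mult_right_mono[OF dj(3), of "norm (P j)"]
      by (simp add: P_def)
    also have "\<dots> \<le> norm (P (Suc (Suc j))) * norm (B j)"
      using norm_triple_product_ge[OF dj(1), of "B (Suc j)" "P j"] by (simp add: P_def matrix_mul_assoc)
    also have "\<dots> \<le> norm (P (Suc (Suc j))) * U" by (intro mult_left_mono dj) auto
    finally have 1: "W * norm (P (Suc j)) / 4 - U * norm (P j) \<le> norm (P (Suc (Suc j))) * U" .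
    have W8: "W = 8 * U * \<kappa>" using assms(6) by (simp add: \<kappa>_def)
    have "U * norm (P j) \<le> U * norm (P (Suc j))"
      using IH \<kappa> assms(6) mult_right_mono[OF \<kappa>, of "norm (P j)"] by (intro mult_left_mono) auto
    also have "\<dots> \<le> U * \<kappa> * norm (P (Suc j))"
      using \<kappa> assms(6) mult_right_mono[OF \<kappa>, of "U * norm (P (Suc j))"] by (simp add: mult_ac)
    finally have "U * (\<kappa> * norm (P (Suc j))) \<le> U * norm (P (Suc (Suc j)))"
      using 1 unfolding W8 by (simp add: mult_ac)
    then show ?case using assms(6) by simp
  qed
  have "\<kappa> ^ (j - 1) \<le> norm (P j)" if "1 \<le> j" "j \<le> q" for j
    using that
  proof (induction j rule: nat_induct_at_least)
    case base
    have "mat2_det (P 1) = 1" using det mat2_det_chain_prod[of 1 B] base by (simp add: P_def)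
    then show ?case by (simp add: norm_mat2_ge_1)
  next
    case (Suc j)
    have "\<kappa> ^ (Suc j - 1) = \<kappa> * \<kappa> ^ (j - 1)" using Suc(1) by (cases j) auto
    also have "\<dots> \<le> \<kappa> * norm (P j)" using Suc \<kappa> by (intro mult_left_mono) auto
    also have "\<dots> \<le> norm (P (Suc j))" using step[of j] Suc by simp
    finally show ?case .
  qed
  from this[of q] show ?thesis using assms(4) by (simp add: P_def \<kappa>_def)
qed

subsection \<open>Dependence on the energy\<close>

text \<open>Two step matrices differ by a \<open>corner\<close>, and \<open>corner 1\<close> is the
  derivative of a step in the energy. It has rank one, so inserting it at a site cuts the product
  there.\<close>

definition corner :: "'a::comm_ring_1 \<Rightarrow> 'a^2^2" where
  "corner d = vector [vector [d, 0], vector [0, 0]]"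

lemma corner_nth [simp]:
  "corner d $ 1 $ 1 = d" "corner d $ 1 $ 2 = 0" "corner d $ 2 $ 1 = 0" "corner d $ 2 $ 2 = 0"
  by (simp_all add: corner_def)

lemma norm_corner [simp]: "norm (corner (d::real)) = \<bar>d\<bar>"
  by (rule power2_eq_imp_eq) (auto simp: norm_mat2_sq)

lemma mat2_mult_sum_right:
  fixes A :: "'a::comm_ring_1^2^2" and f :: "'b \<Rightarrow> 'a^2^2"
  shows "A ** (\<Sum>k\<in>I. f k) = (\<Sum>k\<in>I. A ** f k)"
proof (induction I rule: infinite_finite_induct)
  case (insert x F)
  have "A ** (f x + sum f F) = A ** f x + A ** sum f F"
    unfolding mat2_eq_iff by (simp add: algebra_simps)
  with insert show ?case by simp
qed (simp_all add: mat2_eq_iff)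

text \<open>Telescoping over the site at which the factors switch from those of \<open>w\<close> to
  those of \<open>u\<close>.\<close>

lemma schr_prod_diff:
  "schr_prod u n - schr_prod w n =
    (\<Sum>k<n. schr_prod (\<lambda>i. u (Suc k + i)) (n - 1 - k) ** corner (u k - w k) ** schr_prod w k)"
proof (induction n)
  case (Suc n)
  let ?F = "\<lambda>n k. schr_prod (\<lambda>i. u (Suc k + i)) (n - 1 - k) ** corner (u k - w k) ** schr_prod w k"
  have "schr_step (u n) ** ?F n k = ?F (Suc n) k" if "k < n" for k
  proof -
    have "Suc n - 1 - k = Suc (n - 1 - k)" "Suc k + (n - 1 - k) = n" using that by auto
    then show ?thesis by (simp add: matrix_mul_assoc)
  qed
  then have "(\<Sum>k<Suc n. ?F (Suc n) k) = schr_step (u n) ** (\<Sum>k<n. ?F n k) + corner (u n - w n) ** schr_prod w n"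
    by (simp add: mat2_mult_sum_right)
  also have "\<dots> = schr_prod u (Suc n) - schr_prod w (Suc n)"
    unfolding Suc[symmetric] mat2_eq_iff by (simp add: algebra_simps)
  finally show ?case by simp
qed simp

text \<open>Only the product of the norms before and after a site enters. The two lengths add up to
  \<open>n - 1\<close>, so in the main application this product stays near exp(\<gamma> n);
  maximizing the two norms separately would square it.\<close>

lemma norm_schr_prod_diff_le:
  fixes u w :: "nat \<Rightarrow> real"
  assumes "\<And>k. k < n \<Longrightarrow> \<bar>u k - w k\<bar> \<le> \<delta>"
    and "\<And>k. k < n \<Longrightarrow> norm (schr_prod (\<lambda>i. u (Suc k + i)) (n - 1 - k)) * norm (schr_prod w k) \<le> C"
  shows "norm (schr_prod u n - schr_prod w n) \<le> n * (C * \<delta>)"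
proof -
  have "norm (schr_prod u n - schr_prod w n) \<le> (\<Sum>k<n. C * \<delta>)"
    unfolding schr_prod_diff
  proof (rule sum_norm_le)
    fix k assume k: "k \<in> {..<n}"
    let ?a = "norm (schr_prod (\<lambda>i. u (Suc k + i)) (n - 1 - k))" and ?b = "norm (schr_prod w k)"
    have "norm (schr_prod (\<lambda>i. u (Suc k + i)) (n - 1 - k) ** corner (u k - w k) ** schr_prod w k)
        \<le> ?a * \<bar>u k - w k\<bar> * ?b"
      using norm_mat2_mult_le[of "schr_prod (\<lambda>i. u (Suc k + i)) (n - 1 - k)" "corner (u k - w k)"]
      by (intro order_trans[OF norm_mat2_mult_le] mult_right_mono) simp_all
    also have "\<dots> = (?a * ?b) * \<bar>u k - w k\<bar>" by simp
    also have "\<dots> \<le> C * \<delta>"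
      using assms(1,2)[of k] k by (intro mult_mono) (auto intro: order_trans[OF _ assms(2)[of k]])
    finally show "norm (schr_prod (\<lambda>i. u (Suc k + i)) (n - 1 - k) ** corner (u k - w k) ** schr_prod w k)
        \<le> C * \<delta>" .
  qed
  then show ?thesis by simp
qed

text \<open>The product rule for the derivative in the energy, taken as a recursion, so that the
  trace identities below are ring identities.\<close>

primrec schr_deriv :: "(nat \<Rightarrow> 'a::comm_ring_1) \<Rightarrow> nat \<Rightarrow> 'a^2^2" where
  "schr_deriv u 0 = 0"
| "schr_deriv u (Suc n) = corner 1 ** schr_prod u n + schr_step (u n) ** schr_deriv u n"

lemma schr_prod_has_derivative:
  fixes x :: "nat \<Rightarrow> 'a::real_normed_field"
  shows "((\<lambda>z. schr_prod (\<lambda>i. z - x i) n $ a $ b) has_field_derivative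
    schr_deriv (\<lambda>i. z - x i) n $ a $ b) (at z)"
proof (induction n arbitrary: a b)
  case 0
  show ?case by simp
next
  case (Suc n a b)
  have "a = 1 \<or> a = 2" using exhaust_2 by auto
  then show ?case
  proof
    assume a: "a = 1"
    have "((\<lambda>z. z - x n) has_field_derivative 1) (at z)"
      by (auto intro!: derivative_eq_intros)
    from DERIV_diff[OF DERIV_mult[OF this Suc[of 1 b]] Suc[of 2 b]]
    show ?thesis using a by (simp add: algebra_simps)
  next
    assume a: "a = 2"
    show ?thesis unfolding a schr_prod_Suc_nth by (simp, rule Suc)
  qed
qed

lemma schr_deriv_eq_sum:
  "schr_deriv u n =
    (\<Sum>k<n. schr_prod (\<lambda>i. u (Suc k + i)) (n - 1 - k) ** corner 1 ** schr_prod u k)"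
proof (induction n)
  case (Suc n)
  let ?F = "\<lambda>n k. schr_prod (\<lambda>i. u (Suc k + i)) (n - 1 - k) ** corner 1 ** schr_prod u k"
  have "schr_step (u n) ** ?F n k = ?F (Suc n) k" if "k < n" for k
  proof -
    have "Suc n - 1 - k = Suc (n - 1 - k)" "Suc k + (n - 1 - k) = n" using that by auto
    then show ?thesis by (simp add: matrix_mul_assoc)
  qed
  then show ?case
    by (simp add: Suc mat2_mult_sum_right add.commute)
qed simp

lemma trace_sum: "trace (\<Sum>k\<in>I. (f k :: 'a::comm_ring_1^2^2)) = (\<Sum>k\<in>I. trace (f k))"
  by (induction I rule: infinite_finite_induct) (auto simp: mat2_trace)

text \<open>Cutting the ring open behind site \<open>k\<close> turns the \<open>k\<close>-th term of the trace into an entry of a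
  product over the remaining sites.\<close>

lemma trace_schr_deriv:
  "trace (schr_deriv u n) = (\<Sum>k<n. schr_prod (\<lambda>i. u ((Suc k + i) mod n)) (n - 1) $ 1 $ 1)"
  unfolding schr_deriv_eq_sum trace_sum
proof (rule sum.cong)
  fix k assume "k \<in> {..<n}"
  then have k: "k < n" by simp
  define w where "w = (\<lambda>i. u ((Suc k + i) mod n))"
  have "n - 1 = (n - 1 - k) + k" using k by simp
  then have "schr_prod w (n - 1) = schr_prod (\<lambda>i. w (n - 1 - k + i)) k ** schr_prod w (n - 1 - k)"
    by (metis schr_prod_add)
  also have "schr_prod w (n - 1 - k) = schr_prod (\<lambda>i. u (Suc k + i)) (n - 1 - k)"
    by (rule schr_prod_cong) (simp add: w_def)
  also have "schr_prod (\<lambda>i. w (n - 1 - k + i)) k = schr_prod u k"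
    by (rule schr_prod_cong) (use k in \<open>simp add: w_def\<close>)
  finally have "schr_prod w (n - 1) $ 1 $ 1 =
      trace (corner 1 ** (schr_prod u k ** schr_prod (\<lambda>i. u (Suc k + i)) (n - 1 - k)))"
    by (simp add: mat2_trace)
  also have "\<dots> = trace (schr_prod (\<lambda>i. u (Suc k + i)) (n - 1 - k) ** (corner 1 ** schr_prod u k))"
    by (subst trace_mul_sym) (simp add: mat2_trace algebra_simps)
  finally show "trace (schr_prod (\<lambda>i. u (Suc k + i)) (n - 1 - k) ** corner 1 ** schr_prod u k)
      = schr_prod (\<lambda>i. u ((Suc k + i) mod n)) (n - 1) $ 1 $ 1"
    by (simp add: w_def matrix_mul_assoc)
qed simp

text \<open>The derivative of the trace is a sum of values of the quadratic form
  \<open>q(p, r) = - b p\<^sup>2 + (a - d) p r + c r\<^sup>2\<close> of the matrix with rows \<open>(a, b)\<close> and \<open>(c, d)\<close>. Its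
  discriminant is \<open>trace\<^sup>2 - 4\<close>, so at trace \<open>\<plusminus>2\<close> the form is semidefinite and nothing cancels.\<close>

lemma trace_schr_deriv_quadratic:
  fixes u :: "nat \<Rightarrow> 'a::comm_ring_1"
  defines "V \<equiv> schr_prod u"
  shows "trace (schr_deriv u n) =
    (\<Sum>k<n. - V n $ 1 $ 2 * (V k $ 1 $ 1)\<^sup>2 + (V n $ 1 $ 1 - V n $ 2 $ 2) * (V k $ 1 $ 1 * V k $ 1 $ 2)
      + V n $ 2 $ 1 * (V k $ 1 $ 2)\<^sup>2)"
proof -
  define G where "G = schr_deriv u"
  have rec: "V (Suc m) $ 1 $ j = u m * V m $ 1 $ j - V m $ 2 $ j" "V (Suc m) $ 2 $ j = V m $ 1 $ j"
    "G (Suc m) $ 1 $ j = V m $ 1 $ j + u m * G m $ 1 $ j - G m $ 2 $ j" "G (Suc m) $ 2 $ j = G m $ 1 $ j" for m j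
    by (simp_all add: V_def G_def)
  have G0: "G 0 = 0" by (simp add: G_def)
  \<comment> \<open>Up to sign these four combinations are the entries of the inverse of
    \<open>V m\<close> times \<open>G m\<close>. At each site that matrix grows by the inverse of
    \<open>V (Suc k)\<close> times \<open>corner 1 ** V k\<close>, whose entries are quadratic in
    the first row of \<open>V k\<close>.\<close>
  have P: "V m $ 2 $ 1 * G m $ 1 $ 1 - V m $ 1 $ 1 * G m $ 2 $ 1 = (\<Sum>k<m. (V k $ 1 $ 1)\<^sup>2)" for m
    by (induction m) (simp_all add: G0 rec power2_eq_square algebra_simps)
  have Q: "V m $ 2 $ 2 * G m $ 1 $ 1 - V m $ 1 $ 2 * G m $ 2 $ 1 = (\<Sum>k<m. V k $ 1 $ 1 * V k $ 1 $ 2)" for m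
    by (induction m) (simp_all add: G0 rec power2_eq_square algebra_simps)
  have Q': "V m $ 2 $ 1 * G m $ 1 $ 2 - V m $ 1 $ 1 * G m $ 2 $ 2 = (\<Sum>k<m. V k $ 1 $ 1 * V k $ 1 $ 2)" for m
    by (induction m) (simp_all add: G0 rec power2_eq_square algebra_simps)
  have R: "V m $ 2 $ 2 * G m $ 1 $ 2 - V m $ 1 $ 2 * G m $ 2 $ 2 = (\<Sum>k<m. (V k $ 1 $ 2)\<^sup>2)" for m
    by (induction m) (simp_all add: G0 rec power2_eq_square algebra_simps)
  let ?a = "V n $ 1 $ 1" and ?b = "V n $ 1 $ 2" and ?c = "V n $ 2 $ 1" and ?d = "V n $ 2 $ 2"
  have det: "?a * ?d - ?b * ?c = 1"
    using mat2_det_schr_prod[of u n] by (simp add: mat2_det_def V_def)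
  have "trace (G n) = (?a * ?d - ?b * ?c) * (G n $ 1 $ 1 + G n $ 2 $ 2)"
    by (simp add: det mat2_trace)
  also have "\<dots> = - ?b * (V n $ 2 $ 1 * G n $ 1 $ 1 - V n $ 1 $ 1 * G n $ 2 $ 1)
      + ?a * (V n $ 2 $ 2 * G n $ 1 $ 1 - V n $ 1 $ 2 * G n $ 2 $ 1)
      - ?d * (V n $ 2 $ 1 * G n $ 1 $ 2 - V n $ 1 $ 1 * G n $ 2 $ 2)
      + ?c * (V n $ 2 $ 2 * G n $ 1 $ 2 - V n $ 1 $ 2 * G n $ 2 $ 2)"
    by (simp add: algebra_simps)
  also have "\<dots> = - ?b * (\<Sum>k<n. (V k $ 1 $ 1)\<^sup>2) + (?a - ?d) * (\<Sum>k<n. V k $ 1 $ 1 * V k $ 1 $ 2)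
      + ?c * (\<Sum>k<n. (V k $ 1 $ 2)\<^sup>2)"
    unfolding P Q Q' R by (simp add: algebra_simps)
  finally show ?thesis
    by (simp only: G_def sum.distrib sum_distrib_left)
qed

text \<open>All terms of the sum have one sign, so its modulus t dominates every single term. The
  first term is - b, as \<open>V 0\<close> is the identity. The last one is c, because the first row
  of the product before the final step is the row (c, d) and the form takes the value c (a d - b c)
  there. The discriminant identity then gives |a - d| \<le> 2 t, and with |a + d| = 2 each diagonal
  entry is at most 1 + t. Adding the four entries gives 2 + 4 t.\<close>

lemma trace_schr_deriv_ge:
  fixes u :: "nat \<Rightarrow> real"
  assumes "(trace (schr_prod u n))\<^sup>2 = 4" "1 \<le> n"
  shows "(norm (schr_prod u n) - 2) / 4 \<le> \<bar>trace (schr_deriv u n)\<bar>"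
proof -
  define V where "V = schr_prod u"
  let ?a = "V n $ 1 $ 1" and ?b = "V n $ 1 $ 2" and ?c = "V n $ 2 $ 1" and ?d = "V n $ 2 $ 2"
  have det: "?a * ?d - ?b * ?c = 1"
    using mat2_det_schr_prod[of u n] by (simp add: mat2_det_def V_def)
  have tr: "(?a + ?d)\<^sup>2 = 4" using assms(1) by (simp add: mat2_trace V_def)
  have disc: "(?a - ?d)\<^sup>2 = - (4 * (?b * ?c))"
    using det tr by (simp add: power2_eq_square algebra_simps)
  define q where "q p r = - ?b * p\<^sup>2 + (?a - ?d) * (p * r) + ?c * r\<^sup>2" for p r
  have tq: "trace (schr_deriv u n) = (\<Sum>k<n. q (V k $ 1 $ 1) (V k $ 1 $ 2))"
    unfolding trace_schr_deriv_quadratic q_def V_def by simp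
  have qb: "0 \<le> - ?b * q p r" for p r
  proof -
    have "- ?b * q p r = (?b * p - (?a - ?d) * r / 2)\<^sup>2 - r\<^sup>2 * ((?a - ?d)\<^sup>2 + 4 * (?b * ?c)) / 4"
      by (simp add: q_def power2_eq_square field_simps)
    then show ?thesis using disc by simp
  qed
  have qc: "0 \<le> ?c * q p r" for p r
  proof -
    have "?c * q p r = (?c * r + (?a - ?d) * p / 2)\<^sup>2 - p\<^sup>2 * ((?a - ?d)\<^sup>2 + 4 * (?b * ?c)) / 4"
      by (simp add: q_def power2_eq_square field_simps)
    then show ?thesis using disc by simp
  qed
  \<comment> \<open>A term whose value \<open>s\<close> is - b or c also certifies the sign of all
    others, by \<open>qb\<close> and \<open>qc\<close>; multiplying the sum by \<open>s\<close>
    makes every summand nonnegative.\<close>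
  have gen: "\<bar>s\<bar> \<le> \<bar>trace (schr_deriv u n)\<bar>"
    if s: "\<And>p r. 0 \<le> s * q p r" and m: "m < n" "q (V m $ 1 $ 1) (V m $ 1 $ 2) = s" for s m
  proof (cases "s = 0")
    case False
    have "s * s \<le> (\<Sum>k<n. s * q (V k $ 1 $ 1) (V k $ 1 $ 2))"
      using m s member_le_sum[of m "{..<n}" "\<lambda>k. s * q (V k $ 1 $ 1) (V k $ 1 $ 2)"] by simp
    also have "\<dots> = s * trace (schr_deriv u n)" by (simp add: tq sum_distrib_left)
    finally have "\<bar>s\<bar> * \<bar>s\<bar> \<le> \<bar>s\<bar> * \<bar>trace (schr_deriv u n)\<bar>"
      by (metis abs_ge_self abs_mult abs_mult_self_eq order_trans)
    then show ?thesis using False by (metis mult_le_cancel_left_pos zero_less_abs_iff)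
  qed simp
  have b: "\<bar>?b\<bar> \<le> \<bar>trace (schr_deriv u n)\<bar>"
    using gen[of "- ?b" 0] qb assms(2) by (simp add: q_def V_def mat2_one_nth)
  have c: "\<bar>?c\<bar> \<le> \<bar>trace (schr_deriv u n)\<bar>"
  proof -
    obtain m where n: "n = Suc m" using assms(2) by (cases n) auto
    have m: "V m $ 1 $ 1 = ?c" "V m $ 1 $ 2 = ?d" by (simp_all add: n V_def)
    have "q ?c ?d = ?c * (?a * ?d - ?b * ?c)" by (simp add: q_def power2_eq_square algebra_simps)
    then have "q ?c ?d = ?c" by (simp add: det)
    then show ?thesis using gen[of ?c m] qc m n by simp
  qed
  let ?t = "\<bar>trace (schr_deriv u n)\<bar>"
  have "\<bar>?b * ?c\<bar> \<le> ?t * ?t" unfolding abs_mult by (intro mult_mono b c) auto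
  then have "(?a - ?d)\<^sup>2 \<le> (2 * ?t)\<^sup>2" unfolding disc by (simp add: power2_eq_square)
  then have ad: "\<bar>?a - ?d\<bar> \<le> 2 * ?t" using abs_le_square_iff[of "?a - ?d" "2 * ?t"] by simp
  have "?a + ?d = 2 \<or> ?a + ?d = - 2" using tr power2_eq_iff[of "?a + ?d" 2] by simp
  then have "\<bar>?a + ?d\<bar> = 2" by auto
  then have "\<bar>?a\<bar> \<le> 1 + ?t" "\<bar>?d\<bar> \<le> 1 + ?t" using ad by linarith+
  moreover have "norm (V n) \<le> \<bar>?a\<bar> + \<bar>?b\<bar> + \<bar>?c\<bar> + \<bar>?d\<bar>"
  proof -
    have "norm (V n) \<le> (\<Sum>i\<in>UNIV. norm (V n $ i))" by (simp add: norm_vec_def L2_set_le_sum)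
    also have "\<dots> \<le> \<bar>?a\<bar> + \<bar>?b\<bar> + \<bar>?c\<bar> + \<bar>?d\<bar>"
      using L2_set_le_sum[of UNIV "\<lambda>j. norm (V n $ 1 $ j)"] L2_set_le_sum[of UNIV "\<lambda>j. norm (V n $ 2 $ j)"]
      by (simp add: sum_2 norm_vec_def)
    finally show ?thesis .
  qed
  ultimately show ?thesis using b c by (simp add: V_def)
qed

section \<open>Growth of vectors under random products\<close>

text \<open>A step with letter t sends a direction with ratio \<sigma> = z2 / z1 to one whose first
  coordinate divided by its second is E - t - \<sigma>. Append the smaller letter \<open>a\<close>
  to all words, which preserves wedges, and append \<open>b\<close> to the word with the largest
  \<sigma>: its new ratio lies strictly below all others. So every additional letter yields one
  additional direction.\<close>

lemma schr_word_step:
  fixes a b E :: real and y :: "real^2"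
  defines "Z \<equiv> \<lambda>w n. schr_prod (\<lambda>k. E - w k) n *v y"
  assumes "a < b" "y \<noteq> 0"
  shows "\<exists>w::nat \<Rightarrow> nat \<Rightarrow> real. (\<forall>i k. w i k \<in> {a, b}) \<and>
    (\<forall>i\<le>N. \<forall>j\<le>N. i \<noteq> j \<longrightarrow> wedge (Z (w i) (Suc N)) (Z (w j) (Suc N)) \<noteq> 0) \<and>
    (\<exists>i\<le>N. Z (w i) (Suc N) $ 1 \<noteq> 0)"
proof (induction N)
  case 0
  have "\<exists>t\<in>{a, b}. (E - t) * y $ 1 - y $ 2 \<noteq> 0"
  proof (rule ccontr)
    assume "\<not> ?thesis"
    then have e: "(E - a) * y $ 1 = y $ 2" "(E - b) * y $ 1 = y $ 2" by auto
    have "(b - a) * y $ 1 = (E - a) * y $ 1 - (E - b) * y $ 1" by (simp add: algebra_simps)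
    also have "\<dots> = 0" unfolding e by simp
    finally have "(b - a) * y $ 1 = 0" .
    then have "y $ 1 = 0" using assms by simp
    then have "y = 0" using e by (simp add: Finite_Cartesian_Product.vec_eq_iff forall_2)
    then show False using assms by simp
  qed
  then obtain t where t: "t \<in> {a, b}" "(E - t) * y $ 1 - y $ 2 \<noteq> 0" by blast
  then show ?case
    by (intro exI[of _ "\<lambda>i k. t"]) (simp add: Z_def mat2_one_nth)
next
  case (Suc N)
  then obtain w where w: "\<And>i k. w i k \<in> {a, b}"
      and sep: "\<And>i j. i \<le> N \<Longrightarrow> j \<le> N \<Longrightarrow> i \<noteq> j \<Longrightarrow> wedge (Z (w i) (Suc N)) (Z (w j) (Suc N)) \<noteq> 0"
      and ex: "\<exists>i\<le>N. Z (w i) (Suc N) $ 1 \<noteq> 0" by blast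
  define z where "z i = Z (w i) (Suc N)" for i
  \<comment> \<open>Directions with first coordinate 0 have no finite ratio. The step gives them
    second coordinate 0, which already separates them from the new direction. The last clause of the
    induction hypothesis keeps \<open>I\<close> nonempty.\<close>
  define I where "I = {i. i \<le> N \<and> z i $ 1 \<noteq> 0}"
  have "finite I" "I \<noteq> {}" using ex by (auto simp: I_def z_def)
  then obtain i0 where i0: "i0 \<in> I"
      "(MAX i\<in>I. z i $ 2 / z i $ 1) = z i0 $ 2 / z i0 $ 1"
    by (rule obtains_MAX)
  have i0_max: "z i $ 2 / z i $ 1 \<le> z i0 $ 2 / z i0 $ 1" if "i \<in> I" for i
    unfolding i0(2)[symmetric] using \<open>finite I\<close> that by (intro Max_ge) auto
  define w' where "w' i = (if i \<le> N then (w i)(Suc N := a) else (w i0)(Suc N := b))" for i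
  have zt: "Z (u(Suc N := t)) (Suc (Suc N)) = schr_step (E - t) *v Z u (Suc N)" for u t
  proof -
    have "schr_prod (\<lambda>k. E - (u(Suc N := t)) k) (Suc N) = schr_prod (\<lambda>k. E - u k) (Suc N)"
      by (rule schr_prod_cong) simp
    then show ?thesis
      by (simp add: Z_def matrix_vector_mul_assoc del: schr_prod.simps(2)) (simp add: matrix_vector_mul_assoc)
  qed
  have znz: "z i \<noteq> 0" for i
  proof
    assume "z i = 0"
    then have "norm y \<le> 0"
      using norm_le_norm_mat2_mult_vec[of "schr_prod (\<lambda>k. E - w i k) (Suc N)" y]
      by (simp add: z_def Z_def del: schr_prod.simps)
    then show False using assms by simp
  qed
  have new: "wedge (schr_step (E - a) *v z i) (schr_step (E - b) *v z i0) \<noteq> 0" if "i \<le> N" for i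
  proof -
    have e: "wedge (schr_step (E - a) *v z i) (schr_step (E - b) *v z i0)
        = (b - a) * z i $ 1 * z i0 $ 1 - z i $ 2 * z i0 $ 1 + z i $ 1 * z i0 $ 2"
      by (simp add: wedge_def algebra_simps)
    have i0': "z i0 $ 1 \<noteq> 0" using i0 by (simp add: I_def)
    show ?thesis
    proof (cases "z i $ 1 = 0")
      case True
      then have "z i $ 2 \<noteq> 0" using znz[of i] by (auto simp: Finite_Cartesian_Product.vec_eq_iff forall_2)
      then show ?thesis using e True i0' by simp
    next
      case False
      then have "0 < (b - a) - z i $ 2 / z i $ 1 + z i0 $ 2 / z i0 $ 1"
        using i0_max[of i] that assms by (simp add: I_def)
      moreover have "(b - a) * z i $ 1 * z i0 $ 1 - z i $ 2 * z i0 $ 1 + z i $ 1 * z i0 $ 2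
        = z i $ 1 * z i0 $ 1 * ((b - a) - z i $ 2 / z i $ 1 + z i0 $ 2 / z i0 $ 1)"
        using False i0' by (simp add: field_simps)
      ultimately show ?thesis using e False i0' by simp
    qed
  qed
  have sep': "wedge (Z (w' i) (Suc (Suc N))) (Z (w' j) (Suc (Suc N))) \<noteq> 0"
    if ij: "i \<le> Suc N" "j \<le> Suc N" "i \<noteq> j" for i j
  proof -
    have sw: "wedge p q \<noteq> 0 \<Longrightarrow> wedge q p \<noteq> 0" for p q by (simp add: wedge_def mult.commute)
    consider "i \<le> N" "j \<le> N" | "i \<le> N" "j = Suc N" | "i = Suc N" "j \<le> N"
      using ij by linarith
    then show ?thesis
    proof cases
      case 1
      then show ?thesis using sep[of i j] ij
        by (simp only: w'_def zt if_True wedge_mult) simp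
    next
      case 2
      then show ?thesis using new[of i] by (simp add: w'_def zt z_def del: mat2_mult_vec_nth)
    next
      case 3
      then show ?thesis using sw[OF new[of j]] by (simp add: w'_def zt z_def del: mat2_mult_vec_nth)
    qed
  qed
  moreover have "\<exists>i\<le>Suc N. Z (w' i) (Suc (Suc N)) $ 1 \<noteq> 0"
  proof (rule ccontr)
    assume "\<not> ?thesis"
    then have "Z (w' 0) (Suc (Suc N)) $ 1 = 0" "Z (w' 1) (Suc (Suc N)) $ 1 = 0" by auto
    then have "wedge (Z (w' 0) (Suc (Suc N))) (Z (w' 1) (Suc (Suc N))) = 0"
      by (simp only: wedge_def mult_zero_left mult_zero_right diff_self)
    then show False using sep'[of 0 1] by simp
  qed
  moreover have "\<forall>i k. w' i k \<in> {a, b}" using w by (auto simp: w'_def)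
  ultimately show ?case by blast
qed

lemma tendsto_schr_prod_nth:
  assumes "(e \<longlongrightarrow> (E::real)) F"
  shows "((\<lambda>n. schr_prod (\<lambda>k. e n - w k) m $ i $ j) \<longlongrightarrow> schr_prod (\<lambda>k. E - w k) m $ i $ j) F"
proof (induction m arbitrary: i j)
  case (Suc m i j)
  have "i = 1 \<or> i = 2" using exhaust_2 by auto
  then show ?case
    by (elim disjE) (auto intro!: tendsto_intros assms Suc)
qed simp

text \<open>Compactness of the energy interval times the unit circle. Counterexamples to every
  \<theta> would accumulate at some (E, y0); the words found there keep their wedges away from 0
  nearby, because for fixed words the wedges are continuous.\<close>

lemma schr_words_uniform:
  fixes a b R :: real
  assumes "a < b"
  shows "\<exists>\<theta>>0. \<forall>E. \<bar>E\<bar> \<le> R \<longrightarrow> (\<forall>y::real^2. norm y = 1 \<longrightarrow>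
    (\<exists>w::nat \<Rightarrow> nat \<Rightarrow> real. (\<forall>i k. w i k \<in> {a, b}) \<and>
      (\<forall>i\<le>N. \<forall>j\<le>N. i \<noteq> j \<longrightarrow>
        \<theta> \<le> \<bar>wedge (schr_prod (\<lambda>k. E - w i k) (Suc N) *v y) (schr_prod (\<lambda>k. E - w j k) (Suc N) *v y)\<bar>)))"
    (is "\<exists>\<theta>>0. \<forall>E. _ \<longrightarrow> (\<forall>y. _ \<longrightarrow> ?P \<theta> E y)")
proof (rule ccontr)
  assume "\<not> ?thesis"
  then have "\<forall>n. \<exists>E y. \<bar>E\<bar> \<le> R \<and> norm y = 1 \<and> \<not> ?P (inverse (real (Suc n))) E y"
    by (metis inverse_positive_iff_positive of_nat_0_less_iff zero_less_Suc)
  then obtain e y where ey: "\<And>n. \<bar>e n\<bar> \<le> R" "\<And>n. norm (y n) = 1"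
      "\<And>n. \<not> ?P (inverse (real (Suc n))) (e n) (y n)" by metis
  have "compact ({-R..R} \<times> sphere (0::real^2) 1)" by (intro compact_Times) auto
  moreover have "\<forall>n. (e n, y n) \<in> {-R..R} \<times> sphere (0::real^2) 1"
    using ey by (auto simp: abs_le_iff) (metis minus_le_iff)+
  ultimately obtain l r where l: "l \<in> {-R..R} \<times> sphere (0::real^2) 1" "strict_mono (r::nat\<Rightarrow>nat)"
      "((\<lambda>n. (e n, y n)) \<circ> r) \<longlonglongrightarrow> l"
    unfolding compact_def by meson
  obtain E y0 where lE: "l = (E, y0)" by (cases l)
  have conv: "(\<lambda>n. e (r n)) \<longlonglongrightarrow> E" "(\<lambda>n. y (r n)) \<longlonglongrightarrow> y0"
    using tendsto_fst[OF l(3)] tendsto_snd[OF l(3)] by (simp_all add: lE o_def)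
  have "y0 \<noteq> 0" using l(1) lE by auto
  from schr_word_step[OF assms this, where E=E and N=N] obtain w where w: "\<And>i k. w i k \<in> {a, b}"
      and sep: "\<And>i j. i \<le> N \<Longrightarrow> j \<le> N \<Longrightarrow> i \<noteq> j \<Longrightarrow>
        wedge (schr_prod (\<lambda>k. E - w i k) (Suc N) *v y0) (schr_prod (\<lambda>k. E - w j k) (Suc N) *v y0) \<noteq> 0"
    by blast
  let ?w = "\<lambda>E y i j. wedge (schr_prod (\<lambda>k. E - w i k) (Suc N) *v y) (schr_prod (\<lambda>k. E - w j k) (Suc N) *v y)"
  have lim: "(\<lambda>n. ?w (e (r n)) (y (r n)) i j) \<longlonglongrightarrow> ?w E y0 i j" for i j
    unfolding wedge_def mat2_mult_vec_nth
    by (intro tendsto_diff tendsto_mult tendsto_add tendsto_schr_prod_nth conv tendsto_vec_nth)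
  have ev: "\<forall>\<^sub>F n in sequentially. inverse (real (Suc (r n))) \<le> \<bar>?w (e (r n)) (y (r n)) i j\<bar>"
    if "i \<le> N" "j \<le> N" "i \<noteq> j" for i j
  proof -
    have "(\<lambda>n. inverse (real (Suc (r n)))) \<longlonglongrightarrow> 0"
      using LIMSEQ_subseq_LIMSEQ[OF LIMSEQ_inverse_real_of_nat l(2)] by (simp add: o_def)
    from tendsto_diff[OF tendsto_rabs[OF lim[of i j]] this]
    have "(\<lambda>n. \<bar>?w (e (r n)) (y (r n)) i j\<bar> - inverse (real (Suc (r n)))) \<longlonglongrightarrow> \<bar>?w E y0 i j\<bar> - 0" .
    from order_tendstoD(1)[OF this, of 0] have
      "\<forall>\<^sub>F n in sequentially. 0 < \<bar>?w (e (r n)) (y (r n)) i j\<bar> - inverse (real (Suc (r n)))"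
      using sep[OF that] by simp
    then show ?thesis by eventually_elim simp
  qed
  have "\<forall>\<^sub>F n in sequentially. \<forall>i\<in>{..N}. \<forall>j\<in>{..N}. i \<noteq> j \<longrightarrow>
      inverse (real (Suc (r n))) \<le> \<bar>?w (e (r n)) (y (r n)) i j\<bar>"
  proof (intro eventually_ball_finite ballI finite_atMost)
    fix i j assume "i \<in> {..N}" "j \<in> {..N}"
    then show "\<forall>\<^sub>F n in sequentially. i \<noteq> j \<longrightarrow>
        inverse (real (Suc (r n))) \<le> \<bar>?w (e (r n)) (y (r n)) i j\<bar>"
      using ev[of i j] by (cases "i = j") auto
  qed
  then obtain n where "\<forall>i\<in>{..N}. \<forall>j\<in>{..N}. i \<noteq> j \<longrightarrow>
      inverse (real (Suc (r n))) \<le> \<bar>?w (e (r n)) (y (r n)) i j\<bar>"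
    using eventually_sequentially by auto
  then have "?P (inverse (real (Suc (r n)))) (e (r n)) (y (r n))"
    using w by (intro exI[of _ w]) (simp del: schr_prod.simps)
  then show False using ey(3) by blast
qed

lemma wedge_diff_le:
  "\<bar>wedge p q - wedge p' q'\<bar> \<le> 2 * (norm (p - p') * norm q + norm p' * norm (q - q'))"
proof -
  have c: "\<bar>x $ k\<bar> \<le> norm x" for x :: "real^2" and k
    using Finite_Cartesian_Product.norm_nth_le real_norm_def by metis
  have e: "wedge p q - wedge p' q' =
      ((p - p') $ 1 * q $ 2 - (p - p') $ 2 * q $ 1) + (p' $ 1 * (q - q') $ 2 - p' $ 2 * (q - q') $ 1)"
    by (simp add: wedge_def algebra_simps)
  have "\<bar>s $ i * t $ j\<bar> \<le> norm s * norm t" for s t :: "real^2" and i j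
    unfolding abs_mult by (intro mult_mono c) auto
  note b = this
  have tri: "\<bar>(A - B) + (C - D)\<bar> \<le> \<bar>A\<bar> + \<bar>B\<bar> + \<bar>C\<bar> + \<bar>D\<bar>" for A B C D :: real by linarith
  have "\<bar>wedge p q - wedge p' q'\<bar> \<le> norm (p - p') * norm q + norm (p - p') * norm q
      + norm p' * norm (q - q') + norm p' * norm (q - q')"
    unfolding e by (rule order_trans[OF tri]) (intro add_mono b)
  then show ?thesis by (simp add: algebra_simps)
qed

text \<open>The potential is \<open>c\<close> applied to samples of \<open>\<nu>\<close>; \<open>c\<close> will be a truncation, so that bounds that
  are only almost sure for the given variables hold everywhere.\<close>

locale random_potential =
  fixes \<nu> :: "real measure" and c :: "real \<Rightarrow> real" and K R :: real
  assumes prob_\<nu>: "prob_space \<nu>" and sets_\<nu>: "sets \<nu> = sets borel"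
    and c_measurable [measurable]: "c \<in> borel_measurable borel"
    and c_bound: "\<And>t. \<bar>c t\<bar> \<le> K"
    and R_nonneg: "0 \<le> R"
begin

sublocale nu: prob_space \<nu> by (rule prob_\<nu>)
sublocale sequence_space \<nu> by unfold_locales

declare sets_\<nu> [measurable_cong]

abbreviation V :: "real \<Rightarrow> (nat \<Rightarrow> real) \<Rightarrow> nat \<Rightarrow> real^2^2" where
  "V E x n \<equiv> schr_prod (\<lambda>i. E - c (x i)) n"

text \<open>Bounds the Frobenius norm of one step, as (R + K)^2 + 2 is at most \<open>L\<close>
  squared, and is at least 2, so that \<open>ln L\<close> is positive.\<close>

definition L :: real where "L = R + K + 2"

lemma K_nonneg: "0 \<le> K" using c_bound[of 0] by linarith

lemma L_ge_2: "2 \<le> L" using K_nonneg R_nonneg by (simp add: L_def)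

lemma space_S [simp]: "space S = UNIV"
proof -
  have "space \<nu> = UNIV" using sets_eq_imp_space_eq[OF sets_\<nu>] by simp
  then show ?thesis by (simp add: space_PiM)
qed

lemma c_coord_measurable [measurable]: "(\<lambda>x. c (x i)) \<in> borel_measurable S"
proof -
  have "(\<lambda>x. x i) \<in> measurable S \<nu>" by (rule measurable_component_singleton) simp
  then have "(\<lambda>x. x i) \<in> measurable S borel" by (simp cong: measurable_cong_sets add: sets_\<nu>)
  then show ?thesis by measurable
qed

lemma V_nth_measurable [measurable]: "(\<lambda>x. V E x n $ i $ j) \<in> borel_measurable S"
proof (induction n arbitrary: i j)
  case (Suc n i j)
  note [measurable] = Suc
  have "i = 1 \<or> i = 2" using exhaust_2 by auto
  then show ?case by (elim disjE) simp_all
qed simp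

lemma norm_mat2_sqrt:
  "norm (A::real^2^2) = sqrt ((A $ 1 $ 1)\<^sup>2 + (A $ 1 $ 2)\<^sup>2 + (A $ 2 $ 1)\<^sup>2 + (A $ 2 $ 2)\<^sup>2)"
  by (rule real_sqrt_unique[symmetric]) (simp_all add: norm_mat2_sq)

lemma norm_vec2_sqrt: "norm (y::real^2) = sqrt ((y $ 1)\<^sup>2 + (y $ 2)\<^sup>2)"
  by (rule real_sqrt_unique[symmetric]) (simp_all add: norm_vec2_sq)

lemma norm_V_measurable [measurable]: "(\<lambda>x. norm (V E x n)) \<in> borel_measurable S"
  unfolding norm_mat2_sqrt by measurable

lemma norm_V_vec_measurable [measurable]:
  assumes "f \<in> measurable M' S" "(\<lambda>x. g x $ 1) \<in> borel_measurable M'"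
    "(\<lambda>x. g x $ 2) \<in> borel_measurable M'"
  shows "(\<lambda>x. norm (V E (f x) n *v g x)) \<in> borel_measurable M'"
proof -
  have [measurable]: "(\<lambda>x. V E (f x) n $ i $ j) \<in> borel_measurable M'" for i j
    using measurable_compose[OF assms(1) V_nth_measurable] .
  note [measurable] = assms(2,3)
  show ?thesis unfolding norm_vec2_sqrt mat2_mult_vec_nth by measurable
qed

lemma norm_V_pos [simp]: "1 \<le> norm (V E x n)" "V E x n \<noteq> 0" "0 < norm (V E x n)"
proof -
  show *: "1 \<le> norm (V E x n)" by (rule norm_mat2_ge_1) simp
  then show "V E x n \<noteq> 0" "0 < norm (V E x n)" by auto
qed

lemma norm_schr_prod_le:
  assumes "\<And>i. i < n \<Longrightarrow> \<bar>u i\<bar> \<le> R + K"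
  shows "norm (schr_prod u n) \<le> 2 * L ^ n"
  using assms
proof (induction n)
  case 0
  have "norm (schr_prod u 0 :: real^2^2) \<le> 2"
    by (rule power2_le_imp_le) (simp_all add: norm_mat2_sq mat2_one_nth)
  then show ?case by simp
next
  case (Suc n)
  have "norm (schr_step (u n)) \<le> L"
  proof (rule power2_le_imp_le)
    have "(u n)\<^sup>2 \<le> (R + K)\<^sup>2" using Suc(2)[of n] abs_le_square_iff[of "u n" "R + K"] R_nonneg K_nonneg by simp
    then have "(norm (schr_step (u n)))\<^sup>2 \<le> (R + K)\<^sup>2 + 2" by (simp add: norm_mat2_sq)
    also have "\<dots> \<le> L\<^sup>2"
      using R_nonneg K_nonneg unfolding L_def power2_sum[of "R + K" 2] by simp
    finally show "(norm (schr_step (u n)))\<^sup>2 \<le> L\<^sup>2" .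
  qed (use L_ge_2 in simp)
  then have "norm (schr_prod u (Suc n)) \<le> L * (2 * L ^ n)"
    unfolding schr_prod.simps
    by (intro order_trans[OF norm_mat2_mult_le] mult_mono Suc) (use Suc(2) L_ge_2 in auto)
  then show ?case by (simp add: mult_ac)
qed

lemma norm_V_le: "\<bar>E\<bar> \<le> R \<Longrightarrow> norm (V E x n) \<le> 2 * L ^ n"
  by (rule norm_schr_prod_le) (meson abs_triangle_ineq4 add_mono c_bound order_trans)

lemma norm_V_vec_bounds:
  assumes "\<bar>E\<bar> \<le> R" "y \<noteq> 0"
  shows "norm (V E x n *v y) / norm y \<le> 2 * L ^ n" "1 / (2 * L ^ n) \<le> norm (V E x n *v y) / norm y"
    "0 < norm (V E x n *v y)"
    "norm (V E x n *v y) / norm y \<le> norm (V E x n)" "1 / norm (V E x n) \<le> norm (V E x n *v y) / norm y"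
proof -
  have y: "0 < norm y" using assms by simp
  have *: "norm (V E x n *v y) / norm y \<le> norm (V E x n)"
    using norm_mat2_mult_vec_le[of "V E x n" y] y by (simp add: pos_divide_le_eq)
  then show "norm (V E x n *v y) / norm y \<le> norm (V E x n)" .
  show "norm (V E x n *v y) / norm y \<le> 2 * L ^ n" using * norm_V_le[OF assms(1), of x n] by linarith
  have **: "norm y \<le> norm (V E x n) * norm (V E x n *v y)"
    by (rule norm_le_norm_mat2_mult_vec) simp
  then show ***: "1 / norm (V E x n) \<le> norm (V E x n *v y) / norm y"
    using y norm_V_pos(3)[of E x n] by (simp add: field_simps)
  have "1 / (2 * L ^ n) \<le> 1 / norm (V E x n)"
    using norm_V_le[OF assms(1), of x n] L_ge_2 by (intro divide_left_mono) auto
  then show "1 / (2 * L ^ n) \<le> norm (V E x n *v y) / norm y" using *** by linarith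
  show "0 < norm (V E x n *v y)"
  proof (rule ccontr)
    assume "\<not> ?thesis"
    then have "norm (V E x n *v y) = 0" by (simp add: not_less)
    then have "norm y \<le> 0" using ** by (simp only: mult_zero_right)
    then show False using y by linarith
  qed
qed

lemma S_integrable_bounded:
  fixes f :: "(nat \<Rightarrow> real) \<Rightarrow> real"
  assumes "f \<in> borel_measurable S" "\<And>x. \<bar>f x\<bar> \<le> B"
  shows "integrable S f"
  by (rule P.integrable_const_bound[of _ B]) (use assms in auto)

text \<open>Independence as Fubini: \<open>comb_seq k x y\<close> takes its first \<open>k\<close>
  coordinates from \<open>x\<close> and continues with \<open>y\<close>, and it is distributed like
  one sequence when \<open>x\<close> and \<open>y\<close> are independent.\<close>

lemma S_integral_split:
  fixes f :: "(nat \<Rightarrow> real) \<Rightarrow> real"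
  assumes [measurable]: "f \<in> borel_measurable S" and "\<And>x. \<bar>f x\<bar> \<le> B"
  shows "(\<integral>x. f x \<partial>S) = (\<integral>x. (\<integral>y. f (comb_seq k x y) \<partial>S) \<partial>S)"
proof -
  interpret PP: pair_prob_space S S ..
  have "(\<integral>x. f x \<partial>S) = (\<integral>x. f x \<partial>distr (S \<Otimes>\<^sub>M S) S (\<lambda>(x, y). comb_seq k x y))"
    by (simp add: PiM_comb_seq)
  also have "\<dots> = (\<integral>p. f (case p of (x, y) \<Rightarrow> comb_seq k x y) \<partial>(S \<Otimes>\<^sub>M S))"
    by (rule integral_distr[OF measurable_comb_seq assms(1)])
  also have "\<dots> = (\<integral>p. (case p of (x, y) \<Rightarrow> f (comb_seq k x y)) \<partial>(S \<Otimes>\<^sub>M S))"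
    by (intro Bochner_Integration.integral_cong) auto
  also have "\<dots> = (\<integral>x. (\<integral>y. f (comb_seq k x y) \<partial>S) \<partial>S)"
  proof (rule PP.integral_fst[symmetric])
    show "integrable (S \<Otimes>\<^sub>M S) (\<lambda>(x, y). f (comb_seq k x y))"
      by (rule PP.integrable_const_bound[of _ B]) (use assms in auto)
  qed
  finally show ?thesis .
qed

lemma V_comb_seq:
  "V E (comb_seq k x y) (k + n) = V E y n ** V E x k" "m \<le> k \<Longrightarrow> V E (comb_seq k x y) m = V E x m"
proof -
  show *: "V E (comb_seq k x y) m = V E x m" if "m \<le> k" for m
    by (rule schr_prod_cong) (use that in \<open>simp add: comb_seq_def\<close>)
  have "schr_prod (\<lambda>i. E - c (comb_seq k x y (k + i))) n = V E y n"
    by (rule schr_prod_cong) (simp add: comb_seq_def)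
  then show "V E (comb_seq k x y) (k + n) = V E y n ** V E x k"
    unfolding schr_prod_add *[OF order_refl] by simp
qed

subsection \<open>Mean logarithmic growth\<close>

definition mean_log :: "nat \<Rightarrow> real \<Rightarrow> real" where
  "mean_log n E = (\<integral>x. ln (norm (V E x n)) \<partial>S)"

text \<open>Of degree 0 in \<open>y\<close>, so the image of a vector can serve as the next starting
  vector without being normalized.\<close>

definition mean_log_vec :: "nat \<Rightarrow> real \<Rightarrow> real^2 \<Rightarrow> real" where
  "mean_log_vec n E y = (\<integral>x. ln (norm (V E x n *v y) / norm y) \<partial>S)"

definition log_bound :: "nat \<Rightarrow> real" where "log_bound n = ln 2 + n * ln L"

lemma log_bound_nonneg: "0 \<le> log_bound n" using L_ge_2 by (simp add: log_bound_def)

lemma ln_bound_eq: "ln (2 * L ^ n) = log_bound n"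
  using L_ge_2 by (simp add: ln_mult ln_realpow log_bound_def)

lemma ln_norm_V_le:
  assumes "\<bar>E\<bar> \<le> R" shows "\<bar>ln (norm (V E x n))\<bar> \<le> log_bound n" "0 \<le> ln (norm (V E x n))"
proof -
  show p: "0 \<le> ln (norm (V E x n))" by simp
  have "ln (norm (V E x n)) \<le> ln (2 * L ^ n)"
    using norm_V_le[OF assms] L_ge_2 by (subst ln_le_cancel_iff) auto
  then show "\<bar>ln (norm (V E x n))\<bar> \<le> log_bound n" using p by (simp add: ln_bound_eq)
qed

lemma ln_norm_V_vec_le:
  assumes "\<bar>E\<bar> \<le> R" "y \<noteq> 0" 
  shows "\<bar>ln (norm (V E x n *v y) / norm y)\<bar> \<le> log_bound n"
    "ln (norm (V E x n *v y) / norm y) \<le> ln (norm (V E x n))"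
    "- ln (norm (V E x n)) \<le> ln (norm (V E x n *v y) / norm y)"
proof -
  have pos: "0 < norm (V E x n *v y) / norm y" using norm_V_vec_bounds(3)[OF assms] assms by simp
  have "ln (norm (V E x n *v y) / norm y) \<le> ln (norm (V E x n))"
    using norm_V_vec_bounds(4)[OF assms] pos by (subst ln_le_cancel_iff) auto
  moreover have "ln (1 / norm (V E x n)) \<le> ln (norm (V E x n *v y) / norm y)"
    using norm_V_vec_bounds(5)[OF assms] pos by (subst ln_le_cancel_iff) auto
  moreover have "ln (1 / norm (V E x n)) = - ln (norm (V E x n))" by (simp add: ln_div)
  ultimately show "ln (norm (V E x n *v y) / norm y) \<le> ln (norm (V E x n))"
    "- ln (norm (V E x n)) \<le> ln (norm (V E x n *v y) / norm y)"
    "\<bar>ln (norm (V E x n *v y) / norm y)\<bar> \<le> log_bound n"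
    using ln_norm_V_le[OF assms(1), of x n] by linarith+
qed

lemma ln_norm_V_vec_measurable [measurable]:
  "(\<lambda>x. ln (norm (V E x n *v y) / norm y)) \<in> borel_measurable S"
proof -
  have [measurable]: "(\<lambda>x. norm (V E x n *v y)) \<in> borel_measurable S"
    by (rule norm_V_vec_measurable[where f="\<lambda>x. x"]) auto
  show ?thesis by measurable
qed

lemma integrable_ln_norm_V [simp]:
  "\<bar>E\<bar> \<le> R \<Longrightarrow> integrable S (\<lambda>x. ln (norm (V E x n)))"
  "\<bar>E\<bar> \<le> R \<Longrightarrow> y \<noteq> 0 \<Longrightarrow> integrable S (\<lambda>x. ln (norm (V E x n *v y) / norm y))"
  by (rule S_integrable_bounded[where B="log_bound n"]; use ln_norm_V_le ln_norm_V_vec_le in simp)+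

lemma mean_log_nonneg: "\<bar>E\<bar> \<le> R \<Longrightarrow> 0 \<le> mean_log n E"
  unfolding mean_log_def using ln_norm_V_le(2) by (intro Bochner_Integration.integral_nonneg) auto

lemma measure_S_UNIV [simp]: "measure S UNIV = 1"
  using P.prob_space by simp

lemma integral_le_bound:
  assumes "integrable S f" "\<And>x. f x \<le> (B::real)" shows "(\<integral>x. f x \<partial>S) \<le> B"
  using P.integral_le_const[OF assms(1), of B] assms(2) by simp

lemma integral_ge_bound:
  assumes "integrable S f" "\<And>x. (B::real) \<le> f x" shows "B \<le> (\<integral>x. f x \<partial>S)"
  using P.integral_ge_const[OF assms(1), of B] assms(2) by simp

lemma S_integral_mono:
  fixes f g :: "(nat \<Rightarrow> real) \<Rightarrow> real"
  assumes "integrable S f" "\<And>x. g x \<le> f x" "\<And>x. 0 \<le> f x"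
  shows "(\<integral>x. g x \<partial>S) \<le> (\<integral>x. f x \<partial>S)"
  by (rule integral_mono_AE') (use assms in auto)

lemma mean_log_le: "\<bar>E\<bar> \<le> R \<Longrightarrow> mean_log n E \<le> log_bound n"
  unfolding mean_log_def using ln_norm_V_le(1) by (intro integral_le_bound) (auto simp: abs_le_iff)

lemma mean_log_vec_ge: "\<bar>E\<bar> \<le> R \<Longrightarrow> y \<noteq> 0 \<Longrightarrow> - log_bound n \<le> mean_log_vec n E y"
  unfolding mean_log_vec_def using ln_norm_V_vec_le(1)
  by (intro integral_ge_bound) (auto simp: abs_le_iff minus_le_iff)

lemma mean_log_vec_le: "\<bar>E\<bar> \<le> R \<Longrightarrow> y \<noteq> 0 \<Longrightarrow> mean_log_vec n E y \<le> mean_log n E"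
  unfolding mean_log_vec_def mean_log_def using ln_norm_V_vec_le(2)
  by (intro integral_mono) auto

lemma mean_log_add_le:
  assumes "\<bar>E\<bar> \<le> R" shows "mean_log (k + n) E \<le> mean_log k E + mean_log n E"
proof -
  have "mean_log (k + n) E = (\<integral>x. (\<integral>y. ln (norm (V E y n ** V E x k)) \<partial>S) \<partial>S)"
    unfolding mean_log_def
    by (subst S_integral_split[where k=k and B="log_bound (k+n)"])
       (use ln_norm_V_le[OF assms] in \<open>simp_all add: V_comb_seq\<close>)
  also have "\<dots> \<le> (\<integral>x. (ln (norm (V E x k)) + mean_log n E) \<partial>S)"
  proof (rule S_integral_mono)
    fix x
    have "(\<integral>y. ln (norm (V E y n ** V E x k)) \<partial>S) \<le> (\<integral>y. (ln (norm (V E x k)) + ln (norm (V E y n))) \<partial>S)"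
    proof (rule S_integral_mono)
      fix y
      have "1 \<le> norm (V E y n ** V E x k)" by (rule norm_mat2_ge_1) (simp add: mat2_det_mult)
      then have "ln (norm (V E y n ** V E x k)) \<le> ln (norm (V E y n) * norm (V E x k))"
        using norm_mat2_mult_le by (subst ln_le_cancel_iff) auto
      then show "ln (norm (V E y n ** V E x k)) \<le> ln (norm (V E x k)) + ln (norm (V E y n))"
        by (simp add: ln_mult)
    qed (use assms ln_norm_V_le(2) in auto)
    also have "\<dots> = ln (norm (V E x k)) + mean_log n E"
      using assms by (simp add: mean_log_def)
    finally show "(\<integral>y. ln (norm (V E y n ** V E x k)) \<partial>S) \<le> ln (norm (V E x k)) + mean_log n E" .
  qed (use assms ln_norm_V_le(2) mean_log_nonneg in \<open>auto intro!: add_nonneg_nonneg\<close>)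
  also have "\<dots> = mean_log k E + mean_log n E"
    using assms by (simp add: mean_log_def)
  finally show ?thesis .
qed

lemma mean_log_vec_measurable [measurable]:
  assumes y: "y \<noteq> 0" and E: "\<bar>E\<bar> \<le> R"
  shows "(\<lambda>x. mean_log_vec n E (V E x k *v y)) \<in> borel_measurable S"
  unfolding mean_log_vec_def
proof (rule P.borel_measurable_lebesgue_integral)
  have [measurable]: "(\<lambda>z. norm (V E (snd z) n *v (V E (fst z) k *v y))) \<in> borel_measurable (S \<Otimes>\<^sub>M S)"
  proof (rule norm_V_vec_measurable[where f=snd])
    have [measurable]: "(\<lambda>z. V E (fst z) k $ i $ j) \<in> borel_measurable (S \<Otimes>\<^sub>M S)" for i j
      using measurable_compose[OF measurable_fst V_nth_measurable] .
    show "(\<lambda>z. (V E (fst z) k *v y) $ 1) \<in> borel_measurable (S \<Otimes>\<^sub>M S)"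
      "(\<lambda>z. (V E (fst z) k *v y) $ 2) \<in> borel_measurable (S \<Otimes>\<^sub>M S)" by simp_all
  qed auto
  have [measurable]: "(\<lambda>z. norm (V E (fst z) k *v y)) \<in> borel_measurable (S \<Otimes>\<^sub>M S)"
    by (rule norm_V_vec_measurable[where f=fst]) auto
  show "(\<lambda>(x, z). ln (norm (V E z n *v (V E x k *v y)) / norm (V E x k *v y)))
      \<in> borel_measurable (S \<Otimes>\<^sub>M S)"
    by (simp add: split_beta')
qed

text \<open>Conditioning on the first \<open>k\<close> sites: logarithmic growth is additive, and
  the vector reached starts an independent product.\<close>

lemma mean_log_vec_cocycle:
  assumes E: "\<bar>E\<bar> \<le> R" and y: "y \<noteq> 0"
  shows "mean_log_vec (k + n) E y =
    (\<integral>x. (ln (norm (V E x k *v y) / norm y) + mean_log_vec n E (V E x k *v y)) \<partial>S)"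
proof -
  have "mean_log_vec (k + n) E y =
      (\<integral>x. (\<integral>z. ln (norm (V E z n *v (V E x k *v y)) / norm y) \<partial>S) \<partial>S)"
    unfolding mean_log_vec_def
    by (subst S_integral_split[where k=k and B="log_bound (k+n)"])
       (use ln_norm_V_vec_le[OF E y] in \<open>simp_all add: V_comb_seq matrix_vector_mul_assoc\<close>)
  also have "\<dots> = (\<integral>x. (ln (norm (V E x k *v y) / norm y) + mean_log_vec n E (V E x k *v y)) \<partial>S)"
  proof (intro Bochner_Integration.integral_cong refl)
    fix x
    let ?y = "V E x k *v y"
    have y': "0 < norm ?y" using norm_V_vec_bounds(3)[OF E y] .
    then have y'': "?y \<noteq> 0" by auto
    have "ln (norm (V E z n *v ?y) / norm y) = ln (norm ?y / norm y) + ln (norm (V E z n *v ?y) / norm ?y)" for z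
      using y' y norm_V_vec_bounds(3)[OF E y'', of z n] by (simp add: ln_div ln_mult)
    then show "(\<integral>z. ln (norm (V E z n *v ?y) / norm y) \<partial>S) = ln (norm ?y / norm y) + mean_log_vec n E ?y"
      using E y'' by (simp add: mean_log_vec_def)
  qed
  finally show ?thesis .
qed

end

text \<open>Two directions separated by \<kappa> cannot both grow by less than \<kappa> / 4 times
  \<open>norm T\<close>, so at most one index is exceptional. That one still contributes at least -
  ln (norm T), by unimodularity.\<close>

lemma sum_ln_separated_ge:
  fixes y :: "nat \<Rightarrow> real^2" and T :: "real^2^2"
  assumes T: "mat2_det T = 1" and \<kappa>: "0 < \<kappa>"
    and y: "\<And>i. i \<le> N \<Longrightarrow> y i \<noteq> 0"
    and sep: "\<And>i j. i \<le> N \<Longrightarrow> j \<le> N \<Longrightarrow> i \<noteq> j \<Longrightarrow> \<kappa> * (norm (y i) * norm (y j)) \<le> \<bar>wedge (y i) (y j)\<bar>"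
  shows "N * (ln (norm T) - ln (4 / \<kappa>)) - ln (norm T) \<le> (\<Sum>i\<le>N. ln (norm (T *v y i) / norm (y i)))"
proof -
  have T1: "1 \<le> norm T" using norm_mat2_ge_1[OF T] .
  have T0: "0 < norm T" using T1 by linarith
  define \<rho> where "\<rho> i = norm (T *v y i) / norm (y i)" for i
  have \<rho>: "1 / norm T \<le> \<rho> i" if "i \<le> N" for i
    using norm_le_norm_mat2_mult_vec[OF T, of "y i"] y[OF that] T0
    by (simp add: \<rho>_def divide_simps mult.commute)
  have \<rho>0: "0 < \<rho> i" if "i \<le> N" for i using \<rho>[OF that] T1
    by (smt (verit, best) divide_pos_pos)
  have two: "\<kappa> * norm T / 4 \<le> \<rho> i \<or> \<kappa> * norm T / 4 \<le> \<rho> j" if "i \<le> N" "j \<le> N" "i \<noteq> j" for i j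
  proof -
    have p: "0 < norm (y i)" "0 < norm (y j)" using y that by auto
    have "\<kappa> * (norm (y i) * norm (y j)) * norm T \<le> 2 * (norm (y j) * norm (T *v y i) + norm (y i) * norm (T *v y j))"
      by (rule order_trans[OF _ wedge_norm_le]) (intro mult_right_mono sep that norm_ge_zero)
    also have "\<dots> = 2 * (\<rho> i + \<rho> j) * (norm (y i) * norm (y j))"
      using p by (simp add: \<rho>_def field_simps)
    finally have "(\<kappa> * norm T) * (norm (y i) * norm (y j)) \<le> (2 * (\<rho> i + \<rho> j)) * (norm (y i) * norm (y j))"
      by (simp add: mult_ac)
    then have "\<kappa> * norm T \<le> 2 * (\<rho> i + \<rho> j)"
      using p by (metis mult_le_cancel_right_pos mult_pos_pos)
    then show ?thesis by (cases "\<rho> i \<le> \<rho> j") auto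
  qed
  have "\<exists>i0\<le>N. \<forall>i\<le>N. i \<noteq> i0 \<longrightarrow> \<kappa> * norm T / 4 \<le> \<rho> i"
    using two by (metis le0)
  then obtain i0 where i0: "i0 \<le> N" "\<And>i. i \<le> N \<Longrightarrow> i \<noteq> i0 \<Longrightarrow> \<kappa> * norm T / 4 \<le> \<rho> i" by blast
  have good: "ln (norm T) - ln (4 / \<kappa>) \<le> ln (\<rho> i)" if "i \<in> {..N} - {i0}" for i
  proof -
    have "0 < \<kappa> * norm T / 4" using \<kappa> T0 by simp
    then have "ln (\<kappa> * norm T / 4) \<le> ln (\<rho> i)"
      using that i0(2)[of i] by (intro iffD2[OF ln_le_cancel_iff]) auto
    moreover have "ln (\<kappa> * norm T / 4) = ln (norm T) - ln (4 / \<kappa>)"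
      using \<kappa> T0 by (simp add: ln_mult ln_div)
    ultimately show ?thesis by simp
  qed
  have "- ln (norm T) = ln (1 / norm T)" using T1 by (simp add: ln_div)
  also have "\<dots> \<le> ln (\<rho> i0)" using \<rho>[OF i0(1)] \<rho>0[OF i0(1)] T1 by (subst ln_le_cancel_iff) auto
  finally have bad: "- ln (norm T) \<le> ln (\<rho> i0)" .
  have "(\<Sum>i\<le>N. ln (\<rho> i)) = ln (\<rho> i0) + (\<Sum>i\<in>{..N} - {i0}. ln (\<rho> i))"
    using i0(1) by (simp add: sum.remove)
  moreover have "real (card ({..N} - {i0})) * (ln (norm T) - ln (4 / \<kappa>)) \<le> (\<Sum>i\<in>{..N} - {i0}. ln (\<rho> i))"
    by (rule sum_bounded_below) (use good in auto)
  moreover have "card ({..N} - {i0}) = N" using i0(1) by simp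
  ultimately show ?thesis using bad by (simp add: \<rho>_def)
qed

lemma abs_ln_diff_le:
  fixes a b :: real assumes "1 \<le> a" "1 \<le> b" shows "\<bar>ln a - ln b\<bar> \<le> \<bar>a - b\<bar>"
proof -
  have *: "ln a - ln b \<le> a - b" if "1 \<le> b" "b \<le> a" for a b :: real
  proof -
    have "ln (a / b) \<le> a / b - 1" using that by (intro ln_le_minus_one) auto
    also have "\<dots> = (a - b) / b" using that by (simp add: diff_divide_distrib)
    also have "\<dots> \<le> (a - b) / 1" using that by (intro divide_left_mono) auto
    finally show ?thesis using that by (simp add: ln_div)
  qed
  show ?thesis
  proof (cases "b \<le> a")
    case True
    then have "ln b \<le> ln a" using assms by simp
    then show ?thesis using *[of b a] True assms by simp
  next
    case False
    then have "ln a \<le> ln b" using assms by simp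
    then show ?thesis using *[of a b] False assms by simp
  qed
qed

text \<open>\<open>a\<close> and \<open>b\<close> are two points of the support of the law of
  \<open>c\<close>. The law may have no atoms, hence positivity is asked of neighbourhoods
  only.\<close>

locale nondegenerate_potential = random_potential +
  fixes a b :: real
  assumes ab: "a < b" "\<bar>a\<bar> \<le> K" "\<bar>b\<bar> \<le> K"
    and supp: "\<And>r. 0 < r \<Longrightarrow> 0 < measure \<nu> {t. \<bar>c t - a\<bar> < r}"
      "\<And>r. 0 < r \<Longrightarrow> 0 < measure \<nu> {t. \<bar>c t - b\<bar> < r}"
begin

text \<open>The words in \<open>a\<close> and \<open>b\<close> may have probability 0, so each is
  thickened to the event that the first \<open>Suc N\<close> values lie within \<open>r\<close> of
  its letters. Such an event has probability at least \<open>p0 ^ Suc N\<close>, and the wedges lose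
  at most half of their size.\<close>

lemma sep_events:
  "\<exists>p>0. \<exists>\<theta>>0. \<forall>E y. \<bar>E\<bar> \<le> R \<longrightarrow> y \<noteq> 0 \<longrightarrow>
    (\<exists>W. (\<forall>i\<le>N. W i \<in> sets S \<and> p \<le> measure S (W i)) \<and>
      (\<forall>i\<le>N. \<forall>j\<le>N. i \<noteq> j \<longrightarrow> (\<forall>x\<in>W i. \<forall>x'\<in>W j.
        \<theta> * (norm y)\<^sup>2 \<le> \<bar>wedge (V E x (Suc N) *v y) (V E x' (Suc N) *v y)\<bar>)))"
proof -
  obtain \<theta>0 where \<theta>0: "0 < \<theta>0" and words: "\<forall>E. \<bar>E\<bar> \<le> R \<longrightarrow> (\<forall>y::real^2. norm y = 1 \<longrightarrow>
      (\<exists>w::nat \<Rightarrow> nat \<Rightarrow> real. (\<forall>i k. w i k \<in> {a, b}) \<and> (\<forall>i\<le>N. \<forall>j\<le>N. i \<noteq> j \<longrightarrow>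
        \<theta>0 \<le> \<bar>wedge (schr_prod (\<lambda>k. E - w i k) (Suc N) *v y) (schr_prod (\<lambda>k. E - w j k) (Suc N) *v y)\<bar>)))"
    using schr_words_uniform[OF ab(1), of R N] by (elim exE conjE) (rule that)
  define D where "D = 2 * L ^ Suc N"
  have D: "1 \<le> D" using L_ge_2 one_le_power[of L "Suc N"] by (simp add: D_def)
  have Dk: "2 * L ^ k \<le> D" if "k \<le> Suc N" for k
    using L_ge_2 power_increasing[OF that, of L] by (simp add: D_def)
  \<comment> \<open>Chosen so that the perturbation of the wedge, 4 (N + 1) D^3 r, equals \<theta>0
    / 2.\<close>
  define r where "r = \<theta>0 / (8 * (real (Suc N) * D ^ 3))"
  have r: "0 < r" using \<theta>0 D by (simp add: r_def)
  define p0 where "p0 = min (measure \<nu> {t. \<bar>c t - a\<bar> < r}) (measure \<nu> {t. \<bar>c t - b\<bar> < r})"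
  have p0: "0 < p0" using supp[OF r] by (simp add: p0_def)
  show ?thesis
  proof (rule exI[of _ "p0 ^ Suc N"], rule conjI[OF zero_less_power[OF p0]],
      rule exI[of _ "\<theta>0 / 2"], rule conjI[OF half_gt_zero[OF \<theta>0]], intro allI impI)
    fix E and y :: "real^2" assume E: "\<bar>E\<bar> \<le> R" and y: "y \<noteq> 0"
    define u where "u = y /\<^sub>R norm y"
    have u: "norm u = 1" "y = norm y *\<^sub>R u" using y by (simp_all add: u_def)
    obtain w :: "nat \<Rightarrow> nat \<Rightarrow> real" where w: "\<And>i k. w i k \<in> {a, b}"
      and wsep: "\<And>i j. i \<le> N \<Longrightarrow> j \<le> N \<Longrightarrow> i \<noteq> j \<Longrightarrow>
        \<theta>0 \<le> \<bar>wedge (schr_prod (\<lambda>k. E - w i k) (Suc N) *v u) (schr_prod (\<lambda>k. E - w j k) (Suc N) *v u)\<bar>"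
      using words[rule_format, OF E u(1)] by blast
    define W where "W i = {x\<in>space S. \<forall>k\<in>{..<Suc N}. x k \<in> {t. \<bar>c t - w i k\<bar> < r}}" for i
    have set1: "{t. \<bar>c t - q\<bar> < r} \<in> sets \<nu>" for q
    proof -
      have "{t\<in>space borel. \<bar>c t - q\<bar> < r} \<in> sets borel" by measurable
      then show ?thesis by (simp add: sets_\<nu>)
    qed
    have Wm: "W i \<in> sets S" for i
    proof -
      have "{x\<in>space S. \<forall>k\<in>{..<Suc N}. \<bar>c (x k) - w i k\<bar> < r} \<in> sets S" by measurable
      then show ?thesis by (simp add: W_def)
    qed
    have Wp: "p0 ^ Suc N \<le> measure S (W i)" for i
    proof -
      have "emeasure S (W i) = (\<Prod>k\<in>{..<Suc N}. emeasure \<nu> {t. \<bar>c t - w i k\<bar> < r})"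
        unfolding W_def by (rule emeasure_PiM_Collect) (use set1 in auto)
      also have "\<dots> = ennreal (\<Prod>k\<in>{..<Suc N}. measure \<nu> {t. \<bar>c t - w i k\<bar> < r})"
        by (simp only: nu.emeasure_eq_measure prod_ennreal measure_nonneg)
      finally have "measure S (W i) = (\<Prod>k\<in>{..<Suc N}. measure \<nu> {t. \<bar>c t - w i k\<bar> < r})"
        by (simp add: measure_def prod_nonneg)
      moreover have "(\<Prod>k\<in>{..<Suc N}. p0) \<le> (\<Prod>k\<in>{..<Suc N}. measure \<nu> {t. \<bar>c t - w i k\<bar> < r})"
      proof (rule prod_mono)
        fix k show "0 \<le> p0 \<and> p0 \<le> measure \<nu> {t. \<bar>c t - w i k\<bar> < r}"
          using w[of i k] p0 by (auto simp: p0_def)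
      qed
      ultimately show ?thesis by simp
    qed
    have near: "norm (V E x (Suc N) *v u - schr_prod (\<lambda>k. E - w i k) (Suc N) *v u) \<le> Suc N * (D\<^sup>2 * r)"
      if "x \<in> W i" for x i
    proof -
      have wK: "\<bar>w i k\<bar> \<le> K" for k using w[of i k] ab by auto
      have "norm (V E x (Suc N) - schr_prod (\<lambda>k. E - w i k) (Suc N)) \<le> Suc N * (D\<^sup>2 * r)"
      proof (rule norm_schr_prod_diff_le)
        fix k assume k: "k < Suc N"
        then show "\<bar>E - c (x k) - (E - w i k)\<bar> \<le> r"
          using that by (auto simp: W_def abs_minus_commute less_imp_le)
        have "norm (schr_prod (\<lambda>j. E - c (x (Suc k + j))) (Suc N - 1 - k)) \<le> D"
          by (rule order_trans[OF norm_V_le[OF E, of "\<lambda>j. x (Suc k + j)"] Dk]) simp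
        moreover have "norm (schr_prod (\<lambda>k. E - w i k) k) \<le> D"
        proof (rule order_trans[OF norm_schr_prod_le Dk])
          show "\<bar>E - w i j\<bar> \<le> R + K" for j using wK[of j] E by linarith
        qed (use k in simp)
        ultimately show "norm (schr_prod (\<lambda>j. E - c (x (Suc k + j))) (Suc N - 1 - k)) *
            norm (schr_prod (\<lambda>k. E - w i k) k) \<le> D\<^sup>2"
          unfolding power2_eq_square using D by (intro mult_mono) auto
      qed
      moreover have "V E x (Suc N) *v u - schr_prod (\<lambda>k. E - w i k) (Suc N) *v u
          = (V E x (Suc N) - schr_prod (\<lambda>k. E - w i k) (Suc N)) *v u"
        by (simp only: matrix_vector_mult_diff_rdistrib)
      ultimately show ?thesis
        using norm_mat2_mult_vec_le[of "V E x (Suc N) - schr_prod (\<lambda>k. E - w i k) (Suc N)" u]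
        unfolding u(1) mult_1_right by simp
    qed
    have nV: "norm (V E x (Suc N) *v u) \<le> D" for x
      using norm_mat2_mult_vec_le[of "V E x (Suc N)" u] norm_V_le[OF E, of x "Suc N"]
      unfolding D_def u(1) mult_1_right by linarith
    have nw: "norm (schr_prod (\<lambda>k. E - w i k) (Suc N) *v u) \<le> D" for i
    proof -
      have "\<bar>E - w i j\<bar> \<le> R + K" for j using w[of i j] ab E by auto
      then have "norm (schr_prod (\<lambda>k. E - w i k) (Suc N)) \<le> D"
        unfolding D_def by (intro norm_schr_prod_le) auto
      then show ?thesis
        using norm_mat2_mult_vec_le[of "schr_prod (\<lambda>k. E - w i k) (Suc N)" u]
        unfolding u(1) mult_1_right by linarith
    qed
    have sep: "\<theta>0 / 2 \<le> \<bar>wedge (V E x (Suc N) *v u) (V E x' (Suc N) *v u)\<bar>"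
      if ij: "i \<le> N" "j \<le> N" "i \<noteq> j" "x \<in> W i" "x' \<in> W j" for i j x x'
    proof -
      let ?p = "V E x (Suc N) *v u" and ?q = "V E x' (Suc N) *v u"
      let ?p' = "schr_prod (\<lambda>k. E - w i k) (Suc N) *v u" and ?q' = "schr_prod (\<lambda>k. E - w j k) (Suc N) *v u"
      have "\<bar>wedge ?p ?q - wedge ?p' ?q'\<bar> \<le> 2 * (norm (?p - ?p') * norm ?q + norm ?p' * norm (?q - ?q'))"
        by (rule wedge_diff_le)
      also have "\<dots> \<le> 2 * (Suc N * (D\<^sup>2 * r) * D + D * (Suc N * (D\<^sup>2 * r)))"
        using D r by (intro mult_left_mono add_mono mult_mono near nV nw ij) auto
      also have "\<dots> = 4 * (real (Suc N) * D ^ 3) * r" by (simp add: power3_eq_cube power2_eq_square)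
      also have "\<dots> = \<theta>0 / 2"
      proof -
        have "4 * X * (\<theta>0 / (8 * X)) = \<theta>0 / 2" if "X \<noteq> 0" for X :: real using that by simp
        moreover have "real (Suc N) * D ^ 3 \<noteq> 0" using D by simp
        ultimately show ?thesis unfolding r_def by blast
      qed
      finally show ?thesis using wsep[OF ij(1-3)] by linarith
    qed
    have scale: "wedge (A *v y) (B *v y) = (norm y)\<^sup>2 * wedge (A *v u) (B *v u)" for A B
      by (subst u(2), subst (2) u(2)) (simp add: wedge_def power2_eq_square algebra_simps)
    show "\<exists>W. (\<forall>i\<le>N. W i \<in> sets S \<and> p0 ^ Suc N \<le> measure S (W i)) \<and>
      (\<forall>i\<le>N. \<forall>j\<le>N. i \<noteq> j \<longrightarrow> (\<forall>x\<in>W i. \<forall>x'\<in>W j.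
        \<theta>0 / 2 * (norm y)\<^sup>2 \<le> \<bar>wedge (V E x (Suc N) *v y) (V E x' (Suc N) *v y)\<bar>))"
    proof (intro exI[of _ W] conjI allI impI ballI Wm Wp)
      fix i j x x' assume ij: "i \<le> N" "j \<le> N" "i \<noteq> j" "x \<in> W i" "x' \<in> W j"
      show "\<theta>0 / 2 * (norm y)\<^sup>2 \<le> \<bar>wedge (V E x (Suc N) *v y) (V E x' (Suc N) *v y)\<bar>"
        unfolding scale abs_mult using mult_right_mono[OF sep[OF ij] zero_le_power2[of "norm y"]] by (simp only: mult_ac abs_power2)
    qed
  qed
qed

text \<open>Among \<open>N + 1\<close> separated directions a matrix can contract at most one, so running a few steps
  until the direction has \<open>N + 1\<close> separated outcomes costs only a fraction \<open>2 / (N + 1)\<close> of the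
  growth.\<close>

lemma mean_log_vec_ge_mean_log:
  assumes N: "1 \<le> N"
  shows "\<exists>C. \<forall>E y m. \<bar>E\<bar> \<le> R \<longrightarrow> y \<noteq> 0 \<longrightarrow>
    (real N - 1) / (real N + 1) * mean_log m E - C \<le> mean_log_vec m E y"
proof -
  define k where "k = Suc N"
  \<comment> \<open>(N + 1) lam = N - 1 is the balance of \<open>N\<close> stretched directions
    against one contracted direction.\<close>
  define lam where "lam = (real N - 1) / (real N + 1)"
  have lam: "0 \<le> lam" "lam \<le> 1" "(real N + 1) * lam = real N - 1" using N by (simp_all add: lam_def)
  obtain p \<theta> where sepE: "\<forall>E y. \<bar>E\<bar> \<le> R \<longrightarrow> y \<noteq> 0 \<longrightarrow>
    (\<exists>W. (\<forall>i\<le>N. W i \<in> sets S \<and> p \<le> measure S (W i)) \<and>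
      (\<forall>i\<le>N. \<forall>j\<le>N. i \<noteq> j \<longrightarrow> (\<forall>x\<in>W i. \<forall>x'\<in>W j.
        \<theta> * (norm y)\<^sup>2 \<le> \<bar>wedge (V E x k *v y) (V E x' k *v y)\<bar>)))"
      and p: "0 < p" and \<theta>: "0 < \<theta>"
    using sep_events[of N, folded k_def] by (elim exE conjE) (rule that)
  define D where "D = 2 * L ^ k"
  have "1 \<le> L ^ k" using L_ge_2 by (intro one_le_power) simp
  then have D: "1 \<le> D" by (simp add: D_def)
  define \<kappa> where "\<kappa> = \<theta> / D\<^sup>2"
  have \<kappa>: "0 < \<kappa>" using \<theta> D by (simp add: \<kappa>_def)
  define C1 where "C1 = \<bar>ln (4 / \<kappa>)\<bar>"
  define lb where "lb = log_bound k"
  have lb: "0 \<le> lb" using log_bound_nonneg by (simp add: lb_def)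
  \<comment> \<open>The summand \<open>2 * lb\<close> settles lengths below \<open>k\<close>. The
    quotient by \<open>p\<close> repays, after averaging over the events, the \<open>2 * lb\<close>
    lost in the first \<open>k\<close> sites and the slack \<open>N + 1\<close>. \<open>C1\<close>
    absorbs the separation constant.\<close>
  define C where "C = 2 * lb + (2 * lb + (real N + 1)) / p + C1"
  have "lam * mean_log m E - C \<le> mean_log_vec m E y" if E: "\<bar>E\<bar> \<le> R" and y: "y \<noteq> 0" for E y m
    using y
  proof (induction m arbitrary: y rule: less_induct)
    case (less m)
    show ?case
    proof (cases "m < k")
      case True
      have "log_bound m \<le> lb" using True L_ge_2 by (simp add: log_bound_def lb_def mult_right_mono)
      moreover have "lam * mean_log m E \<le> 1 * log_bound m"
        using lam mean_log_le[OF E] mean_log_nonneg[OF E] by (intro mult_mono) auto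
      moreover have "0 \<le> (2 * lb + (real N + 1)) / p" "0 \<le> C1" using lb p by (simp_all add: C1_def)
      ultimately show ?thesis using mean_log_vec_ge[OF E less.prems, of m] unfolding C_def by linarith
    next
      case False
      define m' where "m' = m - k"
      have m: "m = k + m'" "m' < m" using False by (simp_all add: m'_def k_def)
      define B where "B = lam * mean_log m' E - C"
      \<comment> \<open>The excess over the induction hypothesis. It is nonnegative, so its integral
        can be bounded below by the contributions of the disjoint events \<open>W i\<close>.\<close>
      define g where "g x = mean_log_vec m' E (V E x k *v y) - B" for x
      have nz: "V E x k *v y \<noteq> 0" for x using norm_V_vec_bounds(3)[OF E less.prems, of x k] by auto
      have g0: "0 \<le> g x" for x using less.IH[OF m(2) nz, of x] by (simp add: g_def B_def)
      have g_meas [measurable]: "g \<in> borel_measurable S"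
        unfolding g_def using mean_log_vec_measurable[OF less.prems E] by simp
      have gb: "\<bar>g x\<bar> \<le> log_bound m' + \<bar>B\<bar>" for x
        using mean_log_vec_ge[OF E nz, of m' x] mean_log_vec_le[OF E nz, of m' x] mean_log_le[OF E, of m']
        unfolding g_def by linarith
      have g_int: "integrable S g" by (rule S_integrable_bounded[OF g_meas gb])
      have ln_int: "integrable S (\<lambda>x. ln (norm (V E x k *v y) / norm y))" using E less.prems by simp
      have "mean_log_vec m E y = (\<integral>x. (ln (norm (V E x k *v y) / norm y) + (B + g x)) \<partial>S)"
        unfolding m(1) mean_log_vec_cocycle[OF E less.prems] by (simp add: g_def)
      also have "\<dots> = mean_log_vec k E y + B + (\<integral>x. g x \<partial>S)"
        using ln_int g_int by (simp add: mean_log_vec_def)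
      finally have eq: "mean_log_vec m E y = mean_log_vec k E y + B + (\<integral>x. g x \<partial>S)" .
      obtain W where W: "\<And>i. i \<le> N \<Longrightarrow> W i \<in> sets S" "\<And>i. i \<le> N \<Longrightarrow> p \<le> measure S (W i)"
        and sep: "\<And>i j x x'. i \<le> N \<Longrightarrow> j \<le> N \<Longrightarrow> i \<noteq> j \<Longrightarrow> x \<in> W i \<Longrightarrow> x' \<in> W j \<Longrightarrow>
          \<theta> * (norm y)\<^sup>2 \<le> \<bar>wedge (V E x k *v y) (V E x' k *v y)\<bar>"
      proof -
        from sepE[rule_format, OF E less.prems] obtain W where
          W0: "\<forall>i\<le>N. W i \<in> sets S \<and> p \<le> measure S (W i)" and
          W1: "\<forall>i\<le>N. \<forall>j\<le>N. i \<noteq> j \<longrightarrow> (\<forall>x\<in>W i. \<forall>x'\<in>W j.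
            \<theta> * (norm y)\<^sup>2 \<le> \<bar>wedge (V E x k *v y) (V E x' k *v y)\<bar>)"
          by (elim exE conjE) (rule that)
        show ?thesis
        proof (rule that[of W])
          show "\<theta> * (norm y)\<^sup>2 \<le> \<bar>wedge (V E x k *v y) (V E x' k *v y)\<bar>"
            if "i \<le> N" "j \<le> N" "i \<noteq> j" "x \<in> W i" "x' \<in> W j" for i j x x'
            using W1[rule_format, OF that] .
        qed (use W0 in auto)
      qed
      have ny: "0 < norm y" using less.prems by simp
      have disj: "x \<notin> W j" if "i \<le> N" "j \<le> N" "i \<noteq> j" "x \<in> W i" for i j x
      proof
        assume "x \<in> W j"
        then have "\<theta> * (norm y)\<^sup>2 \<le> 0" using sep[of i j x x] that by (simp add: wedge_def mult.commute)
        moreover have "0 < \<theta> * (norm y)\<^sup>2" using \<theta> ny by (intro mult_pos_pos) auto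
        ultimately show False by linarith
      qed
      define I where "I i = (\<integral>x. indicator (W i) x * g x \<partial>S)" for i
      have Wg_int: "integrable S (\<lambda>x. indicator (W i) x * g x)" if "i \<le> N" for i
        using integrable_real_mult_indicator[OF W(1)[OF that] g_int] by (simp add: mult.commute)
      \<comment> \<open>Otherwise \<open>p * g\<close> would exceed \<open>I i + 1\<close> on an
        event of probability at least \<open>p\<close>; the 1 makes the contradiction
        strict.\<close>
      have "\<exists>x\<in>W i. p * g x \<le> I i + 1" if i: "i \<le> N" for i
      proof (rule ccontr)
        assume "\<not> ?thesis"
        then have lt: "I i + 1 < p * g x" if "x \<in> W i" for x using that by force
        have I0: "0 \<le> I i" unfolding I_def using g0 by (intro Bochner_Integration.integral_nonneg) simp
        have "(I i + 1) * measure S (W i) = (\<integral>x. (I i + 1) * indicator (W i) x \<partial>S)"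
          using W(1)[OF i] by simp
        also have "\<dots> \<le> (\<integral>x. p * (indicator (W i) x * g x) \<partial>S)"
        proof (rule S_integral_mono)
          show "integrable S (\<lambda>x. p * (indicator (W i) x * g x))" using Wg_int[OF i] by simp
          show "(I i + 1) * indicator (W i) x \<le> p * (indicator (W i) x * g x)" for x
            using less_imp_le[OF lt[of x]] by (simp add: indicator_def)
          show "0 \<le> p * (indicator (W i) x * g x)" for x using p g0 by simp
        qed
        also have "\<dots> = p * I i" by (simp add: I_def)
        also have "\<dots> \<le> measure S (W i) * I i" using W(2)[OF i] I0 by (intro mult_right_mono)
        finally have "measure S (W i) \<le> 0" by (simp add: algebra_simps)
        then show False using W(2)[OF i] p by simp
      qed
      then obtain xs where xs: "\<And>i. i \<le> N \<Longrightarrow> xs i \<in> W i" "\<And>i. i \<le> N \<Longrightarrow> p * g (xs i) \<le> I i + 1"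
        by metis
      have sumI: "(\<Sum>i\<le>N. I i) \<le> (\<integral>x. g x \<partial>S)"
      proof -
        have "(\<Sum>i\<le>N. I i) = (\<integral>x. (\<Sum>i\<le>N. indicator (W i) x * g x) \<partial>S)"
          unfolding I_def using Wg_int by (subst Bochner_Integration.integral_sum) auto
        also have "\<dots> \<le> (\<integral>x. g x \<partial>S)"
        proof (rule S_integral_mono[OF g_int])
          fix x
          have "(\<Sum>i\<le>N. indicator (W i) x :: real) \<le> 1"
          proof (cases "\<exists>i\<le>N. x \<in> W i")
            case True
            then obtain i where i: "i \<le> N" "x \<in> W i" by blast
            have "(\<Sum>j\<le>N. indicator (W j) x :: real) = (\<Sum>j\<le>N. if j = i then 1 else 0)"
              using i disj[OF i(1) _ _ i(2)] by (intro sum.cong) (auto simp: indicator_def)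
            then show ?thesis using i by simp
          next
            case False
            then show ?thesis by (simp add: indicator_def)
          qed
          then show "(\<Sum>i\<le>N. indicator (W i) x * g x) \<le> g x"
            using g0[of x] by (simp add: sum_distrib_right[symmetric] mult_left_le_one_le sum_nonneg)
        qed (use g0 in simp)
        finally show ?thesis .
      qed
      define ys where "ys i = V E (xs i) k *v y" for i
      have ys: "ys i \<noteq> 0" "norm (ys i) \<le> D * norm y" for i
        using nz norm_V_vec_bounds(1)[OF E less.prems, of "xs i" k] ny
        by (simp_all add: ys_def D_def pos_divide_le_eq)
      have ysep: "\<kappa> * (norm (ys i) * norm (ys j)) \<le> \<bar>wedge (ys i) (ys j)\<bar>"
        if "i \<le> N" "j \<le> N" "i \<noteq> j" for i j
      proof -
        have "norm (ys i) * norm (ys j) \<le> (D * norm y) * (D * norm y)"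
          using D by (intro mult_mono ys) auto
        then have "\<kappa> * (norm (ys i) * norm (ys j)) \<le> \<kappa> * ((D * norm y) * (D * norm y))"
          using \<kappa> by (intro mult_left_mono) auto
        also have "\<dots> = \<theta> * (norm y)\<^sup>2" using D by (simp add: \<kappa>_def power2_eq_square)
        also have "\<dots> \<le> \<bar>wedge (ys i) (ys j)\<bar>"
          unfolding ys_def using sep[OF that xs(1)[OF that(1)] xs(1)[OF that(2)]] .
        finally show ?thesis .
      qed
      have "N * (mean_log m' E - ln (4 / \<kappa>)) - mean_log m' E
          = (\<integral>x. (N * (ln (norm (V E x m')) - ln (4 / \<kappa>)) - ln (norm (V E x m'))) \<partial>S)"
        using E by (simp add: mean_log_def)
      also have "\<dots> \<le> (\<integral>x. (\<Sum>i\<le>N. ln (norm (V E x m' *v ys i) / norm (ys i))) \<partial>S)"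
        by (rule integral_mono) (use E ys sum_ln_separated_ge[OF mat2_det_schr_prod \<kappa> ys(1) ysep] in auto)
      also have "\<dots> = (\<Sum>i\<le>N. mean_log_vec m' E (ys i))"
        unfolding mean_log_vec_def using E ys by (subst Bochner_Integration.integral_sum) auto
      finally have s1: "N * (mean_log m' E - ln (4 / \<kappa>)) - mean_log m' E \<le> (\<Sum>i\<le>N. mean_log_vec m' E (ys i))" .
      have "(\<Sum>i\<le>N. g (xs i)) = (\<Sum>i\<le>N. mean_log_vec m' E (ys i)) - (real N + 1) * B"
        by (simp add: g_def ys_def sum_subtractf)
      \<comment> \<open>The choice of \<open>lam\<close> makes the terms with
        \<open>mean_log m' E\<close> cancel; what is left is a multiple of \<open>C\<close>, which
        is why the induction closes.\<close>
      moreover have "(real N + 1) * B = (real N - 1) * mean_log m' E - (real N + 1) * C"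
        unfolding B_def lam(3)[symmetric] by (simp add: algebra_simps)
      moreover have "N * ln (4 / \<kappa>) \<le> N * C1" by (intro mult_left_mono) (auto simp: C1_def)
      ultimately have s2: "(real N + 1) * C - N * C1 \<le> (\<Sum>i\<le>N. g (xs i))"
        using s1 by (simp add: algebra_simps)
      have "p * (\<Sum>i\<le>N. g (xs i)) \<le> (\<Sum>i\<le>N. I i + 1)"
        unfolding sum_distrib_left by (rule sum_mono) (use xs in simp)
      also have "\<dots> \<le> (\<integral>x. g x \<partial>S) + (real N + 1)" using sumI by (simp add: sum.distrib)
      finally have s3: "p * (\<Sum>i\<le>N. g (xs i)) \<le> (\<integral>x. g x \<partial>S) + (real N + 1)" .
      have "(2 * lb + (real N + 1)) / p + C1 \<le> (real N + 1) * C - N * C1"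
      proof -
        define q where "q = 2 * lb + (2 * lb + (real N + 1)) / p"
        have q: "(2 * lb + (real N + 1)) / p \<le> q" "0 \<le> q" using lb p by (simp_all add: q_def)
        have "C = q + C1" by (simp add: C_def q_def)
        then have "(real N + 1) * C - N * C1 = q + N * q + C1" by (simp add: algebra_simps)
        moreover have "0 \<le> N * q" using q by simp
        ultimately show ?thesis using q by linarith
      qed
      then have "p * ((2 * lb + (real N + 1)) / p + C1) \<le> p * (\<Sum>i\<le>N. g (xs i))"
        using s2 p by (intro mult_left_mono) auto
      moreover have "p * ((2 * lb + (real N + 1)) / p + C1) = 2 * lb + (real N + 1) + p * C1"
        using p by (simp add: field_simps)
      moreover have "0 \<le> p * C1" using p by (simp add: C1_def)
      ultimately have s4: "2 * lb \<le> (\<integral>x. g x \<partial>S)" using s3 by linarith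
      have "lam * mean_log m E \<le> lam * (mean_log k E + mean_log m' E)"
        unfolding m(1) using mean_log_add_le[OF E] lam by (intro mult_left_mono) auto
      moreover have "lam * mean_log k E \<le> 1 * lb"
        unfolding lb_def using lam mean_log_le[OF E] mean_log_nonneg[OF E] by (intro mult_mono) auto
      ultimately have "lam * mean_log m E \<le> lb + lam * mean_log m' E" by (simp add: algebra_simps)
      moreover have "- lb \<le> mean_log_vec k E y" using mean_log_vec_ge[OF E less.prems, of k] by (simp add: lb_def)
      ultimately show ?thesis using s4 unfolding eq B_def by linarith
    qed
  qed
  then show ?thesis unfolding lam_def by blast
qed

end

section \<open>Exponential moments, reindexing of sites, and the Lyapunov exponent\<close>

lemma exp_le_quadratic:
  fixes t :: real assumes "\<bar>t\<bar> \<le> 1" shows "exp t \<le> 1 + t + t\<^sup>2"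
proof (cases "0 \<le> t")
  case True
  then show ?thesis using assms exp_bound[of t] by simp
next
  case False
  have "1 + (- t) + (- t)\<^sup>2 / 2 \<le> exp (- t)"
    using exp_lower_Taylor_quadratic[of "- t"] False by simp
  then have 1: "(1 + t + t\<^sup>2) * (1 - t + t\<^sup>2 / 2) \<le> (1 + t + t\<^sup>2) * exp (- t)"
    using assms False by (intro mult_left_mono) auto
  have "(1 + t + t\<^sup>2) * (1 - t + t\<^sup>2 / 2) = 1 + t\<^sup>2 * (1 - t + t\<^sup>2) / 2"
    by (simp add: power2_eq_square field_simps)
  moreover have "0 \<le> t\<^sup>2 * (1 - t + t\<^sup>2) / 2" using False by simp
  ultimately have "1 \<le> (1 + t + t\<^sup>2) * exp (- t)" using 1 by linarith
  then show ?thesis by (simp add: exp_minus field_simps)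
qed

context random_potential
begin

text \<open>For small \<open>s\<close> the moment generating function is governed by the mean; the
  second-order term can be made a small fraction of any gap between the mean and a
  threshold.\<close>

lemma exp_moment_le:
  fixes f :: "(nat \<Rightarrow> real) \<Rightarrow> real"
  assumes [measurable]: "f \<in> borel_measurable S" and f: "\<And>x. \<bar>f x\<bar> \<le> B" and s: "0 \<le> s" "s * B \<le> 1"
  shows "(\<integral>x. exp (s * f x) \<partial>S) \<le> exp (s * (\<integral>x. f x \<partial>S) + s\<^sup>2 * B\<^sup>2)"
proof -
  have int: "integrable S f" by (rule S_integrable_bounded) (use assms in auto)
  have "exp (s * f x) \<le> 1 + s * f x + s\<^sup>2 * B\<^sup>2" for x
  proof -
    have "\<bar>s * f x\<bar> \<le> s * B" using f[of x] s by (simp add: abs_mult mult_left_mono)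
    then have "exp (s * f x) \<le> 1 + s * f x + (s * f x)\<^sup>2"
      using s by (intro exp_le_quadratic) linarith
    moreover have "(f x)\<^sup>2 \<le> B\<^sup>2" using f[of x] by (metis abs_ge_zero order_trans power2_abs power_mono)
    ultimately show ?thesis by (simp add: power_mult_distrib mult_left_mono order_trans)
  qed
  then have "(\<integral>x. exp (s * f x) \<partial>S) \<le> (\<integral>x. (1 + s * f x + s\<^sup>2 * B\<^sup>2) \<partial>S)"
    using int by (intro S_integral_mono) (auto intro: order_trans[OF exp_ge_zero])
  also have "\<dots> = 1 + (s * (\<integral>x. f x \<partial>S) + s\<^sup>2 * B\<^sup>2)" using int by simp
  also have "\<dots> \<le> exp (s * (\<integral>x. f x \<partial>S) + s\<^sup>2 * B\<^sup>2)" by (rule exp_ge_add_one_self)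
  finally show ?thesis .
qed

lemma exp_markov:
  fixes f :: "(nat \<Rightarrow> real) \<Rightarrow> real"
  assumes [measurable]: "f \<in> borel_measurable S" and f: "\<And>x. \<bar>f x\<bar> \<le> B" and s: "0 \<le> s"
  shows "measure S {x. t \<le> f x} \<le> exp (- (s * t)) * (\<integral>x. exp (s * f x) \<partial>S)"
proof -
  have m: "{x. t \<le> f x} \<in> sets S"
  proof -
    have "{x\<in>space S. t \<le> f x} \<in> sets S" by measurable
    then show ?thesis by simp
  qed
  have "exp (s * t) * measure S {x. t \<le> f x} = (\<integral>x. exp (s * t) * indicator {x. t \<le> f x} x \<partial>S)"
    using m by simp
  also have "\<dots> \<le> (\<integral>x. exp (s * f x) \<partial>S)"
  proof (rule S_integral_mono)
    have "\<bar>s * f x\<bar> \<le> s * B" for x using f[of x] s by (simp add: abs_mult mult_left_mono)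
    then have "s * f x \<le> s * B" for x using abs_le_D1 by blast
    then show "integrable S (\<lambda>x. exp (s * f x))"
      by (intro S_integrable_bounded[where B="exp (s * B)"]) auto
    show "exp (s * t) * indicator {x. t \<le> f x} x \<le> exp (s * f x)" for x
      using s by (simp add: indicator_def mult_left_mono)
  qed simp
  finally have "exp (- (s * t)) * (exp (s * t) * measure S {x. t \<le> f x}) \<le> exp (- (s * t)) * (\<integral>x. exp (s * f x) \<partial>S)"
    by (intro mult_left_mono) auto
  then show ?thesis by (simp add: mult.assoc[symmetric] exp_add[symmetric])
qed

lemma reindex_measurable [measurable]: "(\<lambda>x n. x (f n)) \<in> measurable S S"
proof -
  have "(\<lambda>x. \<lambda>n\<in>UNIV. x (f n)) \<in> measurable S S"
    by (rule measurable_restrict) (rule measurable_component_singleton, simp)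
  then show ?thesis by (simp add: restrict_def)
qed

lemma reindex_distr:
  assumes "inj f" shows "distr S S (\<lambda>x n. x (f n)) = S"
  using distr_PiM_reindex[of UNIV "\<lambda>_. \<nu>" f UNIV] assms prob_\<nu> by (simp add: restrict_def)

text \<open>The product law is invariant under injective selection of sites. This carries bounds for
  initial blocks over to shifted blocks, to rotations of the ring and to pairs of disjoint
  arcs.\<close>

lemma measure_reindex:
  assumes "inj f" "A \<in> sets S"
  shows "measure S ((\<lambda>x n. x (f n)) -` A) = measure S A" "(\<lambda>x n. x (f n)) -` A \<in> sets S"
proof -
  show "(\<lambda>x n. x (f n)) -` A \<in> sets S" using measurable_sets[OF reindex_measurable assms(2), of f] by simp
  have "measure S A = measure (distr S S (\<lambda>x n. x (f n))) A" by (simp add: reindex_distr[OF assms(1)])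
  also have "\<dots> = measure S ((\<lambda>x n. x (f n)) -` A)"
    using measure_distr[OF reindex_measurable assms(2), of f] by simp
  finally show "measure S ((\<lambda>x n. x (f n)) -` A) = measure S A" by simp
qed

text \<open>The constant is exponential in the length, so this serves for blocks of fixed length, or
  for longer ones when the energies are exponentially close.\<close>

lemma V_lipschitz:
  assumes "\<bar>E\<bar> \<le> R" "\<bar>E'\<bar> \<le> R"
  shows "norm (V E x m - V E' x m) \<le> m * ((2 * L ^ m)\<^sup>2 * \<bar>E - E'\<bar>)"
    "\<bar>ln (norm (V E x m)) - ln (norm (V E' x m))\<bar> \<le> m * ((2 * L ^ m)\<^sup>2 * \<bar>E - E'\<bar>)"
proof -
  show *: "norm (V E x m - V E' x m) \<le> m * ((2 * L ^ m)\<^sup>2 * \<bar>E - E'\<bar>)"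
  proof (rule norm_schr_prod_diff_le)
    fix k assume k: "k < m"
    have "2 * L ^ j \<le> 2 * L ^ m" if "j \<le> m" for j using that L_ge_2 by (simp add: power_increasing)
    then have "norm (V E (\<lambda>j. x (Suc k + j)) (m - 1 - k)) \<le> 2 * L ^ m" "norm (V E' x k) \<le> 2 * L ^ m"
      using norm_V_le[OF assms(1), of "\<lambda>j. x (Suc k + j)" "m - 1 - k"] norm_V_le[OF assms(2), of x k] k
      by (meson diff_le_self less_imp_le order_trans)+
    then show "norm (schr_prod (\<lambda>i. E - c (x (Suc k + i))) (m - 1 - k)) * norm (V E' x k) \<le> (2 * L ^ m)\<^sup>2"
      unfolding power2_eq_square using L_ge_2 by (intro mult_mono) auto
  qed simp
  have "\<bar>ln (norm (V E x m)) - ln (norm (V E' x m))\<bar> \<le> \<bar>norm (V E x m) - norm (V E' x m)\<bar>"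
    by (rule abs_ln_diff_le) simp_all
  also have "\<dots> \<le> norm (V E x m - V E' x m)" by (rule norm_triangle_ineq3)
  finally show "\<bar>ln (norm (V E x m)) - ln (norm (V E' x m))\<bar> \<le> m * ((2 * L ^ m)\<^sup>2 * \<bar>E - E'\<bar>)"
    using * by linarith
qed

lemma mean_log_lipschitz:
  assumes "\<bar>E\<bar> \<le> R" "\<bar>E'\<bar> \<le> R"
  shows "\<bar>mean_log m E - mean_log m E'\<bar> \<le> m * ((2 * L ^ m)\<^sup>2 * \<bar>E - E'\<bar>)"
proof -
  let ?D = "m * ((2 * L ^ m)\<^sup>2 * \<bar>E - E'\<bar>)"
  have "mean_log m E - mean_log m E' = (\<integral>x. (ln (norm (V E x m)) - ln (norm (V E' x m))) \<partial>S)"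
    using assms by (simp add: mean_log_def)
  moreover have "- ?D \<le> ln (norm (V E x m)) - ln (norm (V E' x m))"
      "ln (norm (V E x m)) - ln (norm (V E' x m)) \<le> ?D" for x
    using V_lipschitz(2)[OF assms, of x m] unfolding abs_le_iff by linarith+
  ultimately show ?thesis unfolding abs_le_iff
    using integral_le_bound[of "\<lambda>x. ln (norm (V E x m)) - ln (norm (V E' x m))" ?D]
      integral_ge_bound[of "\<lambda>x. ln (norm (V E x m)) - ln (norm (V E' x m))" "- ?D"] assms
    by (simp add: minus_le_iff)
qed

text \<open>The infimum of Fekete's lemma: it bounds every \<open>mean_log n E\<close> from below at
  once. \<open>lyap_limit\<close> identifies it with the limit.\<close>

definition lyap :: "real \<Rightarrow> real" where
  "lyap E = Inf ((\<lambda>n. mean_log n E / real n) ` {1..})"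

lemma lyap_le_mean_log:
  assumes "\<bar>E\<bar> \<le> R" "1 \<le> n" shows "lyap E * n \<le> mean_log n E"
proof -
  have "lyap E \<le> mean_log n E / real n" unfolding lyap_def
    by (rule cInf_lower) (use assms mean_log_nonneg in \<open>auto intro!: bdd_belowI[of _ 0]\<close>)
  then show ?thesis using assms by (simp add: pos_le_divide_eq)
qed

lemma lyap_greatest:
  assumes "\<And>n. 1 \<le> n \<Longrightarrow> z * n \<le> mean_log n E" shows "z \<le> lyap E"
  unfolding lyap_def by (rule cInf_greatest) (use assms in \<open>auto simp: pos_le_divide_eq\<close>)

lemma lyap_nonneg: "\<bar>E\<bar> \<le> R \<Longrightarrow> 0 \<le> lyap E"
  by (rule lyap_greatest) (simp add: mean_log_nonneg)

lemma lyap_le: "\<bar>E\<bar> \<le> R \<Longrightarrow> lyap E \<le> log_bound 1"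
  using lyap_le_mean_log[of E 1] mean_log_le[of E 1] by simp

lemma log_bound_mult: "1 \<le> m \<Longrightarrow> log_bound m \<le> m * log_bound 1"
proof -
  assume "1 \<le> m"
  then have "ln 2 \<le> m * ln (2::real)" using mult_right_mono[of 1 "real m" "ln 2"] by simp
  then show ?thesis by (simp add: log_bound_def algebra_simps)
qed

lemma mean_log_mult_le:
  assumes E: "\<bar>E\<bar> \<le> R" and "1 \<le> j" shows "mean_log (j * m) E \<le> j * mean_log m E"
  using assms(2)
proof (induction j rule: nat_induct_at_least)
  case (Suc j)
  have "mean_log (Suc j * m) E \<le> mean_log m E + mean_log (j * m) E"
    using mean_log_add_le[OF E, of m "j * m"] by simp
  then show ?case using Suc by (simp add: algebra_simps)
qed simp

text \<open>The bound \<beta> has to hold for all starting vectors, since the vector reached after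
  \<open>m\<close> sites is arbitrary.\<close>

lemma mean_log_vec_mult_ge:
  assumes E: "\<bar>E\<bar> \<le> R" and \<beta>: "\<And>y. y \<noteq> 0 \<Longrightarrow> \<beta> \<le> mean_log_vec m E y"
  shows "y \<noteq> 0 \<Longrightarrow> j * \<beta> \<le> mean_log_vec (j * m) E y"
proof (induction j arbitrary: y)
  case 0
  then show ?case by (simp add: mean_log_vec_def)
next
  case (Suc j)
  have nz: "V E x m *v y \<noteq> 0" for x using norm_V_vec_bounds(3)[OF E Suc.prems, of x m] by auto
  have meas: "(\<lambda>x. mean_log_vec (j * m) E (V E x m *v y)) \<in> borel_measurable S"
    using mean_log_vec_measurable[OF Suc.prems E] by simp
  have int: "integrable S (\<lambda>x. mean_log_vec (j * m) E (V E x m *v y))"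
  proof (rule S_integrable_bounded[OF meas])
    show "\<bar>mean_log_vec (j * m) E (V E x m *v y)\<bar> \<le> log_bound (j * m)" for x
      using mean_log_vec_ge[OF E nz, of "j * m" x] mean_log_vec_le[OF E nz, of "j * m" x] mean_log_le[OF E, of "j * m"]
      by linarith
  qed
  have "mean_log_vec (Suc j * m) E y = mean_log_vec m E y + (\<integral>x. mean_log_vec (j * m) E (V E x m *v y) \<partial>S)"
    using mean_log_vec_cocycle[OF E Suc.prems, of m "j * m"] int E Suc.prems by (simp add: mean_log_vec_def)
  moreover have "j * \<beta> \<le> (\<integral>x. mean_log_vec (j * m) E (V E x m *v y) \<partial>S)"
    by (rule integral_ge_bound[OF int]) (rule Suc.IH[OF nz])
  ultimately show ?case using \<beta>[OF Suc.prems] by (simp add: algebra_simps)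
qed

text \<open>Vector growth with a uniform lower bound is superadditive and matrix growth is
  subadditive; the two are compared at the common length \<open>m * n\<close>.\<close>

lemma lyap_ge:
  assumes E: "\<bar>E\<bar> \<le> R" and \<beta>: "\<And>y. y \<noteq> 0 \<Longrightarrow> \<beta> \<le> mean_log_vec m E y" and m: "1 \<le> m"
  shows "\<beta> \<le> lyap E * m"
proof -
  have "\<beta> / m \<le> lyap E"
  proof (rule lyap_greatest)
    fix n :: nat assume n: "1 \<le> n"
    define y :: "real^2" where "y = axis 1 1"
    have "y $ 1 = 1" by (simp add: y_def axis_def)
    then have y: "y \<noteq> 0" by auto
    have "n * \<beta> \<le> mean_log_vec (n * m) E y" by (rule mean_log_vec_mult_ge[OF E \<beta> y])
    also have "\<dots> \<le> mean_log (m * n) E" using mean_log_vec_le[OF E y] by (simp add: mult.commute)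
    also have "\<dots> \<le> m * mean_log n E" by (rule mean_log_mult_le[OF E m])
    finally show "\<beta> / m * n \<le> mean_log n E" using m by (simp add: field_simps)
  qed
  then show ?thesis using m by (simp add: field_simps)
qed

end

context nondegenerate_potential
begin

lemma obtain_fraction:
  assumes "0 < (\<epsilon>::real)" obtains N :: nat where "1 \<le> N" "2 / (real N + 1) * log_bound 1 \<le> \<epsilon>"
proof -
  obtain N :: nat where N: "2 * log_bound 1 / \<epsilon> \<le> N" using real_arch_simple by blast
  have "2 * log_bound 1 \<le> \<epsilon> * N" using N assms by (simp add: pos_divide_le_eq mult.commute)
  also have "\<dots> \<le> \<epsilon> * (real (Suc N) + 1)" using assms by (intro mult_left_mono) auto
  finally show ?thesis by (intro that[of "Suc N"]) (simp_all add: pos_divide_le_eq)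
qed

text \<open>Uniformity in the energy is the point: Fekete's lemma alone gives no rate. Vectors keep
  up with the matrix up to the fraction 2 / (N + 1) and a constant, both independent of the energy,
  and \<open>lyap_ge\<close> turns vector growth into a lower bound for \<open>lyap\<close>.\<close>

lemma mean_log_le_lyap:
  assumes \<epsilon>: "0 < \<epsilon>"
  shows "\<exists>m0\<ge>1. \<forall>m\<ge>m0. \<forall>E. \<bar>E\<bar> \<le> R \<longrightarrow> mean_log m E \<le> (lyap E + \<epsilon>) * m"
proof -
  obtain N where N: "1 \<le> N" "2 / (real N + 1) * log_bound 1 \<le> \<epsilon> / 2" using obtain_fraction[of "\<epsilon> / 2"] \<epsilon> by auto
  obtain C where C: "\<And>E y m. \<bar>E\<bar> \<le> R \<Longrightarrow> y \<noteq> 0 \<Longrightarrow>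
      (real N - 1) / (real N + 1) * mean_log m E - C \<le> mean_log_vec m E y"
    using mean_log_vec_ge_mean_log[OF N(1)] by blast
  obtain m1 :: nat where m1: "2 * C / \<epsilon> \<le> m1" using real_arch_simple by blast
  show ?thesis
  proof (intro exI[of _ "Suc m1"] conjI allI impI)
    fix m E assume m: "Suc m1 \<le> m" and E: "\<bar>E\<bar> \<le> R"
    have 1: "(real N - 1) / (real N + 1) * mean_log m E - C \<le> lyap E * m"
      by (rule lyap_ge[OF E C[OF E]]) (use m in auto)
    have "(real N - 1) / (real N + 1) = 1 - 2 / (real N + 1)" by (simp add: field_simps)
    then have "(1 - 2 / (real N + 1)) * mean_log m E - C \<le> lyap E * m" using 1 by (simp only:)
    then have 2: "mean_log m E \<le> lyap E * m + 2 / (real N + 1) * mean_log m E + C"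
      by (simp add: left_diff_distrib)
    have "2 / (real N + 1) * mean_log m E \<le> 2 / (real N + 1) * (m * log_bound 1)"
      using m mean_log_le[OF E, of m] log_bound_mult[of m] by (intro mult_left_mono) auto
    also have "\<dots> = 2 / (real N + 1) * log_bound 1 * m" by simp
    also have "\<dots> \<le> \<epsilon> / 2 * m" by (intro mult_right_mono N) auto
    finally have 3: "2 / (real N + 1) * mean_log m E \<le> \<epsilon> / 2 * m" .
    have "2 * C / \<epsilon> \<le> m" using m1 m by linarith
    then have "C \<le> \<epsilon> / 2 * m" using \<epsilon> by (simp add: field_simps)
    then show "mean_log m E \<le> (lyap E + \<epsilon>) * m" using 2 3 by (simp add: algebra_simps)
  qed simp
qed

lemma lyap_limit:
  assumes E: "\<bar>E\<bar> \<le> R" shows "(\<lambda>n. mean_log n E / n) \<longlonglongrightarrow> lyap E"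
proof (rule LIMSEQ_I)
  fix \<epsilon> :: real assume \<epsilon>: "0 < \<epsilon>"
  obtain m0 where m0: "1 \<le> m0" "\<And>m. m0 \<le> m \<Longrightarrow> mean_log m E \<le> (lyap E + \<epsilon> / 2) * m"
    using mean_log_le_lyap[of "\<epsilon> / 2"] \<epsilon> E by auto
  have "norm (mean_log n E / n - lyap E) < \<epsilon>" if n: "m0 \<le> n" for n
  proof -
    have "mean_log n E / n \<le> lyap E + \<epsilon> / 2" using m0(2)[OF n] m0(1) n by (simp add: pos_divide_le_eq)
    moreover have "lyap E \<le> mean_log n E / n"
      using lyap_le_mean_log[OF E, of n] m0(1) n by (simp add: pos_le_divide_eq)
    ultimately show ?thesis using \<epsilon> by simp
  qed
  then show "\<exists>no. \<forall>n\<ge>no. norm (mean_log n E / n - lyap E) < \<epsilon>" by blast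
qed

lemma mean_log_vec_ge_lyap:
  assumes \<epsilon>: "0 < \<epsilon>"
  shows "\<exists>C. \<forall>E y m. \<bar>E\<bar> \<le> R \<longrightarrow> y \<noteq> 0 \<longrightarrow> (lyap E - \<epsilon>) * m - C \<le> mean_log_vec m E y"
proof -
  obtain N where N: "1 \<le> N" "2 / (real N + 1) * log_bound 1 \<le> \<epsilon>" using obtain_fraction[OF \<epsilon>] by auto
  obtain C where C: "\<And>E y m. \<bar>E\<bar> \<le> R \<Longrightarrow> y \<noteq> 0 \<Longrightarrow>
      (real N - 1) / (real N + 1) * mean_log m E - C \<le> mean_log_vec m E y"
    using mean_log_vec_ge_mean_log[OF N(1)] by blast
  have "(lyap E - \<epsilon>) * m - C \<le> mean_log_vec m E y" if E: "\<bar>E\<bar> \<le> R" and y: "y \<noteq> 0" for E y m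
  proof -
    define lam where "lam = (real N - 1) / (real N + 1)"
    have lam: "0 \<le> lam" "1 - lam = 2 / (real N + 1)" using N by (simp_all add: lam_def field_simps)
    have "lyap E * m \<le> mean_log m E"
      using lyap_le_mean_log[OF E, of m] mean_log_nonneg[OF E, of m] by (cases m) auto
    then have 1: "lam * (lyap E * m) \<le> lam * mean_log m E" using lam by (intro mult_left_mono)
    have "(1 - lam) * lyap E \<le> 2 / (real N + 1) * log_bound 1"
      unfolding lam(2) by (intro mult_left_mono lyap_le E) auto
    then have "(1 - lam) * lyap E * m \<le> \<epsilon> * m" using N(2) by (intro mult_right_mono) auto
    then have "(lyap E - \<epsilon>) * m \<le> lam * (lyap E * m)" by (simp add: algebra_simps)
    then show ?thesis using 1 C[OF E y, of m] by (simp add: lam_def)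
  qed
  then show ?thesis by blast
qed

text \<open>A single length \<open>m\<close> approximates \<open>lyap\<close> uniformly from above,
  and \<open>mean_log m\<close> is Lipschitz.\<close>

lemma lyap_uniformly_continuous:
  assumes \<epsilon>: "0 < \<epsilon>"
  shows "\<exists>\<delta>>0. \<forall>E E'. \<bar>E\<bar> \<le> R \<longrightarrow> \<bar>E'\<bar> \<le> R \<longrightarrow> \<bar>E - E'\<bar> \<le> \<delta> \<longrightarrow> \<bar>lyap E - lyap E'\<bar> \<le> \<epsilon>"
proof -
  obtain m where m: "1 \<le> m" "\<And>E. \<bar>E\<bar> \<le> R \<Longrightarrow> mean_log m E \<le> (lyap E + \<epsilon> / 2) * m"
    using mean_log_le_lyap[of "\<epsilon> / 2"] \<epsilon> by auto
  define \<delta> where "\<delta> = \<epsilon> / (2 * (2 * L ^ m)\<^sup>2)"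
  have \<delta>: "0 < \<delta>" using \<epsilon> L_ge_2 by (simp add: \<delta>_def)
  have *: "lyap E - lyap E' \<le> \<epsilon>" if E: "\<bar>E\<bar> \<le> R" "\<bar>E'\<bar> \<le> R" "\<bar>E - E'\<bar> \<le> \<delta>" for E E'
  proof -
    have "(2 * L ^ m)\<^sup>2 * \<bar>E - E'\<bar> \<le> (2 * L ^ m)\<^sup>2 * \<delta>" using E by (intro mult_left_mono) auto
    also have "\<dots> = \<epsilon> / 2" using L_ge_2 by (simp add: \<delta>_def)
    finally have "m * ((2 * L ^ m)\<^sup>2 * \<bar>E - E'\<bar>) \<le> m * (\<epsilon> / 2)" by (intro mult_left_mono) auto
    then have "mean_log m E \<le> mean_log m E' + m * (\<epsilon> / 2)"
      using mean_log_lipschitz[OF E(1,2), of m] by linarith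
    then have "lyap E * m \<le> (lyap E' + \<epsilon> / 2) * m + m * (\<epsilon> / 2)"
      using m(2)[OF E(2)] lyap_le_mean_log[OF E(1) m(1)] by linarith
    also have "\<dots> = (lyap E' + \<epsilon>) * m" by (simp add: algebra_simps)
    finally have "lyap E \<le> lyap E' + \<epsilon>" using m(1) by simp
    then show ?thesis by simp
  qed
  show ?thesis
  proof (intro exI[of _ \<delta>] conjI allI impI \<delta>)
    fix E E' assume "\<bar>E\<bar> \<le> R" "\<bar>E'\<bar> \<le> R" "\<bar>E - E'\<bar> \<le> \<delta>"
    then show "\<bar>lyap E - lyap E'\<bar> \<le> \<epsilon>" using *[of E E'] *[of E' E] by (simp add: abs_le_iff abs_minus_commute)
  qed
qed

subsection \<open>Large deviations\<close>

text \<open>The bound \<open>q\<close> is uniform in the starting vector, so conditioning on the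
  first block makes the negative moments multiply.\<close>

lemma neg_moment_le:
  assumes E: "\<bar>E\<bar> \<le> R" and s: "0 \<le> s"
    and q: "\<And>y. y \<noteq> 0 \<Longrightarrow> (\<integral>x. exp (s * - ln (norm (V E x m *v y) / norm y)) \<partial>S) \<le> q"
  shows "y \<noteq> 0 \<Longrightarrow> (\<integral>x. exp (s * - ln (norm (V E x (j * m) *v y) / norm y)) \<partial>S) \<le> q ^ j"
proof (induction j arbitrary: y)
  case 0
  then show ?case by simp
next
  case (Suc j)
  have b: "\<bar>exp (s * - ln (norm (V E x n *v y) / norm y))\<bar> \<le> exp (s * log_bound n)" if "y \<noteq> 0" for x n and y :: "real^2"
  proof -
    have "s * - ln (norm (V E x n *v y) / norm y) \<le> s * log_bound n"
      using ln_norm_V_vec_le(1)[OF E that, of x n] s by (intro mult_left_mono) (auto simp: abs_le_iff)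
    then show ?thesis by simp
  qed
  have q0: "0 \<le> q" by (rule order_trans[OF _ q[OF Suc.prems]]) simp
  have "(\<integral>x. exp (s * - ln (norm (V E x (Suc j * m) *v y) / norm y)) \<partial>S) =
     (\<integral>x. (\<integral>z. exp (s * - ln (norm (V E (comb_seq m x z) (m + j * m) *v y) / norm y)) \<partial>S) \<partial>S)"
    by (subst S_integral_split[where k=m and B="exp (s * log_bound (Suc j * m))"]) (use b[OF Suc.prems] in auto)
  also have "\<dots> \<le> (\<integral>x. exp (s * - ln (norm (V E x m *v y) / norm y)) * q ^ j \<partial>S)"
  proof (rule S_integral_mono)
    show "integrable S (\<lambda>x. exp (s * - ln (norm (V E x m *v y) / norm y)) * q ^ j)"
      by (rule integrable_mult_left) (rule S_integrable_bounded, simp, rule b[OF Suc.prems])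
    fix x
    let ?y = "V E x m *v y"
    have y': "0 < norm ?y" using norm_V_vec_bounds(3)[OF E Suc.prems] .
    then have y'': "?y \<noteq> 0" by auto
    have "exp (s * - ln (norm (V E (comb_seq m x z) (m + j * m) *v y) / norm y)) =
        exp (s * - ln (norm ?y / norm y)) * exp (s * - ln (norm (V E z (j * m) *v ?y) / norm ?y))" for z
    proof -
      have "ln (norm (V E z (j * m) *v ?y) / norm y) = ln (norm ?y / norm y) + ln (norm (V E z (j * m) *v ?y) / norm ?y)"
        using y' Suc.prems norm_V_vec_bounds(3)[OF E y'', of z "j * m"] by (simp add: ln_div)
      then show ?thesis
        by (simp add: V_comb_seq matrix_vector_mul_assoc[symmetric] exp_add[symmetric] algebra_simps del: mat2_mult_vec_nth)
    qed
    then have "(\<integral>z. exp (s * - ln (norm (V E (comb_seq m x z) (m + j * m) *v y) / norm y)) \<partial>S) =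
        exp (s * - ln (norm ?y / norm y)) * (\<integral>z. exp (s * - ln (norm (V E z (j * m) *v ?y) / norm ?y)) \<partial>S)"
      by simp
    also have "\<dots> \<le> exp (s * - ln (norm ?y / norm y)) * q ^ j"
      by (intro mult_left_mono Suc.IH y'') simp
    finally show "(\<integral>z. exp (s * - ln (norm (V E (comb_seq m x z) (m + j * m) *v y) / norm y)) \<partial>S)
        \<le> exp (s * - ln (norm ?y / norm y)) * q ^ j" .
    show "0 \<le> exp (s * - ln (norm ?y / norm y)) * q ^ j" using q0 by simp
  qed
  also have "\<dots> \<le> q * q ^ j" using q[OF Suc.prems] q0 by (simp add: mult_right_mono)
  finally show ?case by simp
qed

text \<open>A small matrix norm forces slow growth of one fixed vector, and the negative exponential
  moment of that growth decays block by block. Rate and threshold are uniform in the energy because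
  the mean bound for vectors is.\<close>

lemma lower_deviation:
  assumes \<epsilon>: "0 < \<epsilon>"
  shows "\<exists>c::real>0. \<forall>\<^sub>F l in sequentially. \<forall>E. \<bar>E\<bar> \<le> R \<longrightarrow>
    measure S {x. norm (V E x l) \<le> exp ((lyap E - \<epsilon>) * l)} \<le> exp (- (c * l))"
proof -
  obtain C where C: "\<And>E y m. \<bar>E\<bar> \<le> R \<Longrightarrow> y \<noteq> 0 \<Longrightarrow> (lyap E - \<epsilon> / 4) * m - C \<le> mean_log_vec m E y"
    using mean_log_vec_ge_lyap[of "\<epsilon> / 4"] \<epsilon> by auto
  obtain m1 :: nat where m1: "4 * C / \<epsilon> \<le> m1" using real_arch_simple by blast
  define m where "m = Suc m1"
  have Cm: "C \<le> \<epsilon> / 4 * m" using m1 \<epsilon> by (simp add: m_def field_simps)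
  define B where "B = log_bound m"
  have B: "0 < B" using L_ge_2 by (simp add: B_def log_bound_def add_pos_nonneg)
  define s where "s = min (1 / B) (\<epsilon> * m / (4 * B\<^sup>2))"
  have s: "0 < s" "s * B \<le> 1" "s * B\<^sup>2 \<le> \<epsilon> / 4 * m"
  proof -
    show "0 < s" using B \<epsilon> by (simp add: s_def m_def)
    have "s * B \<le> 1 / B * B" using B by (intro mult_right_mono) (auto simp: s_def)
    then show "s * B \<le> 1" using B by simp
    have "s * B\<^sup>2 \<le> \<epsilon> * m / (4 * B\<^sup>2) * B\<^sup>2" using B by (intro mult_right_mono) (auto simp: s_def)
    then show "s * B\<^sup>2 \<le> \<epsilon> / 4 * m" using B by simp
  qed
  \<comment> \<open>Pays for the incomplete last block of length \<open>l mod m\<close>: once in the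
    growth, and once in replacing \<open>j * m\<close> by \<open>l\<close>.\<close>
  define D where "D = B + (log_bound 1 + \<epsilon>) * m"
  have main: "measure S {x. norm (V E x l) \<le> exp ((lyap E - \<epsilon>) * l)} \<le> exp (s * D - s * \<epsilon> / 4 * l)"
    if E: "\<bar>E\<bar> \<le> R" for E l
  proof -
    \<comment> \<open>The guaranteed rate. One \<epsilon> / 4 each goes to the mean bound, to the
      constant \<open>C\<close> and to the second-order term; the remaining quarter produces the
      decay.\<close>
    define w where "w = lyap E - 3 * \<epsilon> / 4"
    have w: "\<bar>w\<bar> \<le> log_bound 1 + \<epsilon>" using lyap_le[OF E] lyap_nonneg[OF E] \<epsilon> by (simp add: w_def)
    have q: "(\<integral>x. exp (s * - ln (norm (V E x m *v y) / norm y)) \<partial>S) \<le> exp (- (s * w * m))" if y: "y \<noteq> 0" for y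
    proof -
      have "(\<integral>x. exp (s * - ln (norm (V E x m *v y) / norm y)) \<partial>S)
          \<le> exp (s * (\<integral>x. - ln (norm (V E x m *v y) / norm y) \<partial>S) + s\<^sup>2 * B\<^sup>2)"
        by (rule exp_moment_le) (use ln_norm_V_vec_le(1)[OF E y] s in \<open>auto simp: B_def\<close>)
      also have "\<dots> \<le> exp (- (s * w * m))"
      proof -
        have "s * ((lyap E - \<epsilon> / 4) * m - C - s * B\<^sup>2) \<ge> s * (w * m)"
        proof (rule mult_left_mono)
          show "w * m \<le> (lyap E - \<epsilon> / 4) * m - C - s * B\<^sup>2"
            using Cm s(3) by (simp add: w_def algebra_simps)
        qed (use s in simp)
        moreover have "s * (\<integral>x. ln (norm (V E x m *v y) / norm y) \<partial>S) \<ge> s * ((lyap E - \<epsilon> / 4) * m - C)"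
          using C[OF E y, of m] s by (intro mult_left_mono) (auto simp: mean_log_vec_def)
        ultimately show ?thesis by (simp add: algebra_simps power2_eq_square)
      qed
      finally show ?thesis .
    qed
    define j where "j = l div m"
    define y :: "real^2" where "y = axis 1 1"
    have "y $ 1 = 1" by (simp add: y_def axis_def)
    then have y: "y \<noteq> 0" by auto
    have l: "l = j * m + l mod m" by (simp add: j_def)
    have lm: "l mod m \<le> m" by (simp add: m_def less_imp_le)
    define f where "f x = - ln (norm (V E x (j * m) *v y) / norm y)" for x
    have fm: "f \<in> borel_measurable S" unfolding f_def by measurable
    have sub: "- ((lyap E - \<epsilon>) * l) - B \<le> f x" if "norm (V E x l) \<le> exp ((lyap E - \<epsilon>) * l)" for x
    proof -
      have "ln (norm (V E x l)) \<le> (lyap E - \<epsilon>) * l"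
        using that by (metis ln_exp ln_le_cancel_iff norm_V_pos(3) exp_gt_zero)
      moreover have "ln (norm (V E x l *v y) / norm y) \<le> ln (norm (V E x l))" by (rule ln_norm_V_vec_le(2)[OF E y])
      moreover have "ln (norm (V E x (j * m) *v y) / norm y) - B \<le> ln (norm (V E x l *v y) / norm y)"
      proof -
        let ?y = "V E x (j * m) *v y" and ?x = "\<lambda>i. x (j * m + i)"
        have y': "0 < norm ?y" using norm_V_vec_bounds(3)[OF E y] .
        then have y'': "?y \<noteq> 0" by auto
        have "V E x l = V E ?x (l mod m) ** V E x (j * m)" by (subst l) (rule schr_prod_add)
        then have "V E x l *v y = V E ?x (l mod m) *v ?y" by (simp add: matrix_vector_mul_assoc del: mat2_mult_nth)
        moreover have "ln (norm (V E ?x (l mod m) *v ?y) / norm y) = ln (norm ?y / norm y) + ln (norm (V E ?x (l mod m) *v ?y) / norm ?y)"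
          using y' y norm_V_vec_bounds(3)[OF E y'', of ?x "l mod m"] by (simp add: ln_div)
        moreover have "\<bar>ln (norm (V E ?x (l mod m) *v ?y) / norm ?y)\<bar> \<le> log_bound (l mod m)"
          by (rule ln_norm_V_vec_le(1)[OF E y''])
        moreover have "log_bound (l mod m) \<le> B" using lm L_ge_2 by (simp add: log_bound_def B_def mult_right_mono)
        ultimately show ?thesis by simp
      qed
      ultimately show ?thesis by (simp add: f_def)
    qed
    have "measure S {x. norm (V E x l) \<le> exp ((lyap E - \<epsilon>) * l)} \<le> measure S {x. - ((lyap E - \<epsilon>) * l) - B \<le> f x}"
    proof (rule P.finite_measure_mono)
      have "{x\<in>space S. - ((lyap E - \<epsilon>) * l) - B \<le> f x} \<in> sets S" using fm by measurable
      then show "{x. - ((lyap E - \<epsilon>) * l) - B \<le> f x} \<in> sets S" by simp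
    qed (use sub in auto)
    also have "\<dots> \<le> exp (- (s * (- ((lyap E - \<epsilon>) * l) - B))) * (\<integral>x. exp (s * f x) \<partial>S)"
      by (rule exp_markov[OF fm, of "log_bound (j * m)"]) (use ln_norm_V_vec_le(1)[OF E y] s in \<open>auto simp: f_def\<close>)
    also have "\<dots> \<le> exp (- (s * (- ((lyap E - \<epsilon>) * l) - B))) * exp (- (s * w * m)) ^ j"
      unfolding f_def by (intro mult_left_mono neg_moment_le[OF E _ q y]) (use s in auto)
    also have "\<dots> = exp (s * ((lyap E - \<epsilon>) * l + B - w * (j * m)))"
      by (simp add: exp_of_nat_mult[symmetric] exp_add[symmetric] algebra_simps)
    also have "\<dots> \<le> exp (s * D - s * \<epsilon> / 4 * l)"
    proof -
      have "real l - j * m = real (l mod m)" using l by (metis add_diff_cancel_left' of_nat_add of_nat_mult)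
      then have "w * l - w * (j * m) \<le> (log_bound 1 + \<epsilon>) * m"
        using mult_mono[of w "log_bound 1 + \<epsilon>" "real (l mod m)" m] w lm
          log_bound_nonneg[of 1] \<epsilon> by (simp add: right_diff_distrib[symmetric])
      then have "(lyap E - \<epsilon>) * l + B - w * (j * m) \<le> D - \<epsilon> / 4 * l"
        by (simp add: D_def w_def algebra_simps)
      then have "s * ((lyap E - \<epsilon>) * l + B - w * (j * m)) \<le> s * (D - \<epsilon> / 4 * l)"
        using s by (intro mult_left_mono) auto
      then show ?thesis by (simp add: right_diff_distrib)
    qed
    finally show ?thesis .
  qed
  have "\<forall>\<^sub>F l in sequentially. 8 * D / \<epsilon> \<le> real l" by real_asymp
  then have "\<forall>\<^sub>F l in sequentially. \<forall>E. \<bar>E\<bar> \<le> R \<longrightarrow>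
    measure S {x. norm (V E x l) \<le> exp ((lyap E - \<epsilon>) * l)} \<le> exp (- (s * \<epsilon> / 8 * l))"
  proof (eventually_elim, intro allI impI)
    fix l :: nat and E assume l: "8 * D / \<epsilon> \<le> real l" and E: "\<bar>E\<bar> \<le> R"
    have "D \<le> \<epsilon> / 8 * l" using l \<epsilon> by (simp add: field_simps)
    then have "s * D \<le> s * (\<epsilon> / 8 * l)" using s by (intro mult_left_mono) auto
    then have "exp (s * D - s * \<epsilon> / 4 * l) \<le> exp (- (s * \<epsilon> / 8 * l))" by simp
    then show "measure S {x. norm (V E x l) \<le> exp ((lyap E - \<epsilon>) * l)} \<le> exp (- (s * \<epsilon> / 8 * l))"
      using main[OF E, of l] by linarith
  qed
  then show ?thesis using s \<epsilon> by (intro exI[of _ "s * \<epsilon> / 8"]) auto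
qed

end

section \<open>Upper large deviations, uniform in the energy\<close>

lemma compact_interval_net:
  fixes R \<rho> :: real assumes "0 < \<rho>"
  obtains G where "finite G" "G \<subseteq> {-R..R}" "\<And>E. \<bar>E\<bar> \<le> R \<Longrightarrow> \<exists>E'\<in>G. \<bar>E - E'\<bar> \<le> \<rho>"
proof -
  obtain G where G: "G \<subseteq> {-R..R}" "finite G" "{-R..R} \<subseteq> (\<Union>E'\<in>G. ball E' \<rho>)"
    using compactE_image[of "{-R..R}" "{-R..R}" "\<lambda>E'. ball E' \<rho>"] assms by (metis UN_I centre_in_ball compact_Icc open_ball subsetI)
  show ?thesis
  proof (rule that[OF G(2,1)])
    fix E assume "\<bar>E\<bar> \<le> R"
    then have "E \<in> {-R..R}" by auto
    then obtain E' where "E' \<in> G" "E \<in> ball E' \<rho>" using G(3) by blast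
    then show "\<exists>E'\<in>G. \<bar>E - E'\<bar> \<le> \<rho>" by (auto simp: dist_real_def abs_minus_commute intro!: bexI[of _ E'])
  qed
qed

lemma ln_norm_mat2_mult_le:
  assumes "mat2_det (A::real^2^2) = 1" "mat2_det (B::real^2^2) = 1"
  shows "ln (norm (A ** B)) \<le> ln (norm A) + ln (norm B)"
proof -
  have p: "1 \<le> norm (A ** B)" "1 \<le> norm A" "1 \<le> norm B"
    using assms by (auto intro!: norm_mat2_ge_1 simp: mat2_det_mult)
  then have pos: "0 < norm (A ** B)" "0 < norm A" "0 < norm B" by linarith+
  have "ln (norm (A ** B)) \<le> ln (norm A * norm B)"
    using norm_mat2_mult_le pos by (intro iffD2[OF ln_le_cancel_iff]) auto
  then show ?thesis using pos by (simp add: ln_mult)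
qed

context nondegenerate_potential
begin

text \<open>By submultiplicativity an upper bound, up to constants, for the logarithm of the whole
  product; unlike that logarithm it is a sum of independent identically distributed terms.\<close>

definition block_sum :: "nat \<Rightarrow> real \<Rightarrow> nat \<Rightarrow> (nat \<Rightarrow> real) \<Rightarrow> real" where
  "block_sum m E j x = (\<Sum>i<j. ln (norm (V E (\<lambda>t. x (i * m + t)) m)))"

lemma ln_norm_V_le_block_sum:
  assumes E: "\<bar>E\<bar> \<le> R"
  shows "ln (norm (V E x (j * m + r))) \<le> block_sum m E j x + log_bound 0 + log_bound r"
proof -
  have "ln (norm (V E x (j * m))) \<le> block_sum m E j x + log_bound 0"
  proof (induction j)
    case 0
    show ?case using ln_norm_V_le(1)[OF E, of x 0] by (simp add: block_sum_def)
  next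
    case (Suc j)
    have "V E x (Suc j * m) = V E (\<lambda>t. x (j * m + t)) m ** V E x (j * m)"
      using schr_prod_add[of "\<lambda>i. E - c (x i)" "j * m" m] by (simp add: add.commute)
    then have "ln (norm (V E x (Suc j * m))) \<le> ln (norm (V E (\<lambda>t. x (j * m + t)) m)) + ln (norm (V E x (j * m)))"
      using ln_norm_mat2_mult_le[of "V E (\<lambda>t. x (j * m + t)) m" "V E x (j * m)"] by simp
    then show ?case using Suc by (simp add: block_sum_def)
  qed
  moreover have "ln (norm (V E x (j * m + r))) \<le> ln (norm (V E (\<lambda>t. x (j * m + t)) r)) + ln (norm (V E x (j * m)))"
    unfolding schr_prod_add by (rule ln_norm_mat2_mult_le) simp_all
  moreover have "ln (norm (V E (\<lambda>t. x (j * m + t)) r)) \<le> log_bound r"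
    using ln_norm_V_le(1)[OF E, of "\<lambda>t. x (j * m + t)" r] by linarith
  ultimately show ?thesis by linarith
qed

lemma block_sum_measurable [measurable]: "block_sum m E j \<in> borel_measurable S"
proof -
  have [measurable]: "(\<lambda>x. norm (V E (\<lambda>t. x (i * m + t)) m)) \<in> borel_measurable S" for i
    using measurable_compose[OF reindex_measurable[of "\<lambda>t. i * m + t"] norm_V_measurable] .
  show ?thesis unfolding block_sum_def[abs_def] by measurable
qed

lemma block_sum_bound: "\<bar>E\<bar> \<le> R \<Longrightarrow> \<bar>block_sum m E j x\<bar> \<le> j * log_bound m"
proof -
  assume E: "\<bar>E\<bar> \<le> R"
  have "\<bar>block_sum m E j x\<bar> \<le> (\<Sum>i<j. \<bar>ln (norm (V E (\<lambda>t. x (i * m + t)) m))\<bar>)"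
    unfolding block_sum_def by (rule sum_abs)
  also have "\<dots> \<le> (\<Sum>i<j. log_bound m)" by (rule sum_mono) (rule ln_norm_V_le(1)[OF E])
  finally show ?thesis by simp
qed

lemma block_sum_moment:
  assumes E: "\<bar>E\<bar> \<le> R" and s: "0 \<le> s"
  shows "(\<integral>x. exp (s * block_sum m E j x) \<partial>S) = (\<integral>x. exp (s * ln (norm (V E x m))) \<partial>S) ^ j"
proof (induction j)
  case 0
  show ?case by (simp add: block_sum_def)
next
  case (Suc j)
  have b: "\<bar>exp (s * block_sum m E n x)\<bar> \<le> exp (s * (n * log_bound m))" for n x
  proof -
    have "s * block_sum m E n x \<le> s * (n * log_bound m)"
      using block_sum_bound[OF E, of m n x] s by (intro mult_left_mono) auto
    then show ?thesis by simp
  qed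
  have split: "block_sum m E (Suc j) (comb_seq m x y) = ln (norm (V E x m)) + block_sum m E j y" for x y
  proof -
    have "V E (\<lambda>t. comb_seq m x y (0 * m + t)) m = V E x m"
      by (rule schr_prod_cong) (simp add: comb_seq_def)
    moreover have "V E (\<lambda>t. comb_seq m x y (Suc i * m + t)) m = V E (\<lambda>t. y (i * m + t)) m" for i
      by (rule schr_prod_cong) (simp add: comb_seq_def add.assoc)
    ultimately show ?thesis
      by (simp only: block_sum_def sum.lessThan_Suc_shift)
  qed
  have "(\<integral>x. exp (s * block_sum m E (Suc j) x) \<partial>S)
      = (\<integral>x. (\<integral>y. exp (s * block_sum m E (Suc j) (comb_seq m x y)) \<partial>S) \<partial>S)"
    by (rule S_integral_split) (measurable, rule b)
  also have "\<dots> = (\<integral>x. exp (s * ln (norm (V E x m))) * (\<integral>y. exp (s * block_sum m E j y) \<partial>S) \<partial>S)"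
    unfolding split distrib_left exp_add by simp
  finally show ?case by (simp add: Suc)
qed

text \<open>A large product forces a large sum of block logarithms, and blocks of the fixed length
  \<open>m\<close> are Lipschitz in the energy. So the energies can be replaced by a net whose size
  does not depend on \<open>n\<close>, and the union over net and block counts costs only a factor
  linear in \<open>n\<close>.\<close>

lemma uniform_upper:
  fixes \<delta> :: real
  assumes \<delta>: "0 < \<delta>"
  shows "\<exists>c::real>0. \<forall>\<^sub>F n in sequentially. \<exists>Z\<in>sets S. measure S Z \<le> exp (- (c * n)) \<and>
    (\<forall>x. x \<notin> Z \<longrightarrow> (\<forall>E k. \<bar>E\<bar> \<le> R \<longrightarrow> k \<le> n \<longrightarrow> norm (V E x k) \<le> exp (lyap E * k + \<delta> * n)))"
proof -
  obtain m where m: "1 \<le> m" "\<And>E. \<bar>E\<bar> \<le> R \<Longrightarrow> mean_log m E \<le> (lyap E + \<delta> / 8) * m"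
    using mean_log_le_lyap[of "\<delta> / 8"] \<delta> by auto
  define B where "B = log_bound m"
  have B: "0 < B" using L_ge_2 by (simp add: B_def log_bound_def add_pos_nonneg)
  define s where "s = min (1 / B) (\<delta> * m / (8 * B\<^sup>2))"
  have s: "0 < s" "s * B \<le> 1" "s * B\<^sup>2 \<le> \<delta> / 8 * m"
  proof -
    show "0 < s" using B \<delta> m by (simp add: s_def)
    have "s * B \<le> 1 / B * B" using B by (intro mult_right_mono) (auto simp: s_def)
    then show "s * B \<le> 1" using B by simp
    have "s * B\<^sup>2 \<le> \<delta> * m / (8 * B\<^sup>2) * B\<^sup>2" using B by (intro mult_right_mono) (auto simp: s_def)
    then show "s * B\<^sup>2 \<le> \<delta> / 8 * m" using B by simp
  qed
  obtain \<rho>0 where \<rho>0: "0 < \<rho>0" "\<And>E E'. \<bar>E\<bar> \<le> R \<Longrightarrow> \<bar>E'\<bar> \<le> R \<Longrightarrow> \<bar>E - E'\<bar> \<le> \<rho>0 \<Longrightarrow> \<bar>lyap E - lyap E'\<bar> \<le> \<delta> / 8"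
    using lyap_uniformly_continuous[of "\<delta> / 8"] \<delta> by auto
  \<comment> \<open>Within this distance both \<open>lyap\<close> and the logarithm of a block, per
    site, move by at most \<delta> / 8.\<close>
  define \<rho> where "\<rho> = min \<rho>0 (\<delta> / (8 * (2 * L ^ m)\<^sup>2))"
  have \<rho>: "0 < \<rho>" using \<rho>0 \<delta> L_ge_2 by (simp add: \<rho>_def)
  obtain G where G: "finite G" "G \<subseteq> {-R..R}" "\<And>E. \<bar>E\<bar> \<le> R \<Longrightarrow> \<exists>E'\<in>G. \<bar>E - E'\<bar> \<le> \<rho>"
    using compact_interval_net[OF \<rho>] by blast
  have GR: "\<bar>E'\<bar> \<le> R" if "E' \<in> G" for E' using G(2) that by force
  \<comment> \<open>Mean and second-order term use up \<open>lyap E' + \<delta> / 4\<close> per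
    site. The part \<delta> n / 4 is independent of \<open>j\<close>, so the probability decays in
    \<open>n\<close> even for few blocks.\<close>
  define thr where "thr E' j n = (lyap E' + 3 * \<delta> / 8) * (j * m) + \<delta> * n / 4" for E' j n
  define T where "T n p = {x. thr (fst p) (snd p) n \<le> block_sum m (fst p) (snd p) x}" for n :: nat and p
  have T_meas: "T n p \<in> sets S" for n p
  proof -
    have "{x\<in>space S. thr (fst p) (snd p) n \<le> block_sum m (fst p) (snd p) x} \<in> sets S" by measurable
    then show ?thesis by (simp add: T_def)
  qed
  have T_le: "measure S (T n p) \<le> exp (- (s * \<delta> / 4 * n))" if p: "p \<in> G \<times> {..n}" for n p
  proof -
    obtain E' j where pe: "p = (E', j)" "E' \<in> G" using p by auto
    have E': "\<bar>E'\<bar> \<le> R" using GR pe by simp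
    have "(\<integral>x. exp (s * ln (norm (V E' x m))) \<partial>S) \<le> exp (s * mean_log m E' + s\<^sup>2 * B\<^sup>2)"
      unfolding mean_log_def by (rule exp_moment_le) (use ln_norm_V_le(1)[OF E'] s in \<open>auto simp: B_def\<close>)
    also have "\<dots> \<le> exp (s * ((lyap E' + \<delta> / 4) * m))"
    proof -
      have "mean_log m E' + s * B\<^sup>2 \<le> (lyap E' + \<delta> / 4) * m" using m(2)[OF E'] s(3) by (simp add: algebra_simps)
      then have "s * (mean_log m E' + s * B\<^sup>2) \<le> s * ((lyap E' + \<delta> / 4) * m)" using s by (intro mult_left_mono) auto
      then show ?thesis by (simp add: algebra_simps power2_eq_square)
    qed
    finally have q: "(\<integral>x. exp (s * ln (norm (V E' x m))) \<partial>S) ^ j \<le> exp (s * ((lyap E' + \<delta> / 4) * m)) ^ j"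
      by (intro power_mono) (auto intro!: Bochner_Integration.integral_nonneg)
    have "measure S (T n p) \<le> exp (- (s * thr E' j n)) * (\<integral>x. exp (s * block_sum m E' j x) \<partial>S)"
      unfolding T_def pe fst_conv snd_conv
      by (rule exp_markov[where B="j * log_bound m"]) (use block_sum_bound[OF E'] s in auto)
    also have "\<dots> \<le> exp (- (s * thr E' j n)) * exp (s * ((lyap E' + \<delta> / 4) * m)) ^ j"
      unfolding block_sum_moment[OF E' less_imp_le[OF s(1)]] by (intro mult_left_mono q) simp
    also have "\<dots> = exp (s * (j * ((lyap E' + \<delta> / 4) * m) - thr E' j n))"
      by (simp add: exp_of_nat_mult[symmetric] exp_add[symmetric] algebra_simps)
    also have "\<dots> \<le> exp (s * (- (\<delta> / 4 * n)))"
    proof -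
      have "j * ((lyap E' + \<delta> / 4) * m) - thr E' j n \<le> - (\<delta> / 4 * n)"
        using \<delta> by (simp add: thr_def algebra_simps)
      from mult_left_mono[OF this less_imp_le[OF s(1)]] show ?thesis by (simp only: exp_le_cancel_iff)
    qed
    finally show ?thesis by (simp add: mult_ac)
  qed
  define a' where "a' = s * \<delta> / 4"
  have a': "0 < a'" using s \<delta> by (simp add: a'_def)
  define cG where "cG = real (card G)"
  have cG: "0 \<le> cG" by (simp add: cG_def)
  define lb where "lb = log_bound 0 + log_bound m"
  have ev1: "\<forall>\<^sub>F n in sequentially. cG * (real n + 1) * exp (- (a' * real n)) \<le> exp (- (a' / 2 * real n))"
    using a' by real_asymp
  have ev2: "\<forall>\<^sub>F n in sequentially. lb * 8 / \<delta> \<le> real n" by real_asymp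
  have "\<forall>\<^sub>F n in sequentially. \<exists>Z\<in>sets S. measure S Z \<le> exp (- (a' / 2 * n)) \<and>
    (\<forall>x. x \<notin> Z \<longrightarrow> (\<forall>E k. \<bar>E\<bar> \<le> R \<longrightarrow> k \<le> n \<longrightarrow> norm (V E x k) \<le> exp (lyap E * k + \<delta> * n)))"
    using ev1 ev2
  proof eventually_elim
    case (elim n)
    define Z where "Z = (\<Union>p\<in>G \<times> {..n}. T n p)"
    have fin: "finite (G \<times> {..n})" using G(1) by simp
    have Z: "Z \<in> sets S" unfolding Z_def using fin T_meas by (intro sets.finite_UN) auto
    have "measure S Z \<le> (\<Sum>p\<in>G \<times> {..n}. measure S (T n p))"
      unfolding Z_def by (rule P.finite_measure_subadditive_finite) (use fin T_meas in auto)
    also have "\<dots> \<le> (\<Sum>p\<in>G \<times> {..n}. exp (- (a' * n)))"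
      by (rule sum_mono) (use T_le in \<open>auto simp: a'_def\<close>)
    also have "\<dots> = cG * (real n + 1) * exp (- (a' * n))" by (simp add: cG_def card_cartesian_product algebra_simps)
    finally have mZ: "measure S Z \<le> exp (- (a' / 2 * n))" using elim(1) by linarith
    have "norm (V E x k) \<le> exp (lyap E * k + \<delta> * n)" if x: "x \<notin> Z" and E: "\<bar>E\<bar> \<le> R" and k: "k \<le> n" for x E k
    proof -
      obtain E' where E': "E' \<in> G" "\<bar>E - E'\<bar> \<le> \<rho>" using G(3)[OF E] by blast
      note E'R = GR[OF E'(1)]
      define j where "j = k div m"
      have kj: "k = j * m + k mod m" by (simp add: j_def)
      have "j \<le> n" using k by (metis div_le_dividend j_def order_trans)
      then have "x \<notin> T n (E', j)" using x E'(1) unfolding Z_def by blast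
      then have 1: "block_sum m E' j x \<le> thr E' j n" by (simp add: T_def)
      have "block_sum m E j x - block_sum m E' j x \<le> (\<Sum>i<j. \<delta> / 8 * m)"
        unfolding block_sum_def sum_subtractf[symmetric]
      proof (rule sum_mono)
        fix i
        let ?x = "\<lambda>t. x (i * m + t)"
        have "m * ((2 * L ^ m)\<^sup>2 * \<bar>E - E'\<bar>) \<le> m * ((2 * L ^ m)\<^sup>2 * (\<delta> / (8 * (2 * L ^ m)\<^sup>2)))"
          using E'(2) by (intro mult_left_mono) (auto simp: \<rho>_def)
        also have "\<dots> = \<delta> / 8 * m" using L_ge_2 by simp
        finally show "ln (norm (V E ?x m)) - ln (norm (V E' ?x m)) \<le> \<delta> / 8 * m"
          using V_lipschitz(2)[OF E E'R, of ?x m] by linarith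
      qed
      then have 2: "block_sum m E j x \<le> block_sum m E' j x + \<delta> / 8 * (j * m)" by (simp add: mult_ac)
      have jk: "real (j * m) \<le> k" using kj by (metis le_add1 of_nat_le_iff)
      have "\<bar>lyap E - lyap E'\<bar> \<le> \<delta> / 8" by (rule \<rho>0(2)[OF E E'R]) (use E'(2) in \<open>simp add: \<rho>_def\<close>)
      then have "lyap E' \<le> lyap E + \<delta> / 8" by linarith
      then have "(lyap E' + \<delta> / 2) * (j * m) \<le> (lyap E + 5 * \<delta> / 8) * (j * m)" by (intro mult_right_mono) auto
      also have "\<dots> \<le> (lyap E + 5 * \<delta> / 8) * k" using jk lyap_nonneg[OF E] \<delta> by (intro mult_left_mono) auto
      also have "\<dots> \<le> lyap E * k + 5 * \<delta> / 8 * n" using k \<delta> by (simp add: distrib_right mult_left_mono)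
      finally have 3: "(lyap E' + \<delta> / 2) * (j * m) \<le> lyap E * k + 5 * \<delta> / 8 * n" .
      have "log_bound (k mod m) \<le> log_bound m" 
        using L_ge_2 m(1) by (simp add: log_bound_def mult_right_mono less_imp_le)
      moreover have "lb \<le> \<delta> / 8 * n" using elim(2) \<delta> by (simp add: field_simps)
      moreover have "ln (norm (V E x k)) \<le> block_sum m E j x + log_bound 0 + log_bound (k mod m)"
        using ln_norm_V_le_block_sum[OF E, of x j m "k mod m"] kj by simp
      ultimately have "ln (norm (V E x k)) \<le> block_sum m E j x + \<delta> / 8 * n" by (simp add: lb_def)
      also have "\<dots> \<le> (lyap E' + \<delta> / 2) * (j * m) + 3 * \<delta> / 8 * n"
        using 1 2 by (simp add: thr_def algebra_simps)
      also have "\<dots> \<le> lyap E * k + \<delta> * n" using 3 by simp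
      finally have "exp (ln (norm (V E x k))) \<le> exp (lyap E * k + \<delta> * n)"
        unfolding exp_le_cancel_iff .
      then show ?thesis by (simp only: exp_ln norm_V_pos)
    qed
    then show ?case using Z mZ by blast
  qed
  then show ?thesis using a' by (intro exI[of _ "a' / 2"]) auto
qed

end

subsection \<open>Chains of blocks\<close>

lemma chain_lower:
  fixes u :: "nat \<Rightarrow> real"
  assumes mono: "\<And>s. s < q \<Longrightarrow> t s \<le> t (Suc s)"
    and U: "\<And>s. s < q \<Longrightarrow> norm (schr_prod (\<lambda>k. u (t s + k)) (t (Suc s) - t s)) \<le> U"
    and W: "\<And>s. Suc s < q \<Longrightarrow> W \<le> norm (schr_prod (\<lambda>k. u (t s + k)) (t (Suc (Suc s)) - t s))"
    and "1 \<le> q" "8 * U \<le> W" "0 < U"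
  shows "(W / (8 * U)) ^ (q - 1) \<le> norm (schr_prod (\<lambda>k. u (t 0 + k)) (t q - t 0))"
proof -
  define B where "B s = schr_prod (\<lambda>k. u (t s + k)) (t (Suc s) - t s)" for s
  have "(W / (8 * U)) ^ (q - 1) \<le> norm (chain_prod B q)"
  proof (rule avalanche)
    fix s assume s: "Suc s < q"
    have "t s \<le> t (Suc s)" "t (Suc s) \<le> t (Suc (Suc s))" using mono s by auto
    then have "schr_prod (\<lambda>k. u (t s + k)) (t (Suc (Suc s)) - t s) = B (Suc s) ** B s"
      using schr_prod_add[of "\<lambda>k. u (t s + k)" "t (Suc s) - t s" "t (Suc (Suc s)) - t (Suc s)"]
      by (simp add: B_def add.assoc[symmetric])
    then show "W \<le> norm (B (Suc s) ** B s)" using W[OF s] by simp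
  qed (use U assms in \<open>auto simp: B_def\<close>)
  moreover have "chain_prod B q = schr_prod (\<lambda>k. u (t 0 + k)) (t q - t 0)"
    unfolding B_def by (rule schr_prod_eq_chain_prod[where t=t]) (rule mono)
  ultimately show ?thesis by simp
qed

text \<open>Here \<gamma> is the expected logarithmic growth of one block, not of one site. Single
  blocks need only an upper bound, with excess \<open>D1\<close>; lower bounds, with deficit
  \<open>D2\<close>, are asked of adjacent pairs.\<close>

lemma chain_lower_exp:
  fixes u :: "nat \<Rightarrow> real"
  assumes mono: "\<And>s. s < q \<Longrightarrow> t s \<le> t (Suc s)"
    and U: "\<And>s. s < q \<Longrightarrow> norm (schr_prod (\<lambda>k. u (t s + k)) (t (Suc s) - t s)) \<le> exp (\<gamma> + D1)"
    and W: "\<And>s. Suc s < q \<Longrightarrow> exp (2 * \<gamma> - D2) \<le> norm (schr_prod (\<lambda>k. u (t s + k)) (t (Suc (Suc s)) - t s))"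
    and "1 \<le> q" "D1 + D2 + ln 8 \<le> \<gamma>"
  shows "exp ((real q - 1) * (\<gamma> - D1 - D2 - ln 8)) \<le> norm (schr_prod (\<lambda>k. u (t 0 + k)) (t q - t 0))"
proof -
  have r: "exp (2 * \<gamma> - D2) / (8 * exp (\<gamma> + D1)) = exp (\<gamma> - D1 - D2 - ln 8)"
  proof -
    have "8 * exp (\<gamma> + D1) = exp (\<gamma> + D1 + ln 8)" by (simp add: exp_add)
    then show ?thesis by (simp add: exp_diff[symmetric] algebra_simps)
  qed
  have "(exp (2 * \<gamma> - D2) / (8 * exp (\<gamma> + D1))) ^ (q - 1) \<le> norm (schr_prod (\<lambda>k. u (t 0 + k)) (t q - t 0))"
  proof (rule chain_lower[where t=t and u=u])
    have "1 \<le> exp (\<gamma> - D1 - D2 - ln 8)" using assms by simp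
    then show "8 * exp (\<gamma> + D1) \<le> exp (2 * \<gamma> - D2)"
      unfolding r[symmetric] by (simp add: pos_le_divide_eq)
  qed (use assms mono U W in auto)
  moreover have "exp (\<gamma> - D1 - D2 - ln 8) ^ (q - 1) = exp ((real q - 1) * (\<gamma> - D1 - D2 - ln 8))"
    using \<open>1 \<le> q\<close> by (simp add: exp_of_nat_mult[symmetric] of_nat_diff)
  ultimately show ?thesis unfolding r by simp
qed

text \<open>The points \<open>s * n div q\<close> cut \<open>n\<close> sites into \<open>q\<close>
  nearly equal blocks; any run of \<open>k\<close> of them has the ideal length up to 1.\<close>

lemma div_block_bounds:
  fixes s k n q :: nat assumes "0 < q"
  shows "s * n div q \<le> (s + k) * n div q"
    "real ((s + k) * n div q - s * n div q) \<le> k * (n / q) + 1"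
    "k * (n / q) - 1 \<le> real ((s + k) * n div q - s * n div q)"
proof -
  show mono: "s * n div q \<le> (s + k) * n div q" by (intro div_le_mono) simp
  have b: "real (y div q) \<le> y / q" "y / q - 1 \<le> real (y div q)" for y
  proof -
    have e: "real y = real q * real (y div q) + real (y mod q)"
      by (metis of_nat_add of_nat_mult mult_div_mod_eq)
    show "real (y div q) \<le> y / q" using assms e by (simp add: pos_le_divide_eq mult.commute)
    have "real (y mod q) \<le> q" using assms by (simp add: less_imp_le)
    then have "real y \<le> real q * (real (y div q) + 1)" using e by (simp add: distrib_left)
    then show "y / q - 1 \<le> real (y div q)" using assms by (simp add: field_simps)
  qed
  have "real ((s + k) * n) / q = real (s * n) / q + k * (n / q)"
    by (simp add: add_divide_distrib distrib_right)
  then show "real ((s + k) * n div q - s * n div q) \<le> k * (n / q) + 1"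
    "k * (n / q) - 1 \<le> real ((s + k) * n div q - s * n div q)"
    using b[of "(s + k) * n"] b[of "s * n"] mono by (simp_all add: of_nat_diff)
qed

section \<open>Exclusion of double resonances\<close>

lemma schr_prod_poly:
  fixes w :: "nat \<Rightarrow> real"
  shows "\<exists>p. degree p \<le> n \<and> (\<forall>E. schr_prod (\<lambda>k. E - w k) n $ i $ j = poly p E)"
proof -
  have "\<forall>i j. \<exists>p. degree p \<le> n \<and> (\<forall>E. schr_prod (\<lambda>k. E - w k) n $ i $ j = poly p E)"
  proof (induction n)
    case 0
    show ?case by (intro allI, rule_tac x="[:Finite_Cartesian_Product.mat 1 $ i $ j:]" in exI) simp
  next
    case (Suc n)
    show ?case
    proof (intro allI)
      fix i j :: 2
      obtain p q where p: "degree p \<le> n" "\<And>E. schr_prod (\<lambda>k. E - w k) n $ 1 $ j = poly p E"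
        and q: "degree q \<le> n" "\<And>E. schr_prod (\<lambda>k. E - w k) n $ 2 $ j = poly q E"
        using Suc by metis
      have "i = 1 \<or> i = 2" using exhaust_2 by auto
      then show "\<exists>p. degree p \<le> Suc n \<and> (\<forall>E. schr_prod (\<lambda>k. E - w k) (Suc n) $ i $ j = poly p E)"
      proof
        assume i: "i = 1"
        have "degree ([:- w n, 1:] * p - q) \<le> Suc n"
          using p(1) q(1) degree_mult_le[of "[:- w n, 1:]" p] by (intro degree_diff_le) auto
        moreover have "schr_prod (\<lambda>k. E - w k) (Suc n) $ 1 $ j = poly ([:- w n, 1:] * p - q) E" for E
          using p(2)[of E] q(2)[of E] by (simp add: algebra_simps)
        ultimately show ?thesis unfolding i by blast
      next
        assume i: "i = 2"
        show ?thesis unfolding i using p by (intro exI[of _ p]) simp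
      qed
    qed
  qed
  then show ?thesis by blast
qed

lemma norm_schr_prod_poly:
  fixes w :: "nat \<Rightarrow> real"
  shows "\<exists>p. degree p \<le> 2 * n \<and> (\<forall>E. (norm (schr_prod (\<lambda>k. E - w k) n))\<^sup>2 = poly p E)"
proof -
  obtain p where p: "\<And>i j. degree (p i j) \<le> n"
      "\<And>i j E. schr_prod (\<lambda>k. E - w k) n $ i $ j = poly (p i j) E"
    using schr_prod_poly[of n w] by metis
  define P where "P = p 1 1 * p 1 1 + p 1 2 * p 1 2 + p 2 1 * p 2 1 + p 2 2 * p 2 2"
  have "degree (p i j * p i j) \<le> 2 * n" for i j
    using degree_mult_le[of "p i j" "p i j"] p(1)[of i j] by simp
  then have "degree P \<le> 2 * n" unfolding P_def by (intro degree_add_le) auto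
  moreover have "(norm (schr_prod (\<lambda>k. E - w k) n))\<^sup>2 = poly P E" for E
    unfolding norm_mat2_sq p(2) P_def by (simp add: power2_eq_square)
  ultimately show ?thesis by blast
qed

text \<open>A cell counted below contains a root of the polynomial \<open>norm\<^sup>2 - \<tau>\<^sup>2\<close>, whose degree does not
  depend on the number of cells.\<close>

lemma card_cells_le:
  fixes w :: "nat \<Rightarrow> real" and e :: "nat \<Rightarrow> real"
  assumes cells: "\<And>i j. i < j \<Longrightarrow> e i + d \<le> e j" and \<tau>: "0 < \<tau>"
    and J: "finite J" "\<And>j. j \<in> J \<Longrightarrow> \<tau> \<le> norm (schr_prod (\<lambda>k. e j - w k) n)"
      "\<And>j. j \<in> J \<Longrightarrow> \<exists>E. e j \<le> E \<and> E < e j + d \<and> norm (schr_prod (\<lambda>k. E - w k) n) < \<tau>"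
  shows "card J \<le> 2 * n"
proof (cases "J = {}")
  case False
  obtain p where p: "degree p \<le> 2 * n" "\<And>E. (norm (schr_prod (\<lambda>k. E - w k) n))\<^sup>2 = poly p E"
    using norm_schr_prod_poly[of n w] by blast
  define r where "r = p - [:\<tau>\<^sup>2:]"
  have deg: "degree r \<le> 2 * n" unfolding r_def using p(1) by (intro degree_diff_le) auto
  have neg: "poly r E < 0" if "norm (schr_prod (\<lambda>k. E - w k) n) < \<tau>" for E
    using power_strict_mono[OF that, of 2] by (simp add: r_def p(2))
  have root: "\<exists>z. e j \<le> z \<and> z < e j + d \<and> poly r z = 0" if j: "j \<in> J" for j
  proof -
    obtain E where E: "e j \<le> E" "E < e j + d" "norm (schr_prod (\<lambda>k. E - w k) n) < \<tau>" using J(3)[OF j] by blast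
    have "0 \<le> poly r (e j)"
      using power_mono[OF J(2)[OF j], of 2] \<tau> by (simp add: r_def p(2))
    then have "\<exists>z\<ge>e j. z \<le> E \<and> poly r z = 0"
      by (intro IVT2') (use E neg[OF E(3)] in \<open>auto intro!: continuous_intros\<close>)
    then show ?thesis using E(2) by force
  qed
  then obtain z where z: "\<And>j. j \<in> J \<Longrightarrow> e j \<le> z j \<and> z j < e j + d \<and> poly r (z j) = 0" by metis
  have "r \<noteq> 0"
  proof -
    obtain j where "j \<in> J" using False by blast
    then obtain E where "norm (schr_prod (\<lambda>k. E - w k) n) < \<tau>" using J(3) by blast
    then show ?thesis using neg[of E] by auto
  qed
  have "inj_on z J"
  proof (rule inj_onI)
    fix i j assume ij: "i \<in> J" "j \<in> J" "z i = z j"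
    then show "i = j" using z[of i] z[of j] cells[of i j] cells[of j i]
      by (cases i j rule: linorder_cases) auto
  qed
  then have "card J = card (z ` J)" by (simp add: card_image)
  also have "\<dots> \<le> card {x. poly r x = 0}"
    using z \<open>r \<noteq> 0\<close> by (intro card_mono poly_roots_finite) auto
  also have "\<dots> \<le> 2 * n" using card_poly_roots_bound[OF \<open>r \<noteq> 0\<close>] deg by linarith
  finally show ?thesis .
qed simp

context random_potential
begin

text \<open>The second assumption says that \<open>A\<close> depends on the first \<open>k\<close>
  coordinates only; the shifted \<open>B\<close> depends on the later ones.\<close>

lemma measure_split_indep:
  assumes A: "A \<in> sets S" "\<And>x y. comb_seq k x y \<in> A \<longleftrightarrow> x \<in> A" and B: "B \<in> sets S"
  shows "measure S (A \<inter> (\<lambda>x i. x (k + i)) -` B) = measure S A * measure S B"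
proof -
  define B' where "B' = (\<lambda>x i. x (k + i)) -` B"
  have B': "B' \<in> sets S" unfolding B'_def by (rule measure_reindex(2)[OF _ B]) (simp add: inj_def)
  have [measurable]: "A \<in> sets S" "B' \<in> sets S" by fact+
  have "measure S (A \<inter> B') = (\<integral>x. indicator A x * indicator B' x \<partial>S)"
    using A(1) B' by (simp add: indicator_inter_arith[symmetric])
  also have "\<dots> = (\<integral>x. (\<integral>y. indicator A (comb_seq k x y) * indicator B' (comb_seq k x y) \<partial>S) \<partial>S)"
    by (rule S_integral_split[where B=1]) (measurable, simp add: indicator_def)
  also have "\<dots> = (\<integral>x. (\<integral>y. indicator A x * indicator B y \<partial>S) \<partial>S)"
  proof -
    have "(\<lambda>i. comb_seq k x y (k + i)) = y" for x y :: "nat \<Rightarrow> real" by (auto simp: comb_seq_def)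
    then have "comb_seq k x y \<in> B' \<longleftrightarrow> y \<in> B" for x y by (simp add: B'_def)
    then have "(indicator A (comb_seq k x y) * indicator B' (comb_seq k x y) :: real) = indicator A x * indicator B y" for x y
      using A(2)[of x y] by (simp add: indicator_def)
    then show ?thesis by simp
  qed
  also have "\<dots> = measure S A * measure S B" using A(1) B by simp
  finally show ?thesis by (simp add: B'_def)
qed

lemma continuous_norm_V: "continuous_on UNIV (\<lambda>E. norm (V E x n))"
proof -
  obtain p where "\<And>E. (norm (V E x n))\<^sup>2 = poly p E"
    using norm_schr_prod_poly[of n "\<lambda>i. c (x i)"] by blast
  then have *: "(\<lambda>E. norm (V E x n)) = (\<lambda>E. sqrt (poly p E))"
    by (metis norm_ge_zero real_sqrt_abs abs_of_nonneg)
  show ?thesis unfolding * by (intro continuous_intros)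
qed

end

context nondegenerate_potential
begin

abbreviation no_double_resonance :: "real \<Rightarrow> nat \<Rightarrow> nat \<Rightarrow> (nat \<Rightarrow> real) \<Rightarrow> bool" where
  "no_double_resonance \<epsilon> l1 l2 x \<equiv> \<forall>E. \<bar>E\<bar> \<le> R \<longrightarrow> \<epsilon> \<le> lyap E \<longrightarrow>
    \<not> (norm (V E x l1) \<le> exp ((lyap E - \<epsilon>) * l1) \<and>
       norm (V E (\<lambda>i. x (l1 + i)) l2) \<le> exp ((lyap E - \<epsilon>) * l2))"

text \<open>Energies are tested only on a grid of spacing \<open>exp (- c' l)\<close>. The first block can be resonant
  in few cells; in each of these the second block, cut into pieces so short that they do not feel
  the spacing, is resonant with exponentially small probability.\<close>

lemma double_resonance:
  fixes \<epsilon> :: real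
  assumes \<epsilon>: "0 < \<epsilon>"
  shows "\<exists>cc::real>0. \<forall>\<^sub>F l in sequentially. \<forall>l1 l2. l \<le> l1 \<longrightarrow> l1 \<le> 2 * l \<longrightarrow> l \<le> l2 \<longrightarrow> l2 \<le> 2 * l \<longrightarrow>
    (\<exists>Z\<in>sets S. measure S Z \<le> exp (- (cc * l)) \<and> (\<forall>x. x \<notin> Z \<longrightarrow> no_double_resonance \<epsilon> l1 l2 x))"
proof -
  define \<Gamma> where "\<Gamma> = log_bound 1"
  have \<Gamma>: "0 < \<Gamma>" using L_ge_2 by (simp add: \<Gamma>_def log_bound_def add_pos_nonneg)
  have lyap\<Gamma>: "lyap E \<le> \<Gamma>" if "\<bar>E\<bar> \<le> R" for E using lyap_le[OF that] by (simp add: \<Gamma>_def)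
  obtain c1 :: real where c1: "0 < c1" and dev1: "\<forall>\<^sub>F l in sequentially. \<forall>E. \<bar>E\<bar> \<le> R \<longrightarrow>
    measure S {x. norm (V E x l) \<le> exp ((lyap E - \<epsilon> / 4) * l)} \<le> exp (- (c1 * l))"
    using lower_deviation[of "\<epsilon> / 4"] \<epsilon> by auto
  \<comment> \<open>About exp(c' l) grid energies, each exceptional with probability at most exp(-
    c1 l), leave exp(- c1 l / 2).\<close>
  define c' where "c' = c1 / 2"
  have c': "0 < c'" using c1 by (simp add: c'_def)
  \<comment> \<open>The first demand lets the spacing exp(- c' l) beat the Lipschitz constant of two
    adjacent pieces, of total length about 2 l2 / q. The second makes the growth of a single piece
    at most an \<epsilon> / 8 share.\<close>
  obtain q :: nat where q0: "max (16 * ln L / c') (max (8 * \<Gamma> / \<epsilon>) 4) \<le> real q" using real_arch_simple by blast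
  have q: "16 * ln L / c' \<le> q" "8 * \<Gamma> / \<epsilon> \<le> q" "4 \<le> real q" using q0 by auto
  have q_pos: "0 < q" "0 < real q" using q(3) by auto
  define \<eta> where "\<eta> = \<epsilon> / 32"
  define \<delta> where "\<delta> = \<epsilon> / (8 * q)"
  have \<eta>: "0 < \<eta>" and \<delta>: "0 < \<delta>" using \<epsilon> q_pos by (simp_all add: \<eta>_def \<delta>_def)
  obtain c2 :: real where c2: "0 < c2" and dev2: "\<forall>\<^sub>F g in sequentially. \<forall>E. \<bar>E\<bar> \<le> R \<longrightarrow>
    measure S {x. norm (V E x g) \<le> exp ((lyap E - \<eta>) * g)} \<le> exp (- (c2 * g))"
    using lower_deviation[OF \<eta>] by auto
  then obtain g0 where g0: "\<And>g E. g0 \<le> g \<Longrightarrow> \<bar>E\<bar> \<le> R \<Longrightarrow>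
    measure S {x. norm (V E x g) \<le> exp ((lyap E - \<eta>) * g)} \<le> exp (- (c2 * g))"
    unfolding eventually_sequentially by blast
  obtain c3 :: real where c3: "0 < c3" and up: "\<forall>\<^sub>F n in sequentially. \<exists>Z\<in>sets S. measure S Z \<le> exp (- (c3 * n)) \<and>
    (\<forall>x. x \<notin> Z \<longrightarrow> (\<forall>E k. \<bar>E\<bar> \<le> R \<longrightarrow> k \<le> n \<longrightarrow> norm (V E x k) \<le> exp (lyap E * k + \<delta> * n)))"
    using uniform_upper[OF \<delta>] by (elim exE conjE) (rule that)
  obtain l0 where l0: "\<And>l E. l0 \<le> l \<Longrightarrow> \<bar>E\<bar> \<le> R \<Longrightarrow>
    measure S {x. norm (V E x l) \<le> exp ((lyap E - \<epsilon> / 4) * l)} \<le> exp (- (c1 * l))"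
    using dev1 unfolding eventually_sequentially by blast
  obtain \<rho> where \<rho>: "0 < \<rho>" "\<And>E E'. \<bar>E\<bar> \<le> R \<Longrightarrow> \<bar>E'\<bar> \<le> R \<Longrightarrow> \<bar>E - E'\<bar> \<le> \<rho> \<Longrightarrow> \<bar>lyap E - lyap E'\<bar> \<le> \<eta>"
    using lyap_uniformly_continuous[OF \<eta>] by auto
  \<comment> \<open>The resonance threshold varies with the energy through \<open>lyap\<close>,
    whereas counting roots needs a constant one. So \<open>lyap\<close> is rounded down to multiples
    \<theta> i of \<epsilon> / 4, of which \<open>I + 1\<close> suffice.\<close>
  define I where "I = nat \<lceil>4 * \<Gamma> / \<epsilon>\<rceil>"
  define C0 where "C0 = 2 * \<Gamma> + ln 2 + ln 8"
  define d where "d l = exp (- (c' * real l))" for l :: nat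
  define cc where "cc = min c3 (min c1 (c2 / q)) / 4"
  have cc: "0 < cc" "cc < c3" "cc < c1 / 2" "cc < c2 / q"
  proof -
    define mn where "mn = min c3 (min c1 (c2 / q))"
    have mn: "0 < mn" "mn \<le> c3" "mn \<le> c1" "mn \<le> c2 / q" "cc = mn / 4"
      using c1 c2 c3 q_pos by (simp_all add: mn_def cc_def)
    show "0 < cc" "cc < c3" "cc < c1 / 2" "cc < c2 / q" using mn by linarith+
  qed
  have evs: "\<forall>\<^sub>F l in sequentially. l0 \<le> l" "\<forall>\<^sub>F l in sequentially. real g0 \<le> real l / q"
    "\<forall>\<^sub>F l in sequentially. d l \<le> \<rho>" "\<forall>\<^sub>F l in sequentially. 1 \<le> l"
    "\<forall>\<^sub>F l in sequentially. 2 * real l / q + 1 \<le> real l"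
    "\<forall>\<^sub>F l in sequentially. 1 \<le> real l / q"
    "\<forall>\<^sub>F l in sequentially. q * C0 \<le> \<epsilon> / 8 * real l"
    "\<forall>\<^sub>F l in sequentially. C0 \<le> \<epsilon> / (2 * q) * real l"
    "\<forall>\<^sub>F l in sequentially. (4 * real l / q + 1) * (4 * (exp ((8 * real l / q + 2) * ln L) * d l)) \<le> 1 / 2"
    "\<forall>\<^sub>F l in sequentially. (2 * R / d l + 2) * exp (- (c1 * real l)) + q * exp (- (c3 * real l))
       + (real I + 1) * (q * (4 * real l * exp (- (c2 * (real l / q))))) \<le> exp (- (cc * real l))"
  proof -
    show "\<forall>\<^sub>F l in sequentially. l0 \<le> l" "\<forall>\<^sub>F l in sequentially. 1 \<le> l" by (rule eventually_ge_at_top)+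
    show "\<forall>\<^sub>F l in sequentially. real g0 \<le> real l / q" using q_pos by real_asymp
    show "\<forall>\<^sub>F l in sequentially. d l \<le> \<rho>" unfolding d_def using c' \<rho> by real_asymp
    show "\<forall>\<^sub>F l in sequentially. 1 \<le> real l / q" using q_pos by real_asymp
    have "2 / real q < 1" using q by simp
    then have *: "0 < 1 - 2 / real q" by simp
    then have "\<forall>\<^sub>F l in sequentially. 1 \<le> (1 - 2 / real q) * real l" by real_asymp
    then show "\<forall>\<^sub>F l in sequentially. 2 * real l / q + 1 \<le> real l"
      by eventually_elim (simp add: left_diff_distrib)
    have **: "0 < \<epsilon> / (2 * q)" "0 < \<epsilon> / 8" using \<epsilon> q_pos by auto
    show "\<forall>\<^sub>F l in sequentially. q * C0 \<le> \<epsilon> / 8 * real l" using \<epsilon> by real_asymp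
    show "\<forall>\<^sub>F l in sequentially. C0 \<le> \<epsilon> / (2 * q) * real l"
      using **(1) unfolding mult_of_nat_commute by real_asymp
    define A where "A = 8 * ln L / q"
    have "0 < c' - A"
    proof -
      have "A \<le> c' / 2" using q(1) q_pos c' by (simp add: A_def field_simps)
      then show ?thesis using c' by simp
    qed
    then have "\<forall>\<^sub>F l in sequentially. (4 * real l / q + 1) * (4 * (L\<^sup>2 * exp (- ((c' - A) * real l)))) \<le> 1 / 2"
      using q_pos L_ge_2 by real_asymp
    moreover have "exp ((8 * real l / q + 2) * ln L) * d l = L\<^sup>2 * exp (- ((c' - A) * real l))" for l
    proof -
      have "L\<^sup>2 = exp (2 * ln L)" using L_ge_2 by (simp add: exp_double ln_div)
      then show ?thesis by (simp add: d_def A_def exp_add[symmetric] algebra_simps add_divide_distrib)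
    qed
    ultimately show "\<forall>\<^sub>F l in sequentially. (4 * real l / q + 1) * (4 * (exp ((8 * real l / q + 2) * ln L) * d l)) \<le> 1 / 2"
      by simp
    have e1: "\<forall>\<^sub>F l in sequentially. (2 * R + 2) * exp (- (c1 / 2 * real l)) \<le> exp (- (cc * real l)) / 3"
    proof -
      have "\<forall>\<^sub>F l in sequentially. (2 * R + 2) * exp (- ((c1 / 2 - cc) * real l)) \<le> 1 / 3"
        using cc R_nonneg by real_asymp
      then show ?thesis
      proof eventually_elim
        case (elim l)
        have "exp (- (c1 / 2 * real l)) = exp (- ((c1 / 2 - cc) * real l)) * exp (- (cc * real l))"
          by (simp add: exp_add[symmetric] algebra_simps)
        then show ?case using mult_right_mono[OF elim, of "exp (- (cc * real l))"] by (simp add: mult.assoc)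
      qed
    qed
    have e2: "\<forall>\<^sub>F l in sequentially. q * exp (- (c3 * real l)) \<le> exp (- (cc * real l)) / 3"
    proof -
      have "\<forall>\<^sub>F l in sequentially. q * exp (- ((c3 - cc) * real l)) \<le> 1 / 3"
        using cc by real_asymp
      then show ?thesis
      proof eventually_elim
        case (elim l)
        have "exp (- (c3 * real l)) = exp (- ((c3 - cc) * real l)) * exp (- (cc * real l))"
          by (simp add: exp_add[symmetric] algebra_simps)
        then show ?case using mult_right_mono[OF elim, of "exp (- (cc * real l))"] by (simp add: mult.assoc)
      qed
    qed
    have e3: "\<forall>\<^sub>F l in sequentially. (real I + 1) * (q * (4 * real l * exp (- (c2 * (real l / q))))) \<le> exp (- (cc * real l)) / 3"
    proof -
      define b where "b = c2 / q - cc"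
      have "0 < b" using cc by (simp add: b_def)
      then have "\<forall>\<^sub>F l in sequentially. (real I + 1) * (q * (4 * real l * exp (- (b * real l)))) \<le> 1 / 3"
        by real_asymp
      then show ?thesis
      proof eventually_elim
        case (elim l)
        have "exp (- (c2 * (real l / q))) = exp (- (b * real l)) * exp (- (cc * real l))"
          by (simp add: exp_add[symmetric] b_def algebra_simps)
        then show ?case using mult_right_mono[OF elim, of "exp (- (cc * real l))"] by (simp add: mult.assoc)
      qed
    qed
    show "\<forall>\<^sub>F l in sequentially. (2 * R / d l + 2) * exp (- (c1 * real l)) + q * exp (- (c3 * real l))
       + (real I + 1) * (q * (4 * real l * exp (- (c2 * (real l / q))))) \<le> exp (- (cc * real l))"
      using e1 e2 e3
    proof eventually_elim
      case (elim l)
      have "2 * R / d l + 2 \<le> (2 * R + 2) * exp (c' * real l)"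
        using c' R_nonneg by (simp add: d_def exp_minus field_simps)
      then have "(2 * R / d l + 2) * exp (- (c1 * real l)) \<le> (2 * R + 2) * exp (c' * real l) * exp (- (c1 * real l))"
        by (intro mult_right_mono) auto
      also have "\<dots> = (2 * R + 2) * exp (- (c1 / 2 * real l))"
        by (simp add: mult.assoc exp_add[symmetric] c'_def algebra_simps)
      finally show ?case using elim by linarith
    qed
  qed
  have main: "\<exists>Z\<in>sets S. measure S Z \<le> exp (- (cc * l)) \<and> (\<forall>x. x \<notin> Z \<longrightarrow> no_double_resonance \<epsilon> l1 l2 x)"
    if ll: "l \<le> l1" "l1 \<le> 2 * l" "l \<le> l2" "l2 \<le> 2 * l"
    and el: "l0 \<le> l" "real g0 \<le> real l / q" "d l \<le> \<rho>" "1 \<le> l"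
      "2 * real l / q + 1 \<le> real l" "1 \<le> real l / q" "q * C0 \<le> \<epsilon> / 8 * real l" "C0 \<le> \<epsilon> / (2 * q) * real l"
      "(4 * real l / q + 1) * (4 * (exp ((8 * real l / q + 2) * ln L) * d l)) \<le> 1 / 2"
      "(2 * R / d l + 2) * exp (- (c1 * real l)) + q * exp (- (c3 * real l))
       + (real I + 1) * (q * (4 * real l * exp (- (c2 * (real l / q))))) \<le> exp (- (cc * real l))"
    and upl: "\<exists>Z\<in>sets S. measure S Z \<le> exp (- (c3 * l)) \<and>
    (\<forall>x. x \<notin> Z \<longrightarrow> (\<forall>E k. \<bar>E\<bar> \<le> R \<longrightarrow> k \<le> l \<longrightarrow> norm (V E x k) \<le> exp (lyap E * k + \<delta> * l)))"
    for l l1 l2 :: nat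
  proof -
    define dl where "dl = d l"
    have dl: "0 < dl" by (simp add: dl_def d_def)
    define J where "J = nat \<lfloor>2 * R / dl\<rfloor>"
    define e where "e j = - R + real j * dl" for j :: nat
    have J: "real J \<le> 2 * R / dl" using R_nonneg dl by (simp add: J_def)
    have eR: "\<bar>e j\<bar> \<le> R" if "j \<le> J" for j
    proof -
      have "real j * dl \<le> real J * dl" using that dl by (intro mult_right_mono) auto
      also have "\<dots> \<le> 2 * R" using J dl by (simp add: pos_le_divide_eq)
      finally show ?thesis using dl by (simp add: e_def abs_le_iff)
    qed
    have cell: "\<exists>j\<le>J. e j \<le> E \<and> E < e j + dl" if "\<bar>E\<bar> \<le> R" for E
    proof -
      define j where "j = nat \<lfloor>(E + R) / dl\<rfloor>"
      have p: "0 \<le> (E + R) / dl" using that dl by simp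
      have "(E + R) / dl \<le> 2 * R / dl" using that dl by (intro divide_right_mono) auto
      then have "j \<le> J" unfolding j_def J_def by (intro nat_mono floor_mono)
      moreover have "real j \<le> (E + R) / dl" "(E + R) / dl < real j + 1" using p by (auto simp: j_def)
      then have "e j \<le> E" "E < e j + dl" using dl by (auto simp: e_def field_simps)
      ultimately show ?thesis by blast
    qed
    define \<theta> where "\<theta> i = real i * (\<epsilon> / 4)" for i :: nat
    define \<tau> where "\<tau> i = exp ((\<theta> i - 3 * \<epsilon> / 4) * l1)" for i
    define us where "us s = s * l2 div q" for s :: nat
    define g where "g s = us (Suc (Suc s)) - us s" for s
    define A where "A j = {x. norm (V (e j) x l1) \<le> exp ((lyap (e j) - \<epsilon> / 4) * l1)}" for j
    \<comment> \<open>The cell \<open>j\<close> is crossed: its left end is above level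
      \<open>i\<close>, some energy inside is below. Restricting to rational energies makes the
      event measurable.\<close>
    define T where "T i j = {x. \<tau> i \<le> norm (V (e j) x l1) \<and>
        (\<exists>r\<in>\<rat>. e j \<le> r \<and> r < e j + dl \<and> norm (V r x l1) < \<tau> i)}" for i j
    define B where "B j s = {y. norm (V (e j) y (g s)) \<le> exp ((lyap (e j) - \<eta>) * g s)}" for j s
    define B' where "B' j s = (\<lambda>x i. x (l1 + i)) -` ((\<lambda>x i. x (us s + i)) -` B j s)" for j s
    obtain ZU where ZU: "ZU \<in> sets S" "measure S ZU \<le> exp (- (c3 * l))"
      and ZU': "\<And>x E k. x \<notin> ZU \<Longrightarrow> \<bar>E\<bar> \<le> R \<Longrightarrow> k \<le> l \<Longrightarrow> norm (V E x k) \<le> exp (lyap E * k + \<delta> * l)"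
      using upl by blast
    define U where "U s = (\<lambda>x i. x (l1 + (us s + i))) -` ZU" for s
    have inj: "inj ((+) k)" for k :: nat by (simp add: inj_def)
    have U: "U s \<in> sets S" "measure S (U s) = measure S ZU" for s
      unfolding U_def by (rule measure_reindex[OF _ ZU(1)]; simp add: inj_def)+
    have A_meas: "A j \<in> sets S" for j
    proof -
      have "{x\<in>space S. norm (V (e j) x l1) \<le> exp ((lyap (e j) - \<epsilon> / 4) * l1)} \<in> sets S" by measurable
      then show ?thesis by (simp add: A_def)
    qed
    have T_meas: "T i j \<in> sets S" for i j
    proof -
      define Q where "Q = \<rat> \<inter> {e j..<e j + dl}"
      have cQ: "countable Q" unfolding Q_def using countable_rat by (rule countable_subset[rotated]) auto
      have m1: "{x\<in>space S. \<tau> i \<le> norm (V (e j) x l1)} \<in> sets S" by measurable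
      have m2: "{x\<in>space S. norm (V r x l1) < \<tau> i} \<in> sets S" for r by measurable
      have "T i j = {x\<in>space S. \<tau> i \<le> norm (V (e j) x l1)} \<inter> (\<Union>r\<in>Q. {x\<in>space S. norm (V r x l1) < \<tau> i})"
        unfolding T_def Q_def by auto
      moreover have "(\<Union>r\<in>Q. {x\<in>space S. norm (V r x l1) < \<tau> i}) \<in> sets S"
        using cQ m2 by (intro sets.countable_UN') auto
      ultimately show ?thesis using m1 by auto
    qed
    have B_meas: "B j s \<in> sets S" for j s
    proof -
      have "{x\<in>space S. norm (V (e j) x (g s)) \<le> exp ((lyap (e j) - \<eta>) * g s)} \<in> sets S" by measurable
      then show ?thesis by (simp add: B_def)
    qed
    have gb: "2 * (l2 / q) - 1 \<le> real (g s)" "real (g s) \<le> 2 * (l2 / q) + 1" for s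
    proof -
      have e: "Suc (Suc s) = s + 2" by simp
      show "2 * (l2 / q) - 1 \<le> real (g s)" "real (g s) \<le> 2 * (l2 / q) + 1"
        using div_block_bounds(2,3)[OF q_pos(1), where s=s and k=2 and n=l2]
        unfolding g_def us_def e by (simp_all only: of_nat_numeral)
    qed
    have g_ge: "real l / q \<le> g s" for s
    proof -
      have "real l / q \<le> l2 / q" using ll by (intro divide_right_mono) auto
      then show ?thesis using gb(1)[of s] el(6) by linarith
    qed
    have B_le: "measure S (B j s) \<le> exp (- (c2 * (real l / q)))" if "j \<le> J" for j s
    proof -
      have "g0 \<le> g s" using g_ge[of s] el(2) by linarith
      then have "measure S (B j s) \<le> exp (- (c2 * g s))" unfolding B_def by (rule g0[OF _ eR[OF that]])
      also have "\<dots> \<le> exp (- (c2 * (real l / q)))"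
        using mult_left_mono[OF g_ge[of s] less_imp_le[OF c2]] by (simp only: exp_le_cancel_iff neg_le_iff_le)
      finally show ?thesis .
    qed
    have shiftB: "(\<lambda>x i. x (us s + i)) -` B j s \<in> sets S"
        "measure S ((\<lambda>x i. x (us s + i)) -` B j s) = measure S (B j s)" for j s
      by (rule measure_reindex[OF inj B_meas])+
    have TB: "measure S (T i j \<inter> B' j s) \<le> measure S (T i j) * exp (- (c2 * (real l / q)))" if "j \<le> J" for i j s
    proof -
      have "comb_seq l1 x y \<in> T i j \<longleftrightarrow> x \<in> T i j" for x y
        by (simp add: T_def V_comb_seq(2))
      then have "measure S (T i j \<inter> B' j s) = measure S (T i j) * measure S (B j s)"
        unfolding B'_def using measure_split_indep[OF T_meas _ shiftB(1)] shiftB(2) by metis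
      then show ?thesis using B_le[OF that] by (simp add: mult_left_mono)
    qed
    have B'_meas: "B' j s \<in> sets S" for j s
      unfolding B'_def by (rule measure_reindex(2)[OF inj shiftB(1)])
    \<comment> \<open>The heart of the estimate: there are exponentially many cells, but each
      realization has at most \<open>2 * l1\<close> crossed ones. Since the second block is
      independent of the first, the union over cells costs only this linear factor.\<close>
    have sumT: "(\<Sum>j\<le>J. measure S (T i j)) \<le> 2 * real l1" for i
    proof -
      have "(\<Sum>j\<le>J. measure S (T i j)) = (\<integral>x. (\<Sum>j\<le>J. indicator (T i j) x) \<partial>S)"
        using T_meas by (subst Bochner_Integration.integral_sum) (auto simp: less_top[symmetric])
      also have "\<dots> \<le> 2 * real l1"
      proof (rule integral_le_bound)
        show "integrable S (\<lambda>x. \<Sum>j\<le>J. indicator (T i j) x :: real)"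
          using T_meas by (intro Bochner_Integration.integrable_sum) (auto simp: less_top[symmetric])
        fix x
        have "card {j\<in>{..J}. x \<in> T i j} \<le> 2 * l1"
        proof (rule card_cells_le[where e=e and d=dl and \<tau>="\<tau> i" and w="\<lambda>k. c (x k)"])
          fix i j :: nat assume "i < j"
          then have "(real i + 1) * dl \<le> real j * dl" using dl by (intro mult_right_mono) auto
          then show "e i + dl \<le> e j" by (simp add: e_def algebra_simps)
        qed (auto simp: \<tau>_def T_def)
        moreover have "(\<Sum>j\<le>J. indicator (T i j) x :: real) = card {j\<in>{..J}. x \<in> T i j}"
          by (simp add: indicator_def sum.If_cases Int_def)
        ultimately show "(\<Sum>j\<le>J. indicator (T i j) x :: real) \<le> 2 * real l1" by simp
      qed
      finally show ?thesis .
    qed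
    \<comment> \<open>\<open>Z1\<close>: the first block is deficient at a grid energy.
      \<open>Z2\<close>: an upper bound fails for a tail of the second block. \<open>Z3\<close>: the
      first block has a crossed cell at whose grid energy two adjacent pieces of the second block
      are deficient.\<close>
    define Z1 where "Z1 = (\<Union>j\<in>{..J}. A j)"
    define Z2 where "Z2 = (\<Union>s\<in>{..<q}. U s)"
    define Z3 where "Z3 = (\<Union>p\<in>{..I} \<times> ({..<q} \<times> {..J}). T (fst p) (snd (snd p)) \<inter> B' (snd (snd p)) (fst (snd p)))"
    have Zm: "Z1 \<in> sets S" "Z2 \<in> sets S" "Z3 \<in> sets S"
      unfolding Z1_def Z2_def Z3_def using A_meas U T_meas B'_meas by (auto intro!: sets.finite_UN)
    have mZ1: "measure S Z1 \<le> (2 * R / dl + 2) * exp (- (c1 * l))"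
    proof -
      have "measure S Z1 \<le> (\<Sum>j\<le>J. measure S (A j))"
        unfolding Z1_def by (rule P.finite_measure_subadditive_finite) (use A_meas in auto)
      also have "\<dots> \<le> (\<Sum>j\<le>J. exp (- (c1 * l)))"
      proof (rule sum_mono)
        fix j assume j: "j \<in> {..J}"
        have "measure S (A j) \<le> exp (- (c1 * l1))"
          unfolding A_def using l0[of l1 "e j"] eR[of j] j ll el by auto
        also have "\<dots> \<le> exp (- (c1 * l))" using c1 ll by simp
        finally show "measure S (A j) \<le> exp (- (c1 * l))" .
      qed
      also have "\<dots> = (real J + 1) * exp (- (c1 * l))" by simp
      also have "\<dots> \<le> (2 * R / dl + 2) * exp (- (c1 * l))" using J by (intro mult_right_mono) auto
      finally show ?thesis .
    qed
    have mZ2: "measure S Z2 \<le> q * exp (- (c3 * l))"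
    proof -
      have "measure S Z2 \<le> (\<Sum>s<q. measure S (U s))"
        unfolding Z2_def by (rule P.finite_measure_subadditive_finite) (use U in auto)
      also have "\<dots> \<le> (\<Sum>s<q. exp (- (c3 * l)))" by (rule sum_mono) (simp add: U ZU)
      finally show ?thesis by simp
    qed
    have mZ3: "measure S Z3 \<le> (real I + 1) * (q * (4 * real l * exp (- (c2 * (real l / q)))))"
    proof -
      let ?E = "exp (- (c2 * (real l / q)))"
      have "measure S Z3 \<le> (\<Sum>p\<in>{..I} \<times> ({..<q} \<times> {..J}). measure S (T (fst p) (snd (snd p)) \<inter> B' (snd (snd p)) (fst (snd p))))"
        unfolding Z3_def by (rule P.finite_measure_subadditive_finite) (use T_meas B'_meas in auto)
      also have "\<dots> \<le> (\<Sum>p\<in>{..I} \<times> ({..<q} \<times> {..J}). measure S (T (fst p) (snd (snd p))) * ?E)"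
        by (rule sum_mono) (use TB in auto)
      also have "\<dots> = (\<Sum>i\<le>I. \<Sum>s<q. (\<Sum>j\<le>J. measure S (T i j)) * ?E)"
        by (simp add: sum.cartesian_product' sum_distrib_right)
      also have "\<dots> \<le> (\<Sum>i\<le>I. \<Sum>s<q. 4 * real l * ?E)"
      proof (intro sum_mono mult_right_mono)
        show "(\<Sum>j\<le>J. measure S (T i j)) \<le> 4 * real l" for i using sumT[of i] ll by simp
      qed simp
      also have "\<dots> = (real I + 1) * (q * (4 * real l * ?E))" by (simp add: algebra_simps)
      finally show ?thesis .
    qed
    define Z where "Z = Z1 \<union> Z2 \<union> Z3"
    have "measure S Z \<le> measure S Z1 + measure S Z2 + measure S Z3"
      unfolding Z_def using measure_Un_le[of "Z1 \<union> Z2" S Z3] measure_Un_le[of Z1 S Z2] Zm by simp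
    then have mZ: "measure S Z \<le> exp (- (cc * l))" using mZ1 mZ2 mZ3 el(10) by (simp add: dl_def)
    have "\<not> (norm (V E x l1) \<le> exp ((lyap E - \<epsilon>) * l1) \<and>
         norm (V E (\<lambda>i. x (l1 + i)) l2) \<le> exp ((lyap E - \<epsilon>) * l2))"
      if x: "x \<notin> Z" and E: "\<bar>E\<bar> \<le> R" and lE: "\<epsilon> \<le> lyap E" for x E
    proof (intro notI, elim conjE)
      assume bX: "norm (V E x l1) \<le> exp ((lyap E - \<epsilon>) * l1)"
        and bY: "norm (V E (\<lambda>i. x (l1 + i)) l2) \<le> exp ((lyap E - \<epsilon>) * l2)"
      obtain j where j: "j \<le> J" "e j \<le> E" "E < e j + dl" using cell[OF E] by blast
      have cl: "\<bar>lyap E - lyap (e j)\<bar> \<le> \<eta>"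
        using \<rho>(2)[OF E eR[OF j(1)]] j el(3) by (simp add: dl_def)
      \<comment> \<open>With this level, \<tau> i lies above the resonance threshold at
        \<open>E\<close> and below the norm guaranteed at the grid point outside \<open>Z1\<close>,
        so the cell is crossed.\<close>
      define i where "i = nat \<lfloor>lyap E / (\<epsilon> / 4)\<rfloor>"
      have p: "0 \<le> lyap E / (\<epsilon> / 4)" using lyap_nonneg[OF E] \<epsilon> by simp
      have "lyap E / (\<epsilon> / 4) \<le> 4 * \<Gamma> / \<epsilon>" using lyap\<Gamma>[OF E] \<epsilon> by (simp add: field_simps)
      then have "i \<le> I" unfolding i_def I_def by (intro nat_mono) linarith
      have "real i \<le> lyap E / (\<epsilon> / 4)" "lyap E / (\<epsilon> / 4) < real i + 1" using p by (auto simp: i_def)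
      then have \<theta>i: "\<theta> i \<le> lyap E" "lyap E < \<theta> i + \<epsilon> / 4"
        using \<epsilon> by (auto simp: \<theta>_def field_simps)
      have l1p: "0 < real l1" using ll el by simp
      have "exp ((lyap E - \<epsilon>) * l1) < \<tau> i"
        unfolding \<tau>_def exp_less_cancel_iff using \<theta>i l1p by (intro mult_strict_right_mono) auto
      then have bX': "norm (V E x l1) < \<tau> i" using bX by linarith
      have "x \<notin> A j" using x j by (auto simp: Z_def Z1_def)
      then have "exp ((lyap (e j) - \<epsilon> / 4) * l1) < norm (V (e j) x l1)" by (simp add: A_def not_le)
      moreover have "\<tau> i \<le> exp ((lyap (e j) - \<epsilon> / 4) * l1)"
      proof -
        have "\<theta> i - 3 * \<epsilon> / 4 \<le> lyap (e j) - \<epsilon> / 4" using \<theta>i cl \<epsilon> unfolding \<eta>_def by linarith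
        then show ?thesis unfolding \<tau>_def exp_le_cancel_iff using l1p by (intro mult_right_mono) auto
      qed
      ultimately have ej: "\<tau> i < norm (V (e j) x l1)" by linarith
      have "E \<noteq> e j" using ej bX' by auto
      then have ltE: "e j < E" using j by simp
      have "x \<in> T i j"
      proof -
        have "open {E. norm (V E x l1) < \<tau> i}"
          using open_Collect_less[OF continuous_norm_V continuous_on_const] .
        then have "open ({E. norm (V E x l1) < \<tau> i} \<inter> {e j<..<e j + dl})" by auto
        moreover have "E \<in> {E. norm (V E x l1) < \<tau> i} \<inter> {e j<..<e j + dl}" using bX' ltE j by auto
        ultimately obtain z where z: "0 < z" "ball E z \<subseteq> {E. norm (V E x l1) < \<tau> i} \<inter> {e j<..<e j + dl}"
          using open_contains_ball by metis
        obtain r where r: "r \<in> \<rat>" "E < r" "r < E + z" using Rats_dense_in_real[of E "E + z"] z(1) by auto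
        then have "r \<in> ball E z" by (simp add: dist_real_def)
        then have "norm (V r x l1) < \<tau> i" "e j \<le> r" "r < e j + dl" using z(2) by auto
        then show ?thesis using r(1) ej by (auto simp: T_def)
      qed
      then have nB: "x \<notin> B' j s" if "s < q" for s
        using x j \<open>i \<le> I\<close> that unfolding Z_def Z3_def by force
      have nU: "x \<notin> U s" if "s < q" for s using x that unfolding Z_def Z2_def by blast
      define y where "y k = x (l1 + k)" for k
      define a where "a = l2 / real q"
      have a: "real l / q \<le> a" "a \<le> 2 * real l / q" "0 \<le> a"
        using ll q_pos by (simp_all add: a_def divide_right_mono)
      have gE: "0 \<le> lyap E" using lyap_nonneg[OF E] .
      let ?u = "\<lambda>k. E - c (y k)"
      have blockU: "norm (schr_prod (\<lambda>k. ?u (us s + k)) (us (Suc s) - us s)) \<le> exp (lyap E * a + (\<Gamma> + \<delta> * l))"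
        if "s < q" for s
      proof -
        have h: "real (us (Suc s) - us s) \<le> a + 1"
          using div_block_bounds(2)[OF q_pos(1), where s=s and k=1 and n=l2] by (simp add: us_def a_def)
        have "a + 1 \<le> l" using a el(5) by linarith
        then have "us (Suc s) - us s \<le> l" using h by linarith
        then have "norm (V E (\<lambda>i. x (l1 + (us s + i))) (us (Suc s) - us s)) \<le> exp (lyap E * real (us (Suc s) - us s) + \<delta> * l)"
          using ZU'[of "\<lambda>i. x (l1 + (us s + i))" E] nU[OF that] E by (simp add: U_def)
        also have "\<dots> \<le> exp (lyap E * a + (\<Gamma> + \<delta> * l))"
        proof -
          have "lyap E * real (us (Suc s) - us s) \<le> lyap E * (a + 1)" using h gE by (intro mult_left_mono)
          then show ?thesis using lyap\<Gamma>[OF E] by (simp add: algebra_simps)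
        qed
        finally show ?thesis by (simp add: y_def)
      qed
      \<comment> \<open>Moving from the grid energy to \<open>E\<close> changes the norm by at most
        1 / 2, hence at most halves it because it is at least 1. This is the
        \<open>ln 2\<close>.\<close>
      have blockW: "exp (2 * (lyap E * a) - (4 * \<eta> * a + \<Gamma> + ln 2)) \<le> norm (schr_prod (\<lambda>k. ?u (us s + k)) (us (Suc (Suc s)) - us s))"
        if "Suc s < q" for s
      proof -
        let ?y = "\<lambda>i. y (us s + i)"
        have gs: "2 * a - 1 \<le> real (g s)" "real (g s) \<le> 2 * a + 1" using gb[of s] by (simp_all add: a_def)
        have "x \<notin> B' j s" using nB[of s] that by simp
        then have 1: "exp ((lyap (e j) - \<eta>) * g s) < norm (V (e j) ?y (g s))"
          by (simp add: B'_def B_def y_def not_le)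
        have "norm (V (e j) ?y (g s) - V E ?y (g s)) \<le> g s * ((2 * L ^ g s)\<^sup>2 * \<bar>e j - E\<bar>)"
          by (rule V_lipschitz(1)[OF eR[OF j(1)] E])
        also have "\<dots> \<le> (4 * real l / q + 1) * (4 * (exp ((8 * real l / q + 2) * ln L) * d l))"
        proof -
          have g4: "real (g s) \<le> 4 * real l / q + 1" using gs a by linarith
          have "(2 * L ^ g s)\<^sup>2 = 4 * exp (2 * real (g s) * ln L)"
          proof -
            have "L ^ g s = exp (real (g s) * ln L)" using L_ge_2 by (simp add: exp_of_nat_mult)
            then show ?thesis by (simp add: power_mult_distrib exp_double[symmetric] mult.assoc)
          qed
          moreover have "2 * real (g s) * ln L \<le> (8 * real l / q + 2) * ln L"
            using g4 L_ge_2 by (intro mult_right_mono) auto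
          ultimately have "(2 * L ^ g s)\<^sup>2 \<le> 4 * exp ((8 * real l / q + 2) * ln L)" by simp
          moreover have "\<bar>e j - E\<bar> \<le> d l" using j by (simp add: dl_def)
          ultimately have "(2 * L ^ g s)\<^sup>2 * \<bar>e j - E\<bar> \<le> (4 * exp ((8 * real l / q + 2) * ln L)) * d l"
            by (intro mult_mono) auto
          from mult_mono[OF g4 this] show ?thesis by (simp add: mult.assoc)
        qed
        also have "\<dots> \<le> 1 / 2" by (rule el(9))
        finally have "norm (V (e j) ?y (g s)) - 1 / 2 \<le> norm (V E ?y (g s))"
          using norm_triangle_ineq2[of "V (e j) ?y (g s)" "V E ?y (g s)"] by linarith
        moreover have "1 \<le> norm (V (e j) ?y (g s))" by simp
        ultimately have 2: "norm (V (e j) ?y (g s)) / 2 \<le> norm (V E ?y (g s))" by linarith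
        have "0 \<le> lyap E - 2 * \<eta>" using lE \<epsilon> by (simp add: \<eta>_def)
        then have "(lyap E - 2 * \<eta>) * (2 * a - 1) \<le> (lyap E - 2 * \<eta>) * g s" using gs by (intro mult_left_mono)
        also have "\<dots> \<le> (lyap (e j) - \<eta>) * g s" using cl by (intro mult_right_mono) auto
        finally have "2 * (lyap E * a) - (4 * \<eta> * a + \<Gamma>) \<le> (lyap (e j) - \<eta>) * g s"
          using lyap\<Gamma>[OF E] \<eta> by (simp add: algebra_simps)
        then have "exp (2 * (lyap E * a) - (4 * \<eta> * a + \<Gamma>)) \<le> norm (V (e j) ?y (g s))"
          using 1 by (meson exp_le_cancel_iff less_imp_le order_trans)
        moreover have "exp (2 * (lyap E * a) - (4 * \<eta> * a + \<Gamma> + ln 2)) = exp (2 * (lyap E * a) - (4 * \<eta> * a + \<Gamma>)) / 2"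
          by (simp add: exp_diff exp_add)
        ultimately show ?thesis using 2 by (simp add: g_def)
      qed
      have la: "\<epsilon> * a \<le> lyap E * a" using lE a by (intro mult_right_mono)
      have \<delta>l: "\<delta> * l \<le> \<epsilon> / 8 * a"
        using mult_left_mono[OF a(1), of "\<epsilon> / 8"] \<epsilon> by (simp add: \<delta>_def)
      have C0a: "C0 \<le> \<epsilon> / 2 * a"
        using el(8) mult_left_mono[OF a(1), of "\<epsilon> / 2"] \<epsilon> by simp
      have pre: "\<Gamma> + \<delta> * l + (4 * \<eta> * a + \<Gamma> + ln 2) + ln 8 \<le> lyap E * a"
      proof -
        have "4 * \<eta> * a = \<epsilon> / 8 * a" by (simp add: \<eta>_def)
        moreover have "0 \<le> \<epsilon> * a" using \<epsilon> a by simp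
        ultimately show ?thesis using la \<delta>l C0a unfolding C0_def by linarith
      qed
      have "exp ((real q - 1) * (lyap E * a - (\<Gamma> + \<delta> * l) - (4 * \<eta> * a + \<Gamma> + ln 2) - ln 8))
          \<le> norm (schr_prod (\<lambda>k. ?u (us 0 + k)) (us q - us 0))"
      proof (rule chain_lower_exp[where t=us and u="?u"])
        show "us s \<le> us (Suc s)" for s using div_block_bounds(1)[OF q_pos(1), where s=s and k=1 and n=l2] by (simp add: us_def)
      qed (use blockU blockW pre q_pos in auto)
      moreover have "schr_prod (\<lambda>k. ?u (us 0 + k)) (us q - us 0) = V E (\<lambda>i. x (l1 + i)) l2"
        using q_pos by (simp add: us_def y_def)
      ultimately have low: "exp ((real q - 1) * (lyap E * a - (\<Gamma> + \<delta> * l) - (4 * \<eta> * a + \<Gamma> + ln 2) - ln 8))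
          \<le> norm (V E (\<lambda>i. x (l1 + i)) l2)" by simp
      \<comment> \<open>The \<open>q\<close> pieces give only \<open>q - 1\<close> factors. The
        missing one costs \<epsilon> / 8 per site and all errors together 3 \<epsilon> / 8, which
        leaves room below \<epsilon>.\<close>
      have "(lyap E - \<epsilon>) * l2 < (real q - 1) * (lyap E * a - (\<Gamma> + \<delta> * l) - (4 * \<eta> * a + \<Gamma> + ln 2) - ln 8)"
      proof -
        have qa: "real q * a = l2" using q_pos by (simp add: a_def)
        have l2l: "real l \<le> l2" "0 < real l2" using ll el by auto
        define X where "X = \<delta> * l + 4 * \<eta> * a + C0"
        have X0: "0 \<le> X" using \<delta> \<eta> a \<Gamma> by (simp add: X_def C0_def)
        have "q * X \<le> 3 * \<epsilon> / 8 * l2"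
        proof -
          have "q * (\<delta> * l) \<le> \<epsilon> / 8 * l2" using \<epsilon> q_pos l2l by (simp add: \<delta>_def)
          moreover have "q * (4 * \<eta> * a) = \<epsilon> / 8 * l2" using qa by (simp add: \<eta>_def mult_ac)
          moreover have "q * C0 \<le> \<epsilon> / 8 * l2"
          proof -
            have "\<epsilon> / 8 * real l \<le> \<epsilon> / 8 * real l2" using \<epsilon> by (intro mult_left_mono l2l) simp
            then show ?thesis using el(7) by linarith
          qed
          ultimately show ?thesis by (simp add: X_def distrib_left)
        qed
        then have 1: "(real q - 1) * X \<le> 3 * \<epsilon> / 8 * l2" using X0 by (simp add: left_diff_distrib)
        have "lyap E * a \<le> \<Gamma> * a" using lyap\<Gamma>[OF E] a by (intro mult_right_mono)
        also have "\<dots> \<le> \<epsilon> / 8 * l2"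
        proof -
          have "8 * \<Gamma> \<le> \<epsilon> * q" using q(2) \<epsilon> by (simp add: pos_divide_le_eq mult.commute)
          then have "\<Gamma> * a \<le> \<epsilon> * q / 8 * a" using a by (intro mult_right_mono) auto
          then show ?thesis using qa by (simp add: mult_ac)
        qed
        finally have h: "lyap E * a \<le> \<epsilon> / 8 * real l2" .
        have 2: "(real q - 1) * (lyap E * a) \<ge> lyap E * l2 - \<epsilon> / 8 * l2"
        proof -
          have "(real q - 1) * (lyap E * a) = lyap E * (real q * a) - lyap E * a" by (simp add: algebra_simps)
          then show ?thesis using h unfolding qa by linarith
        qed
        have "0 < \<epsilon> / 2 * l2" using \<epsilon> l2l by simp
        then have "(lyap E - \<epsilon>) * l2 < (real q - 1) * (lyap E * a) - (real q - 1) * X"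
          using 1 2 by (simp add: left_diff_distrib)
        also have "\<dots> = (real q - 1) * (lyap E * a - (\<Gamma> + \<delta> * l) - (4 * \<eta> * a + \<Gamma> + ln 2) - ln 8)"
          by (simp add: X_def C0_def right_diff_distrib[symmetric])
        finally show ?thesis .
      qed
      then have "exp ((lyap E - \<epsilon>) * l2) < norm (V E (\<lambda>i. x (l1 + i)) l2)"
        using low by (meson exp_less_cancel_iff less_le_trans)
      then show False using bY by linarith
    qed
    then show ?thesis using mZ Zm by (intro bexI[of _ Z]) (auto simp: Z_def)
  qed
  have "\<forall>\<^sub>F l in sequentially. \<forall>l1 l2. l \<le> l1 \<longrightarrow> l1 \<le> 2 * l \<longrightarrow> l \<le> l2 \<longrightarrow> l2 \<le> 2 * l \<longrightarrow>
    (\<exists>Z\<in>sets S. measure S Z \<le> exp (- (cc * l)) \<and> (\<forall>x. x \<notin> Z \<longrightarrow> no_double_resonance \<epsilon> l1 l2 x))"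
    using evs up
  proof eventually_elim
    case (elim l)
    show ?case
    proof (intro allI impI)
      fix l1 l2 assume ll: "l \<le> l1" "l1 \<le> 2 * l" "l \<le> l2" "l2 \<le> 2 * l"
      show "\<exists>Z\<in>sets S. measure S Z \<le> exp (- (cc * l)) \<and> (\<forall>x. x \<notin> Z \<longrightarrow> no_double_resonance \<epsilon> l1 l2 x)"
        by (rule main[OF ll elim])
    qed
  qed
  then show ?thesis using cc(1) by (intro exI[of _ cc] conjI)
qed

end

section \<open>Growth around the ring\<close>

text \<open>\<open>P i\<close> will say that the double arc starting at \<open>i\<close> is
  deficient; double arcs at distance 2 or more in both directions around the ring are disjoint. Thus
  bad indices are at most two neighbours, and starting right behind them leaves \<open>r - 2\<close>
  good ones in a row.\<close>

lemma ring_gap: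
  fixes P :: "nat \<Rightarrow> bool"
  assumes r: "4 \<le> r" and H: "\<And>i s. i \<le> r \<Longrightarrow> 2 \<le> s \<Longrightarrow> s + 2 \<le> r \<Longrightarrow> P i \<Longrightarrow> P (i + s) \<Longrightarrow> False"
  obtains i0 where "\<And>s. s + 2 < r \<Longrightarrow> \<not> P (i0 + s)"
proof (cases "\<exists>b<r. P b")
  case False
  then show ?thesis by (intro that[of 0]) auto
next
  case True
  then obtain b where b: "b < r" "P b" by blast
  show ?thesis
  proof (cases "P (b + 1)")
    case True
    show ?thesis
    proof (rule that[of "b + 2"])
      fix s assume s: "s + 2 < r"
      show "\<not> P (b + 2 + s)"
      proof (cases "s = 0")
        case True
        then show ?thesis using H[of b 2] b s r by auto
      next
        case False
        then show ?thesis using H[of "b + 1" "s + 1"] b s \<open>P (b + 1)\<close> by auto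
      qed
    qed
  next
    case False
    show ?thesis
    proof (rule that[of "b + 1"])
      fix s assume s: "s + 2 < r"
      show "\<not> P (b + 1 + s)"
        using H[of b "s + 1"] b s False by (cases "s = 0") auto
    qed
  qed
qed

lemma mod_inj_window:
  fixes p p' s n :: nat
  assumes "p mod n = p' mod n" "s \<le> p" "p < s + n" "s \<le> p'" "p' < s + n"
  shows "p = p'"
proof -
  have *: "p = p'" if "p mod n = p' mod n" "s \<le> p" "p \<le> p'" "p' < s + n" for p p' :: nat
  proof -
    have "n dvd p' - p" using that by (metis mod_eq_dvd_iff_nat)
    then show ?thesis using that by (auto dest!: dvd_imp_le)
  qed
  show ?thesis using *[of p p'] *[of p' p] assms by (cases "p \<le> p'") auto
qed

context nondegenerate_potential
begin

text \<open>The upper bound holds from every starting site. The cut \<open>a\<close> of the lower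
  bound depends on the energy, since it has to put a possible defect at the end of the
  product.\<close>

abbreviation ring_estimates :: "real \<Rightarrow> nat \<Rightarrow> (nat \<Rightarrow> real) \<Rightarrow> bool" where
  "ring_estimates \<epsilon> n x \<equiv>
    (\<forall>a E k. \<bar>E\<bar> \<le> R \<longrightarrow> k \<le> n \<longrightarrow>
      norm (V E (\<lambda>i. x ((a + i) mod n)) k) \<le> exp (lyap E * k + \<epsilon> * n)) \<and>
    (\<forall>E. \<bar>E\<bar> \<le> R \<longrightarrow> \<epsilon> \<le> lyap E \<longrightarrow>
      (\<exists>a<n. exp ((lyap E - \<epsilon>) * n) \<le> norm (V E (\<lambda>i. x ((a + i) mod n)) n)))"

text \<open>The ring is divided into \<open>r\<close> arcs, with \<open>r\<close> independent of
  \<open>n\<close>. Excluding double resonances for disjoint pairs of double arcs leaves good double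
  arcs everywhere except around one place. Behind it the avalanche principle runs through
  \<open>r - 1\<close> arcs, and the remaining arc can undo at most its own norm.\<close>

lemma ring_growth:
  fixes \<epsilon> :: real
  assumes \<epsilon>: "0 < \<epsilon>"
  shows "\<exists>cc::real>0. \<forall>\<^sub>F n in sequentially. \<exists>Z\<in>sets S. measure S Z \<le> exp (- (cc * n)) \<and> (\<forall>x. x \<notin> Z \<longrightarrow>
    ring_estimates \<epsilon> n x)"
proof -
  define \<Gamma> where "\<Gamma> = log_bound 1"
  have \<Gamma>: "0 < \<Gamma>" using L_ge_2 by (simp add: \<Gamma>_def log_bound_def add_pos_nonneg)
  have lyap\<Gamma>: "lyap E \<le> \<Gamma>" if "\<bar>E\<bar> \<le> R" for E using lyap_le[OF that] by (simp add: \<Gamma>_def)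
  \<comment> \<open>Makes the growth of one arc at most \<epsilon> n / 8, so that a few arcs can be
    sacrificed.\<close>
  obtain r :: nat where r0: "max (8 * \<Gamma> / \<epsilon>) 6 \<le> real r" using real_arch_simple by blast
  have r: "8 * \<Gamma> / \<epsilon> \<le> r" "6 \<le> r" "0 < r" "0 < real r" using r0 by auto
  define \<epsilon>3 where "\<epsilon>3 = \<epsilon> / 8"
  define \<delta> where "\<delta> = \<epsilon> / (8 * r)"
  have \<epsilon>3: "0 < \<epsilon>3" and \<delta>: "0 < \<delta>" "\<delta> \<le> \<epsilon>"
    using \<epsilon> r by (simp_all add: \<epsilon>3_def \<delta>_def pos_divide_le_eq)
  obtain cD :: real where cD: "0 < cD" and DR: "\<forall>\<^sub>F l in sequentially. \<forall>l1 l2. l \<le> l1 \<longrightarrow> l1 \<le> 2 * l \<longrightarrow> l \<le> l2 \<longrightarrow> l2 \<le> 2 * l \<longrightarrow>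
    (\<exists>Z\<in>sets S. measure S Z \<le> exp (- (cD * l)) \<and> (\<forall>x. x \<notin> Z \<longrightarrow> no_double_resonance \<epsilon>3 l1 l2 x))"
    using double_resonance[OF \<epsilon>3] by (elim exE conjE) (rule that)
  then obtain lD where lD: "\<And>(l::nat) l1 l2. lD \<le> l \<Longrightarrow> l \<le> l1 \<Longrightarrow> l1 \<le> 2 * l \<Longrightarrow> l \<le> l2 \<Longrightarrow> l2 \<le> 2 * l \<Longrightarrow>
    (\<exists>Z\<in>sets S. measure S Z \<le> exp (- (cD * l)) \<and> (\<forall>x. x \<notin> Z \<longrightarrow> no_double_resonance \<epsilon>3 l1 l2 x))"
    unfolding eventually_sequentially by blast
  obtain cU :: real where cU: "0 < cU" and up: "\<forall>\<^sub>F n in sequentially. \<exists>Z\<in>sets S. measure S Z \<le> exp (- (cU * n)) \<and>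
    (\<forall>x. x \<notin> Z \<longrightarrow> (\<forall>E k. \<bar>E\<bar> \<le> R \<longrightarrow> k \<le> n \<longrightarrow> norm (V E x k) \<le> exp (lyap E * k + \<delta> * n)))"
    using uniform_upper[OF \<delta>(1)] by (elim exE conjE) (rule that)
  define C0 where "C0 = 2 * \<Gamma> + ln 8"
  define cD' where "cD' = cD / r"
  have cD': "0 < cD'" using cD r by (simp add: cD'_def)
  define cc where "cc = min cU cD' / 2"
  have cc: "0 < cc" "cc < cU" "cc < cD'"
  proof -
    define mn where "mn = min cU cD'"
    have mn: "0 < mn" "mn \<le> cU" "mn \<le> cD'" "cc = mn / 2" using cU cD' by (simp_all add: mn_def cc_def)
    show "0 < cc" "cc < cU" "cc < cD'" using mn by linarith+
  qed
  have evs: "\<forall>\<^sub>F n in sequentially. real lD \<le> real n / r" "\<forall>\<^sub>F n in sequentially. 3 \<le> real n / r"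
    "\<forall>\<^sub>F n in sequentially. C0 \<le> \<epsilon> / (2 * r) * real n" "\<forall>\<^sub>F n in sequentially. r * C0 + \<Gamma> \<le> \<epsilon> / 8 * real n"
    "\<forall>\<^sub>F n in sequentially. real n * exp (- (cU * real n)) + (real r + 1) * real r * exp (- (cD' * real n)) \<le> exp (- (cc * real n))"
  proof -
    show "\<forall>\<^sub>F n in sequentially. real lD \<le> real n / r" "\<forall>\<^sub>F n in sequentially. 3 \<le> real n / r"
      using r by real_asymp+
    define e' where "e' = \<epsilon> / (2 * r)"
    have "0 < e'" using \<epsilon> r by (simp add: e'_def)
    then show "\<forall>\<^sub>F n in sequentially. C0 \<le> \<epsilon> / (2 * r) * real n"
      unfolding e'_def[symmetric] by real_asymp
    show "\<forall>\<^sub>F n in sequentially. r * C0 + \<Gamma> \<le> \<epsilon> / 8 * real n" using \<epsilon> by real_asymp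
    have "0 < cU - cc" "0 < cD' - cc" using cc by simp_all
    then have "\<forall>\<^sub>F n in sequentially. real n * exp (- ((cU - cc) * real n)) \<le> 1 / 2"
      "\<forall>\<^sub>F n in sequentially. (real r + 1) * real r * exp (- ((cD' - cc) * real n)) \<le> 1 / 2"
      by real_asymp+
    then have "\<forall>\<^sub>F n in sequentially. real n * exp (- ((cU - cc) * real n)) + (real r + 1) * real r * exp (- ((cD' - cc) * real n)) \<le> 1"
      by eventually_elim linarith
    then show "\<forall>\<^sub>F n in sequentially. real n * exp (- (cU * real n)) + (real r + 1) * real r * exp (- (cD' * real n)) \<le> exp (- (cc * real n))"
    proof eventually_elim
      case (elim n)
      have "exp (- (cU * real n)) = exp (- ((cU - cc) * real n)) * exp (- (cc * real n))"
        "exp (- (cD' * real n)) = exp (- ((cD' - cc) * real n)) * exp (- (cc * real n))"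
        by (simp_all add: exp_add[symmetric] algebra_simps)
      then show ?case using mult_right_mono[OF elim, of "exp (- (cc * real n))"]
        by (simp add: distrib_right mult.assoc)
    qed
  qed
  have "\<forall>\<^sub>F n in sequentially. \<exists>Z\<in>sets S. measure S Z \<le> exp (- (cc * n)) \<and> (\<forall>x. x \<notin> Z \<longrightarrow>
    ring_estimates \<epsilon> n x)"
    using evs up
  proof eventually_elim
    case (elim n)
    note el = elim(1-5)
    have n3: "3 * r \<le> n" using el(2) r by (simp add: pos_le_divide_eq) 
    then have n0: "0 < n" using r by simp
    define t where "t i = i * n div r" for i :: nat
    have t_mono: "t i \<le> t j" if "i \<le> j" for i j
      unfolding t_def using that by (intro div_le_mono mult_le_mono1)
    have t_ring: "t (i + r) = t i + n" for i
      using r by (simp add: t_def add_mult_distrib)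
    define a0 where "a0 = real n / r"
    have a0: "real r * a0 = n" "3 \<le> a0" using r el(2) by (simp_all add: a0_def)
    have g1: "real (t (Suc i) - t i) \<le> a0 + 1" for i
      using div_block_bounds(2)[OF r(3), where s=i and k=1 and n=n] by (simp add: t_def a0_def)
    have g2: "2 * a0 - 1 \<le> real (t (i + 2) - t i)" "real (t (i + 2) - t i) \<le> 2 * a0 + 1" for i
      using div_block_bounds(2,3)[OF r(3), where s=i and k=2 and n=n] unfolding t_def a0_def
      by (simp_all only: of_nat_numeral)
    \<comment> \<open>A common scale: every double arc has between \<open>l\<close> and
      \<open>2 * l\<close> sites, as \<open>double_resonance\<close> requires; this uses that arcs
      have average length at least 3.\<close>
    define l where "l = nat \<lfloor>2 * a0 - 1\<rfloor>"
    have l: "real l \<le> 2 * a0 - 1" "2 * a0 - 2 \<le> real l" using a0 by (simp_all add: l_def) linarith+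
    have ll: "lD \<le> l" "\<And>i. l \<le> t (i + 2) - t i" "\<And>i. t (i + 2) - t i \<le> 2 * l"
    proof -
      have "real lD \<le> real l" using l(2) a0(2) el(1) by (simp add: a0_def)
      then show "lD \<le> l" by simp
      fix i
      have "real l \<le> real (t (i + 2) - t i)" using l(1) g2(1)[of i] by linarith
      then show "l \<le> t (i + 2) - t i" by simp
      have "real (t (i + 2) - t i) \<le> 2 * real l" using l(2) g2(2)[of i] a0(2) by linarith
      then show "t (i + 2) - t i \<le> 2 * l" by linarith
    qed
    define g where "g i = t (i + 2) - t i" for i
    have "\<forall>i s. \<exists>Z\<in>sets S. measure S Z \<le> exp (- (cD * l)) \<and> (\<forall>x. x \<notin> Z \<longrightarrow> no_double_resonance \<epsilon>3 (g i) (g (i + s)) x)"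
      by (intro allI lD) (use ll in \<open>simp_all add: g_def\<close>)
    then obtain ZD where ZD: "\<And>i s. ZD i s \<in> sets S" "\<And>i s. measure S (ZD i s) \<le> exp (- (cD * l))"
      "\<And>i s x E. x \<notin> ZD i s \<Longrightarrow> \<bar>E\<bar> \<le> R \<Longrightarrow> \<epsilon>3 \<le> lyap E \<Longrightarrow>
      \<not> (norm (V E x (g i)) \<le> exp ((lyap E - \<epsilon>3) * g i) \<and>
         norm (V E (\<lambda>k. x (g i + k)) (g (i + s))) \<le> exp ((lyap E - \<epsilon>3) * g (i + s)))"
      by metis
    obtain ZU where ZU: "ZU \<in> sets S" "measure S ZU \<le> exp (- (cU * n))"
      and ZU': "\<And>x E k. x \<notin> ZU \<Longrightarrow> \<bar>E\<bar> \<le> R \<Longrightarrow> k \<le> n \<Longrightarrow> norm (V E x k) \<le> exp (lyap E * k + \<delta> * n)"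
      using elim(6) by blast
    \<comment> \<open>Only the first \<open>n\<close> coordinates are rotated; the others stay put
      so that the reindexing is injective.\<close>
    define rot where "rot a k = (if k < n then (a + k) mod n else k)" for a k :: nat
    have inj_rot: "inj (rot a)" for a
    proof (rule injI)
      fix k k' assume e: "rot a k = rot a k'"
      have lt: "(a + j) mod n < n" for j using n0 by simp
      show "k = k'"
      proof (cases "k < n \<and> k' < n")
        case True
        then have "a + k = a + k'" using e mod_inj_window[of "a + k" n "a + k'" a] by (simp add: rot_def)
        then show ?thesis by simp
      next
        case False
        then show ?thesis using e lt[of k] lt[of k'] by (auto simp: rot_def split: if_splits)
      qed
    qed
    \<comment> \<open>Moves two disjoint double arcs next to each other at the front, the position
      treated by \<open>double_resonance\<close>. All further coordinates are sent beyond
      \<open>n\<close> to keep the map injective.\<close>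
    define pr where "pr i s k = (if k < g i then (t i + k) mod n
      else if k < g i + g (i + s) then (t (i + s) + (k - g i)) mod n else k + n)" for i s k :: nat
    have inj_pr: "inj (pr i s)" if s: "2 \<le> s" "s + 2 \<le> r" for i s
    proof -
      define ps where "ps k = (if k < g i then t i + k else t (i + s) + (k - g i))" for k
      have m1: "t i \<le> t (i + 2)" "t (i + 2) \<le> t (i + s)" "t (i + s) \<le> t (i + s + 2)" "t (i + s + 2) \<le> t i + n"
        using s t_mono[of "i + s + 2" "i + r"] t_ring[of i] by (auto intro!: t_mono)
      have psb: "t i \<le> ps k \<and> ps k < t i + n" if "k < g i + g (i + s)" for k
        using that m1 by (auto simp: ps_def g_def)
      have psi: "k = k'" if "k < g i + g (i + s)" "k' < g i + g (i + s)" "ps k = ps k'" for k k'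
        using that m1 by (auto simp: ps_def g_def split: if_splits)
      have prs: "pr i s k = ps k mod n" if "k < g i + g (i + s)" for k
        using that by (auto simp: pr_def ps_def)
      have prl: "pr i s k = k + n" if "\<not> k < g i + g (i + s)" for k using that by (auto simp: pr_def)
      show ?thesis
      proof (rule injI)
        fix k k' assume e: "pr i s k = pr i s k'"
        have lt: "ps j mod n < n" for j using n0 by simp
        show "k = k'"
        proof (cases "k < g i + g (i + s)"; cases "k' < g i + g (i + s)")
          assume kk: "k < g i + g (i + s)" "k' < g i + g (i + s)"
          then have "ps k = ps k'"
            using e psb mod_inj_window[of "ps k" n "ps k'" "t i"] by (auto simp: prs)
          then show ?thesis using psi kk by blast
        next
          assume "k < g i + g (i + s)" "\<not> k' < g i + g (i + s)"
          then show ?thesis using e lt[of k] by (simp add: prs prl)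
        next
          assume "\<not> k < g i + g (i + s)" "k' < g i + g (i + s)"
          then show ?thesis using e lt[of k'] by (simp add: prs prl)
        next
          assume "\<not> k < g i + g (i + s)" "\<not> k' < g i + g (i + s)"
          then show ?thesis using e by (simp add: prl)
        qed
      qed
    qed
    \<comment> \<open>The union over rotations costs a factor \<open>n\<close>, the one over pairs
      of double arcs a constant depending on \<open>r\<close>.\<close>
    define Z1 where "Z1 = (\<Union>a\<in>{..<n}. (\<lambda>x k. x (rot a k)) -` ZU)"
    define Pset where "Pset = {p \<in> {..r} \<times> {..<r}. 2 \<le> snd p \<and> snd p + 2 \<le> r}"
    have Pset: "finite Pset" "card Pset \<le> (r + 1) * r"
    proof -
      show "finite Pset" by (simp add: Pset_def)
      have "card Pset \<le> card ({..r} \<times> {..<r})" by (rule card_mono) (auto simp: Pset_def)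
      then show "card Pset \<le> (r + 1) * r" by simp
    qed
    define Z2 where "Z2 = (\<Union>p\<in>Pset. (\<lambda>x k. x (pr (fst p) (snd p) k)) -` ZD (fst p) (snd p))"
    have m1: "(\<lambda>x k. x (rot a k)) -` ZU \<in> sets S" "measure S ((\<lambda>x k. x (rot a k)) -` ZU) = measure S ZU" for a
      by (rule measure_reindex[OF inj_rot ZU(1)])+
    have m2: "(\<lambda>x k. x (pr (fst p) (snd p) k)) -` ZD (fst p) (snd p) \<in> sets S"
      "measure S ((\<lambda>x k. x (pr (fst p) (snd p) k)) -` ZD (fst p) (snd p)) = measure S (ZD (fst p) (snd p))"
      if "p \<in> Pset" for p
      using that measure_reindex[OF inj_pr[of "snd p" "fst p"] ZD(1)] by (auto simp: Pset_def)
    have Zm: "Z1 \<in> sets S" "Z2 \<in> sets S"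
      unfolding Z1_def Z2_def using m1 m2 Pset by (auto intro!: sets.finite_UN)
    have mZ1: "measure S Z1 \<le> n * exp (- (cU * n))"
    proof -
      have "measure S Z1 \<le> (\<Sum>a<n. measure S ((\<lambda>x k. x (rot a k)) -` ZU))"
        unfolding Z1_def by (rule P.finite_measure_subadditive_finite) (use m1 in auto)
      also have "\<dots> \<le> (\<Sum>a<n. exp (- (cU * n)))" by (rule sum_mono) (simp add: m1 ZU)
      finally show ?thesis by simp
    qed
    have mZ2: "measure S Z2 \<le> (real r + 1) * real r * exp (- (cD' * n))"
    proof -
      have "measure S Z2 \<le> (\<Sum>p\<in>Pset. measure S ((\<lambda>x k. x (pr (fst p) (snd p) k)) -` ZD (fst p) (snd p)))"
        unfolding Z2_def by (rule P.finite_measure_subadditive_finite) (use m2 Pset in auto)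
      also have "\<dots> \<le> (\<Sum>p\<in>Pset. exp (- (cD' * n)))"
      proof (rule sum_mono)
        fix p assume p: "p \<in> Pset"
        have "a0 \<le> real l" using l a0 by linarith
        then have "cD * a0 \<le> cD * l" using cD by (intro mult_left_mono) auto
        then have "exp (- (cD * l)) \<le> exp (- (cD' * n))" by (simp add: cD'_def a0_def)
        then show "measure S ((\<lambda>x k. x (pr (fst p) (snd p) k)) -` ZD (fst p) (snd p)) \<le> exp (- (cD' * n))"
          unfolding m2(2)[OF p] using ZD(2)[of "fst p" "snd p"] by linarith
      qed
      also have "\<dots> = real (card Pset) * exp (- (cD' * n))" by simp
      also have "\<dots> \<le> ((real r + 1) * real r) * exp (- (cD' * n))"
      proof (rule mult_right_mono)
        have "real (card Pset) \<le> real ((r + 1) * r)" using Pset(2) by (simp only: of_nat_le_iff)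
        then show "real (card Pset) \<le> (real r + 1) * real r" by (simp add: algebra_simps)
      qed simp
      finally show ?thesis .
    qed
    define Z where "Z = Z1 \<union> Z2"
    have Z: "Z \<in> sets S" "measure S Z \<le> exp (- (cc * n))"
      using Zm measure_Un_le[OF Zm] mZ1 mZ2 el(5) by (auto simp: Z_def)
    have upper: "norm (V E (\<lambda>i. x ((a + i) mod n)) k) \<le> exp (lyap E * k + \<delta> * n)"
      if x: "x \<notin> Z" and E: "\<bar>E\<bar> \<le> R" and k: "k \<le> n" for x a E k
    proof -
      have "a mod n < n" using n0 by simp
      then have "(\<lambda>k. x (rot (a mod n) k)) \<notin> ZU" using x by (auto simp: Z_def Z1_def)
      then have "norm (V E (\<lambda>k. x (rot (a mod n) k)) k) \<le> exp (lyap E * k + \<delta> * n)" by (rule ZU'[OF _ E k])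
      moreover have "V E (\<lambda>k. x (rot (a mod n) k)) k = V E (\<lambda>i. x ((a + i) mod n)) k"
        by (rule schr_prod_cong) (use k in \<open>simp add: rot_def mod_add_left_eq\<close>)
      ultimately show ?thesis by simp
    qed
    have lower: "\<exists>a<n. exp ((lyap E - \<epsilon>) * n) \<le> norm (V E (\<lambda>i. x ((a + i) mod n)) n)"
      if x: "x \<notin> Z" and E: "\<bar>E\<bar> \<le> R" and lE: "\<epsilon> \<le> lyap E" for x E
    proof -
      define xp where "xp k = x (k mod n)" for k
      define bad where "bad i \<longleftrightarrow> norm (V E (\<lambda>k. xp (t i + k)) (g i)) \<le> exp ((lyap E - \<epsilon>3) * g i)" for i
      have gE: "0 \<le> lyap E" using lyap_nonneg[OF E] .
      have lE3: "\<epsilon>3 \<le> lyap E" using lE \<epsilon> by (simp add: \<epsilon>3_def)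
      have nobad: False if i: "i \<le> r" and s: "2 \<le> s" "s + 2 \<le> r" and b: "bad i" "bad (i + s)" for i s
      proof -
        have "(i, s) \<in> Pset" using i s by (auto simp: Pset_def)
        then have "(\<lambda>k. x (pr i s k)) \<notin> ZD i s" using x by (auto simp: Z_def Z2_def)
        from ZD(3)[OF this E lE3]
        have "\<not> (norm (V E (\<lambda>k. x (pr i s k)) (g i)) \<le> exp ((lyap E - \<epsilon>3) * g i) \<and>
         norm (V E (\<lambda>k. x (pr i s (g i + k))) (g (i + s))) \<le> exp ((lyap E - \<epsilon>3) * g (i + s)))" .
        moreover have "V E (\<lambda>k. x (pr i s k)) (g i) = V E (\<lambda>k. xp (t i + k)) (g i)"
          by (rule schr_prod_cong) (simp add: pr_def xp_def)
        moreover have "V E (\<lambda>k. x (pr i s (g i + k))) (g (i + s)) = V E (\<lambda>k. xp (t (i + s) + k)) (g (i + s))"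
          by (rule schr_prod_cong) (simp add: pr_def xp_def)
        ultimately show False using b by (simp add: bad_def)
      qed
      have "\<exists>i0. \<forall>s. s + 2 < r \<longrightarrow> \<not> bad (i0 + s)"
      proof (rule ring_gap[of r bad])
        show "4 \<le> r" using r by simp
        show False if "i \<le> r" "2 \<le> s" "s + 2 \<le> r" "bad i" "bad (i + s)" for i s
          using nobad[OF that] .
        show "\<exists>i0. \<forall>s. s + 2 < r \<longrightarrow> \<not> bad (i0 + s)"
          if "\<And>s. s + 2 < r \<Longrightarrow> \<not> bad (i0 + s)" for i0
          using that by (intro exI[of _ i0] allI impI)
      qed
      then obtain i0 where "\<forall>s. s + 2 < r \<longrightarrow> \<not> bad (i0 + s)" ..
      then have i0: "\<not> bad (i0 + s)" if "s + 2 < r" for s using that by simp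
      define b where "b s = t (i0 + s)" for s
      let ?u = "\<lambda>k. E - c (xp k)"
      have blk: "norm (V E (\<lambda>k. xp (b s + k)) (t (Suc (i0 + s)) - t (i0 + s))) \<le> exp (lyap E * a0 + (\<Gamma> + \<delta> * n))" for s
      proof -
        let ?h = "t (Suc (i0 + s)) - t (i0 + s)"
        have "real ?h \<le> real n"
        proof -
          have "real ?h \<le> a0 + 1" by (rule g1)
          also have "\<dots> \<le> 6 * a0" using a0 by simp
          also have "\<dots> \<le> real r * a0" using r a0 by (intro mult_right_mono) auto
          finally show ?thesis by (simp add: a0)
        qed
        then have "norm (V E (\<lambda>k. x ((b s + k) mod n)) ?h) \<le> exp (lyap E * ?h + \<delta> * n)"
          using upper[OF x E] by simp
        also have "\<dots> \<le> exp (lyap E * a0 + (\<Gamma> + \<delta> * n))"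
        proof -
          have "lyap E * ?h \<le> lyap E * (a0 + 1)" using g1 gE by (intro mult_left_mono)
          then show ?thesis using lyap\<Gamma>[OF E] by (simp add: algebra_simps)
        qed
        finally show ?thesis by (simp add: xp_def)
      qed
      have chain: "exp ((real (r - 1) - 1) * (lyap E * a0 - (\<Gamma> + \<delta> * n) - (2 * \<epsilon>3 * a0 + \<Gamma>) - ln 8))
          \<le> norm (schr_prod (\<lambda>k. ?u (b 0 + k)) (b (r - 1) - b 0))"
      proof (rule chain_lower_exp[where t=b and u="?u"])
        show "b s \<le> b (Suc s)" for s unfolding b_def by (rule t_mono) simp
        show "norm (schr_prod (\<lambda>k. ?u (b s + k)) (b (Suc s) - b s)) \<le> exp (lyap E * a0 + (\<Gamma> + \<delta> * n))" for s
          using blk[of s] by (simp add: b_def)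
        show "exp (2 * (lyap E * a0) - (2 * \<epsilon>3 * a0 + \<Gamma>)) \<le> norm (schr_prod (\<lambda>k. ?u (b s + k)) (b (Suc (Suc s)) - b s))"
          if "Suc s < r - 1" for s
        proof -
          have "\<not> bad (i0 + s)" by (rule i0) (use that in simp)
          then have 1: "exp ((lyap E - \<epsilon>3) * g (i0 + s)) < norm (V E (\<lambda>k. xp (b s + k)) (g (i0 + s)))"
            by (simp add: bad_def b_def not_le)
          have "2 * (lyap E * a0) - (2 * \<epsilon>3 * a0 + \<Gamma>) \<le> (lyap E - \<epsilon>3) * (2 * a0 - 1)"
            using lyap\<Gamma>[OF E] \<epsilon>3 by (simp add: algebra_simps)
          also have "\<dots> \<le> (lyap E - \<epsilon>3) * g (i0 + s)" using g2(1) lE3 by (intro mult_left_mono) (auto simp: g_def)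
          finally have "exp (2 * (lyap E * a0) - (2 * \<epsilon>3 * a0 + \<Gamma>)) \<le> norm (V E (\<lambda>k. xp (b s + k)) (g (i0 + s)))"
            using 1 by (meson exp_le_cancel_iff less_imp_le order_trans)
          then show ?thesis by (simp add: b_def g_def)
        qed
        show "1 \<le> r - 1" using r by simp
        have "C0 \<le> \<epsilon> / 2 * a0" using el(3) by (simp add: a0_def)
        moreover have "\<delta> * n = \<epsilon> / 8 * a0" by (simp add: \<delta>_def a0_def)
        moreover have "2 * \<epsilon>3 * a0 = \<epsilon> / 4 * a0" by (simp add: \<epsilon>3_def)
        moreover have "\<epsilon> * a0 \<le> lyap E * a0" using lE a0 by (intro mult_right_mono) auto
        moreover have "0 \<le> \<epsilon> * a0" using \<epsilon> a0 by simp
        ultimately show "\<Gamma> + \<delta> * n + (2 * \<epsilon>3 * a0 + \<Gamma>) + ln 8 \<le> lyap E * a0"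
          unfolding C0_def by linarith
      qed
      define G where "G = V E (\<lambda>k. xp (b 0 + k)) (b (r - 1) - b 0)"
      define Bl where "Bl = V E (\<lambda>k. xp (b (r - 1) + k)) (b r - b (r - 1))"
      have Gge: "exp ((real (r - 1) - 1) * (lyap E * a0 - (\<Gamma> + \<delta> * n) - (2 * \<epsilon>3 * a0 + \<Gamma>) - ln 8)) \<le> norm G"
        using chain unfolding G_def .
      have br: "b 0 \<le> b (r - 1)" "b (r - 1) \<le> b r" "b r = b 0 + n"
      proof -
        show "b 0 \<le> b (r - 1)" "b (r - 1) \<le> b r" unfolding b_def by (rule t_mono, simp)+
        show "b r = b 0 + n" unfolding b_def by (simp add: t_ring)
      qed
      have Bl_le: "norm Bl \<le> exp (lyap E * a0 + (\<Gamma> + \<delta> * n))"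
      proof -
        have "Suc (i0 + (r - 1)) = i0 + r" using r by simp
        then show ?thesis using blk[of "r - 1"] by (simp add: Bl_def b_def)
      qed
      have "n = (b (r - 1) - b 0) + (b r - b (r - 1))" using br by simp
      then have "V E (\<lambda>k. xp (b 0 + k)) n = Bl ** G"
        using schr_prod_add[of "\<lambda>k. ?u (b 0 + k)" "b (r - 1) - b 0" "b r - b (r - 1)"] br
        by (simp add: Bl_def G_def add.assoc[symmetric])
      moreover have "norm G \<le> norm Bl * norm (Bl ** G)"
        by (rule norm_le_norm_mat2_mult) (simp add: Bl_def)
      ultimately have "norm G \<le> norm Bl * norm (V E (\<lambda>k. xp (b 0 + k)) n)" by simp
      also have "\<dots> \<le> exp (lyap E * a0 + (\<Gamma> + \<delta> * n)) * norm (V E (\<lambda>k. xp (b 0 + k)) n)"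
        by (intro mult_right_mono Bl_le) simp
      finally have low: "exp ((real (r - 1) - 1) * (lyap E * a0 - (\<Gamma> + \<delta> * n) - (2 * \<epsilon>3 * a0 + \<Gamma>) - ln 8))
          \<le> exp (lyap E * a0 + (\<Gamma> + \<delta> * n)) * norm (V E (\<lambda>k. xp (b 0 + k)) n)"
        using Gge by linarith
      \<comment> \<open>The growth of three arcs is lost: the arc left out of the chain, the factor
        missing in the avalanche bound, and the norm by which the last arc may shrink the product.
        They cost 3 \<epsilon> / 8 and the error terms at most \<epsilon> / 2.\<close>
      have expo: "(lyap E - \<epsilon>) * n + (lyap E * a0 + (\<Gamma> + \<delta> * n))
          \<le> (real (r - 1) - 1) * (lyap E * a0 - (\<Gamma> + \<delta> * n) - (2 * \<epsilon>3 * a0 + \<Gamma>) - ln 8)"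
      proof -
        define q where "q = real r - 2"
        have q: "real (r - 1) - 1 = q" "0 \<le> q" "q + 1 \<le> r" using r by (simp_all add: q_def of_nat_diff)
        define Y where "Y = \<delta> * n + 2 * \<epsilon>3 * a0 + C0"
        have e1: "r * (\<delta> * n) = \<epsilon> / 8 * n" using r by (simp add: \<delta>_def)
        have e2: "r * (2 * \<epsilon>3 * a0) = \<epsilon> / 4 * n" using a0(1) by (simp add: \<epsilon>3_def mult_ac)
        have e3: "lyap E * a0 \<le> \<epsilon> / 8 * n"
        proof -
          have "8 * \<Gamma> \<le> \<epsilon> * r" using r(1) \<epsilon> by (simp add: pos_divide_le_eq mult.commute)
          then have "lyap E * a0 \<le> \<epsilon> * r / 8 * a0" using a0 lyap\<Gamma>[OF E] by (intro mult_right_mono) auto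
          then show ?thesis using a0(1) by (simp add: mult_ac)
        qed
        have p: "0 \<le> \<delta> * n" "0 \<le> 2 * \<epsilon>3 * a0" "0 \<le> C0" using \<delta> \<epsilon>3 a0 \<Gamma> by (simp_all add: C0_def)
        have q1: "q * (\<delta> * n) + \<delta> * n \<le> \<epsilon> / 8 * n"
          using mult_right_mono[OF q(3) p(1)] e1 by (simp add: distrib_right)
        have q2: "q * (2 * \<epsilon>3 * a0) \<le> \<epsilon> / 4 * n"
          using mult_right_mono[of q r, OF _ p(2)] q e2 by linarith
        have q3: "q * C0 + \<Gamma> \<le> \<epsilon> / 8 * n"
          using mult_right_mono[of q r, OF _ p(3)] q el(4) by linarith
        have "q * (lyap E * a0) = lyap E * (real r * a0) - 2 * (lyap E * a0)" by (simp add: q_def algebra_simps)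
        then have q4: "q * (lyap E * a0) = lyap E * n - 2 * (lyap E * a0)" by (simp only: a0(1))
        have "q * (lyap E * a0 - (\<Gamma> + \<delta> * n) - (2 * \<epsilon>3 * a0 + \<Gamma>) - ln 8) = q * (lyap E * a0) - q * (\<delta> * n) - q * (2 * \<epsilon>3 * a0) - q * C0"
          by (simp add: C0_def algebra_simps)
        moreover have "0 \<le> \<epsilon> * n" using \<epsilon> by simp
        ultimately show ?thesis unfolding q(1) left_diff_distrib[of "lyap E"] using q1 q2 q3 q4 e3 by linarith
      qed
      have "exp ((lyap E - \<epsilon>) * n) * exp (lyap E * a0 + (\<Gamma> + \<delta> * n)) \<le>
          norm (V E (\<lambda>k. xp (b 0 + k)) n) * exp (lyap E * a0 + (\<Gamma> + \<delta> * n))"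
        using low expo by (simp add: exp_add[symmetric] mult.commute) (meson exp_le_cancel_iff order_trans)
      then have "exp ((lyap E - \<epsilon>) * n) \<le> norm (V E (\<lambda>k. xp (b 0 + k)) n)" by simp
      moreover have "V E (\<lambda>k. xp (b 0 + k)) n = V E (\<lambda>i. x ((b 0 mod n + i) mod n)) n"
        by (simp add: xp_def mod_add_left_eq)
      ultimately show ?thesis using n0 by (intro exI[of _ "b 0 mod n"]) simp
    qed
    show ?case
    proof (intro bexI[of _ Z] conjI allI impI Z)
      fix x a E k assume a: "x \<notin> Z" "\<bar>E\<bar> \<le> R" "k \<le> n"
      have "\<delta> * real n \<le> \<epsilon> * real n" using \<delta>(2) by (intro mult_right_mono) auto
      then have "exp (lyap E * k + \<delta> * n) \<le> exp (lyap E * k + \<epsilon> * n)" by simp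
      then show "norm (V E (\<lambda>i. x ((a + i) mod n)) k) \<le> exp (lyap E * k + \<epsilon> * n)" using upper[OF a, of a] by linarith
    qed (use lower in blast)
  qed
  then show ?thesis using cc(1) by (intro exI[of _ cc] conjI)
qed

end

section \<open>Eigenvalues and the trace of the transfer matrix\<close>

lemma hatano_nelson_eigenfunction:
  assumes "poly (char_poly (hatano_nelson x n g)) z = 0"
  obtains \<psi> where "\<exists>i<n. \<psi> i \<noteq> 0"
    "\<And>i. i < n \<Longrightarrow> complex_of_real (exp (- g)) * \<psi> ((i + n - 1) mod n)
      + complex_of_real (exp g) * \<psi> ((i + 1) mod n) + complex_of_real (x (i + 1)) * \<psi> i = z * \<psi> i"
proof -
  have carr: "hatano_nelson x n g \<in> carrier_mat n n" by (simp add: hatano_nelson_def)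
  then have "eigenvalue (hatano_nelson x n g) z" using assms by (simp add: eigenvalue_root_char_poly)
  then obtain w where "eigenvector (hatano_nelson x n g) w z" unfolding eigenvalue_def by blast
  then have w: "w \<in> carrier_vec n" "w \<noteq> 0\<^sub>v n" "hatano_nelson x n g *\<^sub>v w = z \<cdot>\<^sub>v w"
    using carr by (auto simp: eigenvector_def)
  show ?thesis
  proof (rule that[of "vec_index w"])
    show "\<exists>i<n. vec_index w i \<noteq> 0"
    proof (rule ccontr)
      assume "\<not> ?thesis"
      then have "w = 0\<^sub>v n" using w(1) by (intro eq_vecI) auto
      then show False using w(2) by simp
    qed
    fix i assume i: "i < n"
    have "vec_index (hatano_nelson x n g *\<^sub>v w) i = z * vec_index w i"
      unfolding w(3) using w(1) i by simp
    then show "complex_of_real (exp (- g)) * vec_index w ((i + n - 1) mod n)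
      + complex_of_real (exp g) * vec_index w ((i + 1) mod n) + complex_of_real (x (i + 1)) * vec_index w i = z * vec_index w i"
      unfolding hatano_nelson_mult_vec[OF w(1) i] .
  qed
qed

lemma eigenvalue_branches_root:
  assumes "eigenvalue_branches x n \<Lambda>" "j \<in> {1..n}" "0 \<le> g"
  shows "poly (char_poly (hatano_nelson x n g)) (\<Lambda> j g) = 0"
proof -
  have "char_poly (hatano_nelson x n g) = (\<Prod>j=1..n. [:- \<Lambda> j g, 1:])"
    using assms by (auto simp: eigenvalue_branches_def)
  then show ?thesis using assms by (auto simp: poly_prod intro!: prod_zero bexI[of _ j])
qed

lemma trace_of_eigenvector:
  fixes T :: "complex^2^2"
  assumes "mat2_det T = 1" "T *v w = \<mu> *s w" "w \<noteq> 0"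
  shows "trace T * \<mu> = \<mu>\<^sup>2 + 1"
proof -
  let ?a = "T $ 1 $ 1" and ?b = "T $ 1 $ 2" and ?c = "T $ 2 $ 1" and ?d = "T $ 2 $ 2"
  have det: "?a * ?d - ?b * ?c = 1" using assms(1) by (simp add: mat2_det_def)
  have "(T *v w) $ 1 = (\<mu> *s w) $ 1" "(T *v w) $ 2 = (\<mu> *s w) $ 2" using assms(2) by simp_all
  then have e: "(?a - \<mu>) * w $ 1 + ?b * w $ 2 = 0" "?c * w $ 1 + (?d - \<mu>) * w $ 2 = 0"
    by (simp_all add: algebra_simps)
  let ?D = "(?a - \<mu>) * (?d - \<mu>) - ?b * ?c"
  have "?D * w $ 1 = (?d - \<mu>) * ((?a - \<mu>) * w $ 1 + ?b * w $ 2) - ?b * (?c * w $ 1 + (?d - \<mu>) * w $ 2)"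
    by (simp add: algebra_simps)
  then have 1: "?D * w $ 1 = 0" unfolding e by simp
  have "?D * w $ 2 = (?a - \<mu>) * (?c * w $ 1 + (?d - \<mu>) * w $ 2) - ?c * ((?a - \<mu>) * w $ 1 + ?b * w $ 2)"
    by (simp add: algebra_simps)
  then have 2: "?D * w $ 2 = 0" unfolding e by simp
  have "w $ 1 \<noteq> 0 \<or> w $ 2 \<noteq> 0"
    using assms(3) by (auto simp: Finite_Cartesian_Product.vec_eq_iff forall_2)
  then have "?D = 0" using 1 2 by auto
  moreover have "?D = (?a * ?d - ?b * ?c) - (?a + ?d) * \<mu> + \<mu>\<^sup>2"
    by (simp add: power2_eq_square algebra_simps)
  ultimately show ?thesis unfolding det mat2_trace by (simp add: algebra_simps)
qed

text \<open>A gauge transformation: multiplying the eigenfunction by exp(g k) removes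
  \<open>g\<close> from the recurrence and moves it into the boundary condition. The transfer matrix
  around the ring then has the eigenvalue \<mu> = exp(n g), and having determinant 1 it has trace
  \<mu> + 1 / \<mu>.\<close>

lemma trace_at_eigenvalue:
  assumes "poly (char_poly (hatano_nelson x n g)) z = 0"
  shows "trace (schr_prod (\<lambda>i. z - complex_of_real (x (Suc i))) n) = complex_of_real (2 * cosh (real n * g))"
proof -
  obtain \<psi> where nz: "\<exists>i<n. \<psi> i \<noteq> 0" and eq: "\<And>i. i < n \<Longrightarrow> complex_of_real (exp (- g)) * \<psi> ((i + n - 1) mod n)
      + complex_of_real (exp g) * \<psi> ((i + 1) mod n) + complex_of_real (x (i + 1)) * \<psi> i = z * \<psi> i"
    using hatano_nelson_eigenfunction[OF assms] by blast
  \<comment> \<open>\<open>U k\<close> belongs to the site with index \<open>k - 1\<close>, taken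
    cyclically, so \<open>U 0\<close> is a multiple of the value at the last site. The index
    arithmetic modulo \<open>n\<close> also covers \<open>n\<close> = 1 and 2, where neighbours
    coincide.\<close>
  define U where "U k = complex_of_real (exp (g * (real k - 1))) * \<psi> ((k + n - 1) mod n)" for k
  define w :: "nat \<Rightarrow> complex^2" where "w k = vector [U (Suc k), U k]" for k
  have w: "w k $ 1 = U (Suc k)" "w k $ 2 = U k" for k by (simp_all add: w_def)
  define T where "T = schr_prod (\<lambda>i. z - complex_of_real (x (Suc i)))"
  have U1: "U (Suc k) = complex_of_real (exp (g * real k)) * \<psi> (k mod n)" for k
    by (simp add: U_def)
  have rec: "U (Suc (Suc k)) = (z - complex_of_real (x (Suc k))) * U (Suc k) - U k" if "k < n" for k
  proof -
    have "complex_of_real (exp (g * real k)) * (complex_of_real (exp (- g)) * \<psi> ((k + n - 1) mod n)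
      + complex_of_real (exp g) * \<psi> ((k + 1) mod n) + complex_of_real (x (k + 1)) * \<psi> k)
      = complex_of_real (exp (g * real k)) * (z * \<psi> k)" using eq[OF that] by simp
    moreover have "exp (g * real k) * exp (- g) = exp (g * (real k - 1))" "exp (g * real k) * exp g = exp (g * real (Suc k))"
      by (simp_all add: exp_add[symmetric] algebra_simps)
    ultimately have "complex_of_real (exp (g * (real k - 1))) * \<psi> ((k + n - 1) mod n)
      + complex_of_real (exp (g * real (Suc k))) * \<psi> ((k + 1) mod n)
      + complex_of_real (exp (g * real k)) * (complex_of_real (x (k + 1)) * \<psi> k)
      = complex_of_real (exp (g * real k)) * (z * \<psi> k)"
      by (simp only: distrib_left mult.assoc[symmetric] of_real_mult[symmetric])
    then show ?thesis unfolding U1 using that by (simp add: U_def algebra_simps)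
  qed
  have Tw: "T k *v w 0 = w k" if "k \<le> n" for k
    using that
  proof (induction k)
    case 0
    show ?case by (simp add: T_def)
  next
    case (Suc k)
    have "T (Suc k) *v w 0 = schr_step (z - complex_of_real (x (Suc k))) *v w k"
      using Suc by (simp add: T_def matrix_vector_mul_assoc[symmetric])
    moreover have "\<dots> = w (Suc k)"
      unfolding Finite_Cartesian_Product.vec_eq_iff forall_2 using rec[of k] Suc(2) by (simp add: w)
    ultimately show ?case by simp
  qed
  have w0: "w 0 \<noteq> 0"
  proof
    assume z0: "w 0 = 0"
    obtain i where i: "i < n" "\<psi> i \<noteq> 0" using nz by blast
    have "w i = 0" using Tw[of i] i z0 by simp
    then have "U (Suc i) = 0" using w(1)[of i] by simp
    then show False using i by (simp add: U1)
  qed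
  let ?\<mu> = "complex_of_real (exp (g * real n))"
  have "T n *v w 0 = ?\<mu> *s w 0"
  proof -
    have "n + n - 1 = (n - 1) + n" using nz by auto
    then have "(n + n - 1) mod n = (n - 1) mod n" by (simp only: mod_add_self2)
    then have "U n = ?\<mu> * U 0"
      by (simp add: U_def mult.assoc[symmetric] of_real_mult[symmetric] exp_add[symmetric] algebra_simps del: of_real_mult)
    moreover have "U (Suc n) = ?\<mu> * U (Suc 0)" by (simp add: U1)
    ultimately have "w n = ?\<mu> *s w 0"
      unfolding Finite_Cartesian_Product.vec_eq_iff forall_2 by (simp add: w)
    then show ?thesis using Tw[of n] by simp
  qed
  from trace_of_eigenvector[OF _ this w0] have t: "trace (T n) * ?\<mu> = ?\<mu>\<^sup>2 + 1" by (simp add: T_def)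
  have "2 * cosh (real n * g) * exp (g * real n) = (exp (g * real n))\<^sup>2 + 1"
    by (simp add: cosh_def exp_minus power2_eq_square field_simps)
  then have "complex_of_real (2 * cosh (real n * g)) * ?\<mu> = ?\<mu>\<^sup>2 + 1"
    by (metis of_real_1 of_real_add of_real_mult of_real_power)
  then have "trace (T n) * ?\<mu> = complex_of_real (2 * cosh (real n * g)) * ?\<mu>" using t by simp
  then show ?thesis by (simp add: T_def)
qed

text \<open>Summing the eigenvalue equation against the conjugate eigenfunction gives reality: the
  backward hopping sum is the conjugate of the forward one. The bound comes from the equation at a
  site of maximal modulus. The centre \<open>v0\<close> serves both bounded potentials, with
  \<open>v0\<close> = 0, and constant ones, with \<open>B\<close> = 0.\<close>

lemma hermitian_eigenvalue:
  assumes root: "poly (char_poly (hatano_nelson x n 0)) z = 0"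
    and B: "\<And>i. i < n \<Longrightarrow> \<bar>x (Suc i) - v0\<bar> \<le> B"
  shows "\<exists>E. z = complex_of_real E \<and> \<bar>E - v0\<bar> \<le> B + 2"
proof -
  obtain \<psi> where nz: "\<exists>i<n. \<psi> i \<noteq> 0" and eq: "\<And>i. i < n \<Longrightarrow> \<psi> ((i + n - 1) mod n)
      + \<psi> ((i + 1) mod n) + complex_of_real (x (i + 1)) * \<psi> i = z * \<psi> i"
    using hatano_nelson_eigenfunction[OF root] by auto
  have n: "0 < n" using nz by auto
  define P where "P = (\<Sum>i<n. cnj (\<psi> i) * \<psi> ((i + 1) mod n))"
  define N where "N = (\<Sum>i<n. (cmod (\<psi> i))\<^sup>2)"
  have "bij_betw (\<lambda>i. (i + 1) mod n) {..<n} {..<n}"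
  proof -
    have "inj_on (\<lambda>i. (i + 1) mod n) {..<n}"
      by (rule inj_onI) (use mod_inj_window[of _ n _ 1] in force)
    moreover have "(\<lambda>i. (i + 1) mod n) ` {..<n} \<subseteq> {..<n}" using n by auto
    ultimately show ?thesis by (simp add: bij_betw_def endo_inj_surj)
  qed
  then have "(\<Sum>i<n. cnj (\<psi> i) * \<psi> ((i + n - 1) mod n))
      = (\<Sum>i<n. cnj (\<psi> ((i + 1) mod n)) * \<psi> (((i + 1) mod n + n - 1) mod n))"
    by (rule sum.reindex_bij_betw[symmetric])
  also have "\<dots> = (\<Sum>i<n. cnj (cnj (\<psi> i) * \<psi> ((i + 1) mod n)))"
  proof (rule sum.cong[OF refl])
    fix i assume i: "i \<in> {..<n}"
    have "((i + 1) mod n + n - 1) mod n = i"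
    proof (cases "i + 1 = n")
      case False
      then have "(i + 1) mod n = i + 1" using i by simp
      then show ?thesis using i by simp
    next
      case True
      then have "(i + 1) mod n = 0" "n - 1 = i" by auto
      then show ?thesis using n by simp
    qed
    then show "cnj (\<psi> ((i + 1) mod n)) * \<psi> (((i + 1) mod n + n - 1) mod n) = cnj (cnj (\<psi> i) * \<psi> ((i + 1) mod n))"
      by (simp only: complex_cnj_mult complex_cnj_cnj mult.commute)
  qed
  finally have P': "(\<Sum>i<n. cnj (\<psi> i) * \<psi> ((i + n - 1) mod n)) = cnj P" by (simp add: P_def)
  have sq: "cnj a * a = complex_of_real ((cmod a)\<^sup>2)" for a :: complex
    by (metis complex_norm_square mult.commute)
  have "z * complex_of_real N = (\<Sum>i<n. cnj (\<psi> i) * (z * \<psi> i))"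
    unfolding N_def of_real_sum sum_distrib_left sq[symmetric] by (rule sum.cong) (simp_all only: mult_ac)
  also have "\<dots> = (\<Sum>i<n. cnj (\<psi> i) * \<psi> ((i + n - 1) mod n) + cnj (\<psi> i) * \<psi> ((i + 1) mod n)
      + complex_of_real (x (i + 1) * (cmod (\<psi> i))\<^sup>2))"
  proof (rule sum.cong[OF refl])
    fix i assume "i \<in> {..<n}"
    then have i: "i < n" by simp
    show "cnj (\<psi> i) * (z * \<psi> i) = cnj (\<psi> i) * \<psi> ((i + n - 1) mod n) + cnj (\<psi> i) * \<psi> ((i + 1) mod n)
      + complex_of_real (x (i + 1) * (cmod (\<psi> i))\<^sup>2)"
      unfolding eq[OF i, symmetric] of_real_mult sq[symmetric] by (simp only: distrib_left mult_ac)
  qed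
  also have "\<dots> = cnj P + P + complex_of_real (\<Sum>i<n. x (i + 1) * (cmod (\<psi> i))\<^sup>2)"
    unfolding sum.distrib P' of_real_sum P_def[symmetric] by simp
  also have "\<dots> = complex_of_real (2 * Re P + (\<Sum>i<n. x (i + 1) * (cmod (\<psi> i))\<^sup>2))"
    by (simp add: complex_eq_iff)
  finally have zN: "z * complex_of_real N = complex_of_real (2 * Re P + (\<Sum>i<n. x (i + 1) * (cmod (\<psi> i))\<^sup>2))" .
  have "0 < N"
  proof -
    obtain i where i: "i < n" "\<psi> i \<noteq> 0" using nz by blast
    have "0 < (cmod (\<psi> i))\<^sup>2" using i by simp
    also have "\<dots> \<le> N" unfolding N_def using i by (intro member_le_sum) auto
    finally show ?thesis .
  qed
  define E where "E = (2 * Re P + (\<Sum>i<n. x (i + 1) * (cmod (\<psi> i))\<^sup>2)) / N"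
  have zE: "z = complex_of_real E"
    using zN \<open>0 < N\<close> by (simp add: E_def field_simps)
  \<comment> \<open>At a site of maximal modulus the two neighbours contribute at most twice that
    modulus.\<close>
  obtain i0 where i0: "i0 \<in> {..<n}" "(MAX i\<in>{..<n}. cmod (\<psi> i)) = cmod (\<psi> i0)"
    by (rule obtains_MAX[of "{..<n}" "\<lambda>i. cmod (\<psi> i)"]) (use n in auto)
  have mx: "cmod (\<psi> i) \<le> cmod (\<psi> i0)" if "i < n" for i
    unfolding i0(2)[symmetric] using that by (intro Max_ge) auto
  have pos: "0 < cmod (\<psi> i0)" using nz mx by (metis norm_le_zero_iff not_le zero_less_norm_iff order_le_less_trans)
  have "(z - complex_of_real (x (i0 + 1))) * \<psi> i0 = \<psi> ((i0 + n - 1) mod n) + \<psi> ((i0 + 1) mod n)"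
    using eq[of i0] i0(1) by (simp add: algebra_simps)
  then have "cmod (z - complex_of_real (x (i0 + 1))) * cmod (\<psi> i0) \<le> cmod (\<psi> ((i0 + n - 1) mod n)) + cmod (\<psi> ((i0 + 1) mod n))"
    by (metis norm_mult norm_triangle_ineq)
  also have "\<dots> \<le> 2 * cmod (\<psi> i0)" using mx[of "(i0 + n - 1) mod n"] mx[of "(i0 + 1) mod n"] n by simp
  finally have "cmod (z - complex_of_real (x (i0 + 1))) \<le> 2" using pos by simp
  then have "\<bar>E - x (Suc i0)\<bar> \<le> 2" unfolding zE by (metis norm_of_real of_real_diff Suc_eq_plus1)
  moreover have "\<bar>x (Suc i0) - v0\<bar> \<le> B" using B i0(1) by simp
  ultimately show ?thesis using zE by (intro exI[of _ E]) auto
qed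

section \<open>Following a continuous branch along real solutions of the trace equation\<close>

lemma schr_prod_of_real:
  "schr_prod (\<lambda>i. complex_of_real (u i)) n $ a $ b = complex_of_real (schr_prod u n $ a $ b)"
proof (induction n arbitrary: a b)
  case 0
  show ?case by (simp add: mat2_one_nth)
next
  case (Suc n a b)
  have "a = 1 \<or> a = 2" using exhaust_2 by auto
  then show ?case by (elim disjE) (simp_all add: Suc)
qed

lemma schr_deriv_of_real:
  "schr_deriv (\<lambda>i. complex_of_real (u i)) n $ a $ b = complex_of_real (schr_deriv u n $ a $ b)"
proof (induction n arbitrary: a b)
  case 0
  show ?case by simp
next
  case (Suc n a b)
  have "a = 1 \<or> a = 2" using exhaust_2 by auto
  then show ?case by (elim disjE) (simp_all add: Suc schr_prod_of_real)
qed

lemma trace_schr_prod_has_derivative: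
  fixes x :: "nat \<Rightarrow> 'a::real_normed_field"
  shows "((\<lambda>z. trace (schr_prod (\<lambda>i. z - x i) n)) has_field_derivative trace (schr_deriv (\<lambda>i. z - x i) n)) (at z)"
  unfolding mat2_trace by (intro DERIV_add schr_prod_has_derivative)

text \<open>Injectivity is needed on a complex disc, because the branch is not yet known to be real
  nearby.\<close>

lemma trace_schr_prod_locally_injective:
  fixes y :: "nat \<Rightarrow> real"
  assumes "trace (schr_deriv (\<lambda>i. E - y i) n) \<noteq> 0"
  obtains r where "0 < r" "inj_on (\<lambda>z. trace (schr_prod (\<lambda>i. z - complex_of_real (y i)) n)) (ball (complex_of_real E) r)"
proof -
  let ?f = "\<lambda>z. trace (schr_prod (\<lambda>i. z - complex_of_real (y i)) n)"
  have hol: "?f holomorphic_on UNIV"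
    using trace_schr_prod_has_derivative[of "\<lambda>i. complex_of_real (y i)" n]
    by (auto simp: holomorphic_on_def field_differentiable_def)
  have "deriv ?f (complex_of_real E) = trace (schr_deriv (\<lambda>i. complex_of_real E - complex_of_real (y i)) n)"
    by (rule DERIV_imp_deriv) (rule trace_schr_prod_has_derivative)
  also have "\<dots> = complex_of_real (trace (schr_deriv (\<lambda>i. E - y i) n))"
    unfolding of_real_diff[symmetric] mat2_trace schr_deriv_of_real by simp
  finally have "deriv ?f (complex_of_real E) \<noteq> 0" using assms by simp
  from has_complex_derivative_locally_injective[OF hol _ open_UNIV this] that show ?thesis by auto
qed

text \<open>The gain of the trace between 0 and \<open>g\<close>, for t = n g. The exact form is the
  source of the factor (1 - exp(- n g))^2 in the theorem.\<close>

lemma two_cosh_bounds: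
  fixes t :: real assumes "0 \<le> t"
  shows "2 * cosh t - 2 \<le> exp t" "2 * cosh t - 2 = exp t * (1 - exp (- t))\<^sup>2"
proof -
  have c: "2 * cosh t = exp t + exp (- t)" by (simp add: cosh_def)
  show "2 * cosh t - 2 \<le> exp t" using assms unfolding c by (simp add: one_le_exp_iff) (smt (verit) exp_ge_zero one_le_exp_iff exp_le_one_iff)
  show "2 * cosh t - 2 = exp t * (1 - exp (- t))\<^sup>2"
    unfolding c by (simp add: exp_minus power2_eq_square field_simps)
qed

text \<open>As \<open>g\<close> grows, the real solution of \<open>trace = 2 cosh (n g)\<close> that starts at \<open>E0\<close> moves
  monotonically along a segment on which the trace is locally injective, so the continuous branch
  cannot leave it.\<close>

lemma real_branch:
  fixes y :: "nat \<Rightarrow> real" and \<Lambda> :: "real \<Rightarrow> complex" and n :: nat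
  defines "\<Delta>' \<equiv> \<lambda>E. trace (schr_deriv (\<lambda>i. E - y i) n)"
  assumes cont: "continuous_on {0..} \<Lambda>" and L0: "\<Lambda> 0 = complex_of_real E0"
    and eq: "\<And>g. 0 \<le> g \<Longrightarrow> trace (schr_prod (\<lambda>i. \<Lambda> g - complex_of_real (y i)) n) = complex_of_real (2 * cosh (real n * g))"
    and m: "0 < m" "\<bar>\<Delta>' E0\<bar> = m" and \<rho>: "0 < \<rho>"
    and lip: "\<And>E. \<bar>E - E0\<bar> \<le> \<rho> \<Longrightarrow> \<bar>\<Delta>' E - \<Delta>' E0\<bar> \<le> m / 2"
    and G: "0 \<le> G" "2 * cosh (real n * G) - 2 \<le> m / 2 * \<rho>"
  shows "\<exists>E. \<Lambda> G = complex_of_real E \<and> \<bar>E - E0\<bar> \<le> \<rho> \<and> m / 2 * \<bar>E - E0\<bar> \<le> 2 * cosh (real n * G) - 2"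
proof -
  define \<Delta> where "\<Delta> E = trace (schr_prod (\<lambda>i. E - y i) n)" for E
  have tr: "trace (schr_prod (\<lambda>i. complex_of_real E - complex_of_real (y i)) n) = complex_of_real (\<Delta> E)" for E
    unfolding of_real_diff[symmetric] mat2_trace schr_prod_of_real \<Delta>_def by simp
  have dE: "(\<Delta> has_field_derivative \<Delta>' E) (at E)" for E
    unfolding \<Delta>_def[abs_def] \<Delta>'_def by (rule trace_schr_prod_has_derivative)
  \<comment> \<open>The trace may decrease in the energy at \<open>E0\<close>; the sign
    \<open>s\<close> picks the direction in which it increases.\<close>
  define s where "s = sgn (\<Delta>' E0)"
  have s: "s * \<Delta>' E0 = m" "\<bar>s\<bar> = 1" using m by (auto simp: s_def sgn_if)
  define h where "h t = \<Delta> (E0 + s * t)" for t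
  define h' where "h' t = s * \<Delta>' (E0 + s * t)" for t
  have dh: "(h has_field_derivative h' t) (at t)" for t
    unfolding h_def[abs_def] h'_def
    by (rule DERIV_chain2[where g="\<lambda>t. E0 + s * t", OF dE, THEN DERIV_cong]) (auto intro!: derivative_eq_intros)
  have h'm: "m / 2 \<le> h' t" if "0 \<le> t" "t \<le> \<rho>" for t
  proof -
    have "\<bar>E0 + s * t - E0\<bar> \<le> \<rho>" using that s by (simp add: abs_mult)
    then have "\<bar>\<Delta>' (E0 + s * t) - \<Delta>' E0\<bar> \<le> m / 2" by (rule lip)
    then have "\<bar>h' t - m\<bar> \<le> m / 2"
      unfolding h'_def s(1)[symmetric] right_diff_distrib[symmetric] abs_mult s(2) by (simp add: s)
    then show ?thesis by linarith
  qed
  have grow: "m / 2 * (t' - t) \<le> h t' - h t" if "0 \<le> t" "t \<le> t'" "t' \<le> \<rho>" for t t'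
  proof (cases "t = t'")
    case False
    then have "t < t'" using that by simp
    from MVT2[OF this, of h h'] dh obtain \<xi> where "t < \<xi>" "\<xi> < t'" "h t' - h t = (t' - t) * h' \<xi>"
      by blast
    moreover have "(t' - t) * (m / 2) \<le> (t' - t) * h' \<xi>"
      using that calculation by (intro mult_left_mono h'm) auto
    ultimately show ?thesis by (simp add: mult.commute)
  qed simp
  have "complex_of_real (\<Delta> E0) = complex_of_real 2"
    using eq[of 0] unfolding L0 tr by simp
  then have h0: "h 0 = 2" unfolding of_real_eq_iff by (simp add: h_def)
  have hcont: "continuous_on A h" for A
    using dh by (meson DERIV_isCont continuous_at_imp_continuous_on)
  have ch_mono: "cosh (real n * g) \<le> cosh (real n * g')" if "0 \<le> g" "g \<le> g'" for g g'
    using that by (intro cosh_real_nonneg_le_iff[THEN iffD2]) (auto simp: mult_left_mono)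
  have ex: "\<exists>t. 0 \<le> t \<and> t \<le> \<rho> \<and> h t = 2 * cosh (real n * g)" if "0 \<le> g" "g \<le> G" for g
  proof -
    have "2 * cosh (real n * g) \<le> h \<rho>" using grow[of 0 \<rho>] \<rho> h0 G ch_mono[OF that] by simp
    moreover have "h 0 \<le> 2 * cosh (real n * g)" using h0 cosh_real_ge_1[of "real n * g"] by simp
    ultimately show ?thesis using IVT'[of h 0 "2 * cosh (real n * g)" \<rho>] hcont \<rho> by auto
  qed
  then obtain \<tau> where \<tau>: "\<And>g. 0 \<le> g \<Longrightarrow> g \<le> G \<Longrightarrow> 0 \<le> \<tau> g \<and> \<tau> g \<le> \<rho> \<and> h (\<tau> g) = 2 * cosh (real n * g)"
    by metis
  have \<tau>dist: "m / 2 * \<bar>\<tau> g - \<tau> g'\<bar> \<le> \<bar>2 * cosh (real n * g) - 2 * cosh (real n * g')\<bar>"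
    if "0 \<le> g" "g \<le> G" "0 \<le> g'" "g' \<le> G" for g g'
  proof (cases "\<tau> g \<le> \<tau> g'")
    case True
    then have "m / 2 * (\<tau> g' - \<tau> g) \<le> 2 * cosh (real n * g') - 2 * cosh (real n * g)"
      using grow[of "\<tau> g" "\<tau> g'"] \<tau>[of g] \<tau>[of g'] that by simp
    moreover have e: "\<bar>\<tau> g - \<tau> g'\<bar> = \<tau> g' - \<tau> g" using True by simp
    ultimately show ?thesis unfolding e by linarith
  next
    case False
    then have "m / 2 * (\<tau> g - \<tau> g') \<le> 2 * cosh (real n * g) - 2 * cosh (real n * g')"
      using grow[of "\<tau> g'" "\<tau> g"] \<tau>[of g] \<tau>[of g'] that by simp
    moreover have e: "\<bar>\<tau> g - \<tau> g'\<bar> = \<tau> g - \<tau> g'" using False by simp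
    ultimately show ?thesis unfolding e by linarith
  qed
  define X where "X = (\<lambda>t. complex_of_real (E0 + s * t)) ` {0..\<rho>}"
  have Xclosed: "closed X"
    unfolding X_def by (intro compact_imp_closed compact_continuous_image continuous_intros) auto
  \<comment> \<open>The parameters at which the branch lies on the segment. This set is closed
    because the segment is; it is open because near such a parameter the branch and the real
    solution are close and have equal trace, where the trace is injective.\<close>
  define D where "D = {g\<in>{0..G}. \<Lambda> g \<in> X}"
  have contG: "continuous_on {0..G} \<Lambda>" using cont by (rule continuous_on_subset) auto
  have onX: "\<Lambda> g = complex_of_real (E0 + s * \<tau> g)" if g: "g \<in> D" for g
  proof -
    have g': "0 \<le> g" "g \<le> G" using g by (auto simp: D_def)
    obtain t where t: "0 \<le> t" "t \<le> \<rho>" "\<Lambda> g = complex_of_real (E0 + s * t)" using g by (auto simp: D_def X_def)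
    have "complex_of_real (h t) = complex_of_real (2 * cosh (real n * g))"
      using eq[OF g'(1)] unfolding t(3) tr h_def .
    then have "h t = h (\<tau> g)" using \<tau>[OF g'] by (simp only: of_real_eq_iff)
    then have "m / 2 * \<bar>t - \<tau> g\<bar> \<le> 0"
      using grow[of t "\<tau> g"] grow[of "\<tau> g" t] \<tau>[OF g'] t by (cases "t \<le> \<tau> g") auto
    then have "t = \<tau> g" using m by (simp add: mult_le_0_iff)
    then show ?thesis using t by simp
  qed
  have "closedin (top_of_set {0..G}) D"
    using continuous_closedin_preimage[OF contG Xclosed] by (simp add: D_def vimage_def Int_def)
  moreover have "openin (top_of_set {0..G}) D"
    unfolding openin_euclidean_subtopology_iff
  proof (intro conjI ballI)
    show "D \<subseteq> {0..G}" by (auto simp: D_def)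
    fix g assume g: "g \<in> D"
    then have g': "0 \<le> g" "g \<le> G" by (auto simp: D_def)
    let ?E = "E0 + s * \<tau> g"
    have "0 < h' (\<tau> g)" using h'm[of "\<tau> g"] \<tau>[OF g'] m by linarith
    then have "trace (schr_deriv (\<lambda>i. ?E - y i) n) \<noteq> 0" by (auto simp: h'_def \<Delta>'_def)
    then obtain r where r: "0 < r"
      "inj_on (\<lambda>z. trace (schr_prod (\<lambda>i. z - complex_of_real (y i)) n)) (ball (complex_of_real ?E) r)"
      by (rule trace_schr_prod_locally_injective)
    obtain d1 where d1: "0 < d1" "\<And>g'. g' \<in> {0..G} \<Longrightarrow> dist g' g < d1 \<Longrightarrow> dist (\<Lambda> g') (\<Lambda> g) < r"
      using contG r(1) g' unfolding continuous_on_iff by (metis atLeastAtMost_iff)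
    have "continuous_on UNIV (\<lambda>g. 2 * cosh (real n * g))" by (intro continuous_intros)
    then obtain d2 where d2: "0 < d2" "\<And>g'. dist g' g < d2 \<Longrightarrow> dist (2 * cosh (real n * g')) (2 * cosh (real n * g)) < m / 2 * r"
      using r(1) m(1) unfolding continuous_on_iff by (metis UNIV_I half_gt_zero mult_pos_pos)
    show "\<exists>e>0. \<forall>g'\<in>{0..G}. dist g' g < e \<longrightarrow> g' \<in> D"
    proof (intro exI[of _ "min d1 d2"] conjI ballI impI)
      show "0 < min d1 d2" using d1 d2 by simp
      fix k assume k: "k \<in> {0..G}" "dist k g < min d1 d2"
      have k': "0 \<le> k" "k \<le> G" using k by auto
      have 1: "\<Lambda> k \<in> ball (complex_of_real ?E) r"
        using d1(2)[of k] k onX[OF g] by (simp add: dist_commute)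
      have "m / 2 * \<bar>\<tau> k - \<tau> g\<bar> < m / 2 * r"
        using \<tau>dist[OF k' g'] d2(2)[of k] k by (simp add: dist_real_def)
      then have "\<bar>\<tau> k - \<tau> g\<bar> < r" using m(1) by (simp only: mult_less_cancel_left_pos half_gt_zero)
      moreover have "dist (complex_of_real (E0 + s * \<tau> k)) (complex_of_real ?E) = \<bar>\<tau> k - \<tau> g\<bar>"
      proof -
        have "dist (complex_of_real (E0 + s * \<tau> k)) (complex_of_real ?E) = \<bar>s * (\<tau> k - \<tau> g)\<bar>"
          by (simp only: dist_norm of_real_diff[symmetric] norm_of_real) (simp add: algebra_simps)
        then show ?thesis by (simp add: abs_mult s)
      qed
      ultimately have 2: "complex_of_real (E0 + s * \<tau> k) \<in> ball (complex_of_real ?E) r" by (simp add: dist_commute)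
      have "trace (schr_prod (\<lambda>i. \<Lambda> k - complex_of_real (y i)) n)
          = trace (schr_prod (\<lambda>i. complex_of_real (E0 + s * \<tau> k) - complex_of_real (y i)) n)"
        unfolding eq[OF k'(1)] tr using \<tau>[OF k'] by (simp add: h_def)
      then have "\<Lambda> k = complex_of_real (E0 + s * \<tau> k)" using inj_onD[OF r(2) _ 1 2] by simp
      then show "k \<in> D" using k \<tau>[OF k'] by (auto simp: D_def X_def)
    qed
  qed
  moreover have "0 \<in> D" using G L0 \<rho> by (auto simp: D_def X_def intro!: image_eqI[of _ _ 0])
  moreover have "connected {0..G}" by simp
  ultimately have "D = {0..G}" unfolding connected_clopen by blast
  then have "G \<in> D" using G by simp
  from onX[OF this] have \<Lambda>G: "\<Lambda> G = complex_of_real (E0 + s * \<tau> G)" .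
  have \<tau>G: "0 \<le> \<tau> G" "\<tau> G \<le> \<rho>" "h (\<tau> G) = 2 * cosh (real n * G)" using \<tau>[of G] G by auto
  have a: "\<bar>E0 + s * \<tau> G - E0\<bar> = \<tau> G" using \<tau>G s by (simp add: abs_mult)
  show ?thesis
  proof (intro exI[of _ "E0 + s * \<tau> G"] conjI \<Lambda>G)
    show "\<bar>E0 + s * \<tau> G - E0\<bar> \<le> \<rho>" using a \<tau>G by simp
    show "m / 2 * \<bar>E0 + s * \<tau> G - E0\<bar> \<le> 2 * cosh (real n * G) - 2"
      unfolding a using grow[of 0 "\<tau> G"] \<tau>G h0 by simp
  qed
qed

section \<open>Eigenvalues of a typical realization\<close>

abbreviation branch_estimates :: "real \<Rightarrow> real \<Rightarrow> nat \<Rightarrow> (real \<Rightarrow> complex) \<Rightarrow> bool" where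
  "branch_estimates \<gamma> \<epsilon> n z \<equiv> \<forall>g. 0 \<le> g \<and> g \<le> \<gamma> - \<epsilon> \<longrightarrow>
    z g \<in> \<real> \<and>
    (1 - exp (- (real n * g)))\<^sup>2 * exp (- ((\<gamma> - g + \<epsilon>) * real n)) \<le> cmod (z g - z 0) \<and>
    cmod (z g - z 0) < exp (- ((\<gamma> - g - \<epsilon>) * real n))"

context nondegenerate_potential
begin

text \<open>On the ring estimates everything is deterministic: the slope at \<lambda>_j(0) is at
  least exp((\<gamma> - 2 \<eta>) n), it varies by at most half of itself within \<rho>, and it is
  at most n exp((\<gamma> + 2 \<eta>) n) there. \<open>R\<close> exceeds the spectral bound
  \<open>K + 2\<close> by 1 to contain that neighbourhood.\<close>

lemma real_eigenvalues:
  fixes \<epsilon> :: real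
  assumes \<epsilon>: "0 < \<epsilon>" and R: "K + 3 \<le> R"
  shows "\<exists>cc::real>0. \<forall>\<^sub>F n in sequentially. \<exists>Z\<in>sets S. measure S Z \<le> exp (- (cc * n)) \<and> (\<forall>x. x \<notin> Z \<longrightarrow>
    (\<forall>\<Lambda>. eigenvalue_branches (\<lambda>k. c (x (k - 1))) n \<Lambda> \<longrightarrow>
      (\<forall>j\<in>{1..n}. \<bar>Re (\<Lambda> j 0)\<bar> \<le> R \<and> branch_estimates (lyap (Re (\<Lambda> j 0))) \<epsilon> n (\<Lambda> j))))"
proof -
  define \<eta> where "\<eta> = \<epsilon> / 16"
  have \<eta>: "0 < \<eta>" "\<epsilon> = 16 * \<eta>" using \<epsilon> by (simp_all add: \<eta>_def)
  obtain cc :: real where cc: "0 < cc" and ring: "\<forall>\<^sub>F n in sequentially. \<exists>Z\<in>sets S. measure S Z \<le> exp (- (cc * n)) \<and> (\<forall>x. x \<notin> Z \<longrightarrow>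
    ring_estimates \<eta> n x)"
    using ring_growth[OF \<eta>(1)] by (elim exE conjE) (rule that)
  obtain \<rho>0 where \<rho>0: "0 < \<rho>0" "\<And>E E'. \<bar>E\<bar> \<le> R \<Longrightarrow> \<bar>E'\<bar> \<le> R \<Longrightarrow> \<bar>E - E'\<bar> \<le> \<rho>0 \<Longrightarrow> \<bar>lyap E - lyap E'\<bar> \<le> \<eta>"
    using lyap_uniformly_continuous[OF \<eta>(1)] by auto
  have evs: "\<forall>\<^sub>F n in sequentially. exp (- (7 * \<eta> * real n)) \<le> \<rho>0"
    "\<forall>\<^sub>F n in sequentially. 6 \<le> exp (\<eta> * real n)"
    "\<forall>\<^sub>F n in sequentially. 2 * (real n)\<^sup>2 \<le> exp (\<eta> * real n)" "\<forall>\<^sub>F n::nat in sequentially. 1 \<le> n"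
  proof -
    show "\<forall>\<^sub>F n in sequentially. exp (- (7 * \<eta> * real n)) \<le> \<rho>0" using \<eta>(1) \<rho>0(1) by real_asymp
    show "\<forall>\<^sub>F n in sequentially. 6 \<le> exp (\<eta> * real n)"
      "\<forall>\<^sub>F n in sequentially. 2 * (real n)\<^sup>2 \<le> exp (\<eta> * real n)" using \<eta>(1) by real_asymp+
    show "\<forall>\<^sub>F n::nat in sequentially. 1 \<le> n" by (rule eventually_ge_at_top)
  qed
  have "\<forall>\<^sub>F n in sequentially. \<exists>Z\<in>sets S. measure S Z \<le> exp (- (cc * n)) \<and> (\<forall>x. x \<notin> Z \<longrightarrow>
    (\<forall>\<Lambda>. eigenvalue_branches (\<lambda>k. c (x (k - 1))) n \<Lambda> \<longrightarrow>
      (\<forall>j\<in>{1..n}. \<bar>Re (\<Lambda> j 0)\<bar> \<le> R \<and> branch_estimates (lyap (Re (\<Lambda> j 0))) \<epsilon> n (\<Lambda> j))))"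
    using evs ring
  proof eventually_elim
    case (elim n)
    note el = elim(1-4)
    obtain Z where Z: "Z \<in> sets S" "measure S Z \<le> exp (- (cc * n))"
      and upper: "\<And>x a E k. x \<notin> Z \<Longrightarrow> \<bar>E\<bar> \<le> R \<Longrightarrow> k \<le> n \<Longrightarrow> norm (V E (\<lambda>i. x ((a + i) mod n)) k) \<le> exp (lyap E * k + \<eta> * n)"
      and lower: "\<And>x E. x \<notin> Z \<Longrightarrow> \<bar>E\<bar> \<le> R \<Longrightarrow> \<eta> \<le> lyap E \<Longrightarrow> \<exists>a<n. exp ((lyap E - \<eta>) * n) \<le> norm (V E (\<lambda>i. x ((a + i) mod n)) n)"
      using elim(5) by blast
    show ?case
    proof (intro bexI[of _ Z] conjI allI impI ballI Z(1) Z(2))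
      fix x \<Lambda> j assume x: "x \<notin> Z" and br: "eigenvalue_branches (\<lambda>k. c (x (k - 1))) n \<Lambda>" and j: "j \<in> {1..n}"
      define y where "y i = c (x i)" for i
      note root = eigenvalue_branches_root[OF br j]
      have trC: "trace (schr_prod (\<lambda>i. \<Lambda> j g - complex_of_real (y i)) n) = complex_of_real (2 * cosh (real n * g))"
        if "0 \<le> g" for g
        using trace_at_eigenvalue[OF root[OF that]] by (simp add: y_def)
      obtain E0 where E0: "\<Lambda> j 0 = complex_of_real E0" "\<bar>E0\<bar> \<le> K + 2"
        using hermitian_eigenvalue[OF root[of 0], of 0 K] c_bound by auto
      have E0R: "\<bar>E0\<bar> \<le> R" using E0 R by linarith
      show "\<bar>Re (\<Lambda> j 0)\<bar> \<le> R" using E0 E0R by simp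
      fix g assume g: "0 \<le> g \<and> g \<le> lyap (Re (\<Lambda> j 0)) - \<epsilon>"
      define \<gamma> where "\<gamma> = lyap E0"
      have g': "0 \<le> g" "g \<le> \<gamma> - 16 * \<eta>" using g E0 \<eta> by (simp_all add: \<gamma>_def)
      have \<gamma>: "16 * \<eta> \<le> \<gamma>" "0 \<le> \<gamma>" using g' \<eta> by linarith+
      \<comment> \<open>The exponent 7 balances two demands. The slope varies by about exp((\<gamma>
        + 4 \<eta>) n) \<rho>, which must be well below exp((\<gamma> - 2 \<eta>) n). Yet the slope
        times \<rho> must exceed the trace gain, which is at most exp((\<gamma> - 16 \<eta>)
        n).\<close>
      define \<rho> where "\<rho> = exp (- (7 * \<eta> * real n))"
      have \<rho>: "0 < \<rho>" "\<rho> \<le> \<rho>0" "\<rho> \<le> 1" using el(1) \<eta> by (simp_all add: \<rho>_def)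
      have near: "\<bar>E\<bar> \<le> R" "lyap E \<le> \<gamma> + \<eta>" if "\<bar>E - E0\<bar> \<le> \<rho>" for E
      proof -
        show ER: "\<bar>E\<bar> \<le> R" using that \<rho>(3) E0(2) R by linarith
        have "\<bar>lyap E - lyap E0\<bar> \<le> \<eta>" using \<rho>0(2)[OF ER E0R] that \<rho>(2) by linarith
        then show "lyap E \<le> \<gamma> + \<eta>" by (simp add: \<gamma>_def abs_le_iff)
      qed
      have up: "norm (V E (\<lambda>i. x ((a + i) mod n)) k) \<le> exp (\<gamma> * k + 2 * \<eta> * n)"
        if "\<bar>E - E0\<bar> \<le> \<rho>" "k \<le> n" for E a k
      proof -
        have "lyap E * k \<le> (\<gamma> + \<eta>) * k" using near(2)[OF that(1)] by (intro mult_right_mono) auto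
        moreover have "\<eta> * k \<le> \<eta> * n" using that \<eta> by (intro mult_left_mono) auto
        ultimately have "lyap E * k + \<eta> * n \<le> \<gamma> * k + 2 * \<eta> * n" by (simp add: distrib_right)
        then show ?thesis using upper[OF x near(1)[OF that(1)] that(2), of a] by (meson exp_le_cancel_iff order_trans)
      qed
      define \<Delta> where "\<Delta> E = trace (schr_prod (\<lambda>i. E - y i) n)" for E
      define \<Delta>' where "\<Delta>' E = trace (schr_deriv (\<lambda>i. E - y i) n)" for E
      have dE: "(\<Delta> has_field_derivative \<Delta>' E) (at E)" for E
        unfolding \<Delta>_def[abs_def] \<Delta>'_def by (rule trace_schr_prod_has_derivative)
      have \<Delta>C: "complex_of_real (\<Delta> E) = trace (schr_prod (\<lambda>i. complex_of_real E - complex_of_real (y i)) n)" for E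
        unfolding of_real_diff[symmetric] mat2_trace schr_prod_of_real \<Delta>_def by simp
      have "complex_of_real (\<Delta> E0) = complex_of_real 2" unfolding \<Delta>C using trC[of 0] E0 by simp
      then have \<Delta>0: "\<Delta> E0 = 2" unfolding of_real_eq_iff .
      have sumD: "\<Delta>' E = (\<Sum>k<n. V E (\<lambda>i. x ((Suc k + i) mod n)) (n - 1) $ 1 $ 1)" for E
        unfolding \<Delta>'_def trace_schr_deriv y_def ..
      define m where "m = \<bar>\<Delta>' E0\<bar>"
      \<comment> \<open>The ring is cut where its product is large. As a function of the energy the
        trace does not depend on the cut, so neither does its slope, and trace 2 makes
        \<open>trace_schr_deriv_ge\<close> applicable.\<close>
      have m_ge: "exp ((\<gamma> - 2 * \<eta>) * n) \<le> m"
      proof -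
        obtain a where a: "a < n" "exp ((\<gamma> - \<eta>) * n) \<le> norm (V E0 (\<lambda>i. x ((a + i) mod n)) n)"
          using lower[OF x E0R] \<gamma> \<eta>(1) unfolding \<gamma>_def by auto
        let ?w = "\<lambda>E i. E - y ((a + i) mod n)"
        have rot: "trace (schr_prod (?w E) n) = \<Delta> E" for E
          unfolding \<Delta>_def using trace_schr_prod_rotate[of a n "\<lambda>i. E - y i"] a(1) by simp
        have "((\<lambda>E. trace (schr_prod (?w E) n)) has_field_derivative trace (schr_deriv (?w E0) n)) (at E0)"
          by (rule trace_schr_prod_has_derivative)
        then have "trace (schr_deriv (?w E0) n) = \<Delta>' E0"
          unfolding rot using dE by (rule DERIV_unique)
        moreover have "(norm (schr_prod (?w E0) n) - 2) / 4 \<le> \<bar>trace (schr_deriv (?w E0) n)\<bar>"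
          by (rule trace_schr_deriv_ge) (use rot \<Delta>0 el(4) in auto)
        ultimately have 1: "(exp ((\<gamma> - \<eta>) * n) - 2) / 4 \<le> m" using a(2) by (simp add: m_def y_def)
        define X where "X = exp ((\<gamma> - 2 * \<eta>) * n)"
        have "1 \<le> X" using \<gamma> \<eta> by (simp add: X_def)
        have "exp ((\<gamma> - \<eta>) * n) = exp (\<eta> * n) * X" by (simp add: X_def exp_add[symmetric] algebra_simps)
        moreover have "6 * X \<le> exp (\<eta> * n) * X" using el(2) \<open>1 \<le> X\<close> by (intro mult_right_mono) auto
        ultimately have "6 * X \<le> exp ((\<gamma> - \<eta>) * n)" by (simp only:)
        then have "4 * X \<le> exp ((\<gamma> - \<eta>) * n) - 2" using \<open>1 \<le> X\<close> by linarith
        also have "\<dots> \<le> 4 * m" using 1 by simp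
        finally show ?thesis unfolding X_def by simp
      qed
      have m: "0 < m" using m_ge by (meson exp_gt_zero less_le_trans)
      have lip: "\<bar>\<Delta>' E - \<Delta>' E0\<bar> \<le> m / 2" if E: "\<bar>E - E0\<bar> \<le> \<rho>" for E
      proof -
        \<comment> \<open>Bounds the product of the norms of the two pieces on either side of a
          site, each with error \<open>2 * \<eta> * n\<close>.\<close>
        let ?C = "exp (\<gamma> * n + 4 * \<eta> * n)"
        have "\<bar>\<Delta>' E - \<Delta>' E0\<bar> \<le> (\<Sum>k<n. real n * (?C * \<rho>))"
          unfolding sumD sum_subtractf[symmetric]
        proof (rule order_trans[OF sum_abs], rule sum_mono)
          fix k
          let ?x = "\<lambda>i. x ((Suc k + i) mod n)"
          have "norm (V E ?x (n - 1) - V E0 ?x (n - 1)) \<le> real (n - 1) * (?C * \<rho>)"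
          proof (rule norm_schr_prod_diff_le)
            show "\<bar>E - c (?x i) - (E0 - c (?x i))\<bar> \<le> \<rho>" for i using E by simp
            fix i assume i: "i < n - 1"
            have "norm (schr_prod (\<lambda>l. E - c (?x (Suc i + l))) (n - 1 - 1 - i)) \<le> exp (\<gamma> * real (n - 1 - 1 - i) + 2 * \<eta> * n)"
              using up[OF E, of "n - 1 - 1 - i" "Suc k + Suc i"] by (simp add: add.assoc)
            moreover have "norm (V E0 ?x i) \<le> exp (\<gamma> * i + 2 * \<eta> * n)" using up[of E0 i "Suc k"] i \<rho> by simp
            ultimately have "norm (schr_prod (\<lambda>l. E - c (?x (Suc i + l))) (n - 1 - 1 - i)) * norm (V E0 ?x i)
                \<le> exp (\<gamma> * real (n - 1 - 1 - i) + 2 * \<eta> * n) * exp (\<gamma> * i + 2 * \<eta> * n)"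
              by (intro mult_mono) auto
            also have "\<dots> = exp (\<gamma> * real (n - 1 - 1 - i + i) + 4 * \<eta> * n)"
              by (simp add: exp_add[symmetric] algebra_simps)
            also have "\<dots> \<le> ?C"
            proof -
              have "\<gamma> * real (n - 1 - 1 - i + i) \<le> \<gamma> * n" using \<gamma>(2) i by (intro mult_left_mono) auto
              then show ?thesis by simp
            qed
            finally show "norm (schr_prod (\<lambda>l. E - c (?x (Suc i + l))) (n - 1 - 1 - i)) * norm (V E0 ?x i) \<le> ?C" .
          qed
          also have "\<dots> \<le> real n * (?C * \<rho>)" using \<rho> by (intro mult_right_mono) auto
          finally have "norm (V E ?x (n - 1) - V E0 ?x (n - 1)) \<le> real n * (?C * \<rho>)" .
          then show "\<bar>V E ?x (n - 1) $ 1 $ 1 - V E0 ?x (n - 1) $ 1 $ 1\<bar> \<le> real n * (?C * \<rho>)"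
            using abs_nth_le_norm_mat2[of "V E ?x (n - 1) - V E0 ?x (n - 1)" 1 1] by simp
        qed
        also have "\<dots> = (real n)\<^sup>2 * (?C * \<rho>)" by (simp add: power2_eq_square)
        also have "?C * \<rho> = exp ((\<gamma> - 2 * \<eta>) * n) * exp (- (\<eta> * n))"
          by (simp add: \<rho>_def exp_add[symmetric] algebra_simps)
        also have "(real n)\<^sup>2 * (exp ((\<gamma> - 2 * \<eta>) * n) * exp (- (\<eta> * n))) = exp ((\<gamma> - 2 * \<eta>) * n) * ((real n)\<^sup>2 * exp (- (\<eta> * n)))"
          by simp
        also have "\<dots> \<le> exp ((\<gamma> - 2 * \<eta>) * n) * (1 / 2)"
          using el(3) by (intro mult_left_mono) (auto simp: exp_minus field_simps)
        also have "\<dots> \<le> m / 2" using m_ge by simp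
        finally show ?thesis .
      qed
      have ng: "0 \<le> real n * g" using g' by simp
      have e2: "exp (7 * \<eta> * n) \<ge> 2" "exp (14 * \<eta> * n) > 2" "real n \<le> exp (14 * \<eta> * n)"
      proof -
        have e: "exp (\<eta> * n) \<le> exp (7 * \<eta> * n)" "exp (\<eta> * n) \<le> exp (14 * \<eta> * n)" using \<eta> by simp_all
        show "exp (7 * \<eta> * n) \<ge> 2" "exp (14 * \<eta> * n) > 2" using e el(2) by linarith+
        have "real n * 1 \<le> real n * real n" using el(4) by (intro mult_left_mono) auto
        then have "real n \<le> exp (\<eta> * n)" using el(3) unfolding power2_eq_square by linarith
        then show "real n \<le> exp (14 * \<eta> * n)" using e(2) by linarith
      qed
      have cosh_le: "2 * cosh (real n * g) - 2 \<le> m / 2 * \<rho>"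
      proof -
        have "2 * cosh (real n * g) - 2 \<le> exp (real n * g)" by (rule two_cosh_bounds(1)[OF ng])
        also have "\<dots> \<le> exp ((\<gamma> - 16 * \<eta>) * n)"
          using mult_left_mono[OF g'(2), of "real n"] by (simp add: mult.commute)
        also have "\<dots> = exp ((\<gamma> - 9 * \<eta>) * n) / exp (7 * \<eta> * n)"
          by (simp add: exp_diff[symmetric] algebra_simps)
        also have "\<dots> \<le> exp ((\<gamma> - 9 * \<eta>) * n) / 2" using e2(1) by (intro divide_left_mono) auto
        also have "exp ((\<gamma> - 9 * \<eta>) * n) = exp ((\<gamma> - 2 * \<eta>) * n) * \<rho>"
          by (simp add: \<rho>_def exp_add[symmetric] algebra_simps)
        also have "exp ((\<gamma> - 2 * \<eta>) * n) * \<rho> / 2 \<le> m * \<rho> / 2"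
          using mult_right_mono[OF m_ge less_imp_le[OF \<rho>(1)]] by simp
        finally show ?thesis by simp
      qed
      have "\<exists>E. \<Lambda> j g = complex_of_real E \<and> \<bar>E - E0\<bar> \<le> \<rho> \<and> m / 2 * \<bar>E - E0\<bar> \<le> 2 * cosh (real n * g) - 2"
      proof (rule real_branch[where y=y])
        show "continuous_on {0..} (\<Lambda> j)" using br j by (auto simp: eigenvalue_branches_def)
      qed (use E0 trC m \<rho> lip g' cosh_le in \<open>auto simp: m_def \<Delta>'_def\<close>)
      then obtain E where E: "\<Lambda> j g = complex_of_real E" "\<bar>E - E0\<bar> \<le> \<rho>" "m / 2 * \<bar>E - E0\<bar> \<le> 2 * cosh (real n * g) - 2"
        by blast
      show "\<Lambda> j g \<in> \<real>" using E(1) by simp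
      have dist: "cmod (\<Lambda> j g - \<Lambda> j 0) = \<bar>E - E0\<bar>"
        unfolding E(1) E0(1) of_real_diff[symmetric] norm_of_real ..
      have Re0: "lyap (Re (\<Lambda> j 0)) = \<gamma>" using E0 by (simp add: \<gamma>_def)
      show "cmod (\<Lambda> j g - \<Lambda> j 0) < exp (- ((lyap (Re (\<Lambda> j 0)) - g - \<epsilon>) * real n))"
      proof -
        have "exp ((\<gamma> - 2 * \<eta>) * n) * \<bar>E - E0\<bar> \<le> m * \<bar>E - E0\<bar>" using m_ge by (intro mult_right_mono) auto
        also have "\<dots> \<le> 2 * exp (real n * g)" using E(3) two_cosh_bounds(1)[OF ng] by simp
        also have "\<dots> < exp (14 * \<eta> * n) * exp (real n * g)" using e2(2) by (intro mult_strict_right_mono) auto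
        also have "\<dots> = exp ((\<gamma> - 2 * \<eta>) * n) * exp (- ((\<gamma> - g - \<epsilon>) * n))"
          by (simp add: exp_add[symmetric] \<eta>(2) algebra_simps)
        finally show ?thesis unfolding dist Re0 by simp
      qed
      show "(1 - exp (- (real n * g)))\<^sup>2 * exp (- ((lyap (Re (\<Lambda> j 0)) - g + \<epsilon>) * real n)) \<le> cmod (\<Lambda> j g - \<Lambda> j 0)"
      proof -
        have "complex_of_real (\<Delta> E) = complex_of_real (2 * cosh (real n * g))"
          unfolding \<Delta>C using trC[OF g'(1)] E(1) by simp
        then have \<Delta>E: "\<Delta> E = 2 * cosh (real n * g)" unfolding of_real_eq_iff .
        \<comment> \<open>Conversely the trace cannot climb faster than its largest slope near
          \<open>E0\<close>, so gaining 2 cosh(n g) - 2 takes a minimal distance.\<close>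
        have "norm (\<Delta> E - \<Delta> E0) \<le> (n * exp (\<gamma> * n + 2 * \<eta> * n)) * norm (E - E0)"
        proof (rule field_differentiable_bound[where S="{E0 - \<rho>..E0 + \<rho>}"])
          show "(\<Delta> has_field_derivative \<Delta>' z) (at z within {E0 - \<rho>..E0 + \<rho>})" for z
            using dE by (rule DERIV_subset) simp
          fix z assume "z \<in> {E0 - \<rho>..E0 + \<rho>}"
          then have z: "\<bar>z - E0\<bar> \<le> \<rho>" by auto
          have "\<bar>\<Delta>' z\<bar> \<le> (\<Sum>k<n. exp (\<gamma> * n + 2 * \<eta> * n))"
            unfolding sumD
          proof (rule order_trans[OF sum_abs], rule sum_mono)
            fix k
            have "\<bar>V z (\<lambda>i. x ((Suc k + i) mod n)) (n - 1) $ 1 $ 1\<bar> \<le> norm (V z (\<lambda>i. x ((Suc k + i) mod n)) (n - 1))"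
              by (rule abs_nth_le_norm_mat2)
            also have "\<dots> \<le> exp (\<gamma> * real (n - 1) + 2 * \<eta> * n)" by (rule up[OF z]) simp
            also have "\<dots> \<le> exp (\<gamma> * n + 2 * \<eta> * n)" using \<gamma>(2) by (simp add: mult_left_mono)
            finally show "\<bar>V z (\<lambda>i. x ((Suc k + i) mod n)) (n - 1) $ 1 $ 1\<bar> \<le> exp (\<gamma> * n + 2 * \<eta> * n)" .
          qed
          then show "norm (\<Delta>' z) \<le> n * exp (\<gamma> * n + 2 * \<eta> * n)" by simp
        qed (use E(2) \<rho> in auto)
        then have 1: "2 * cosh (real n * g) - 2 \<le> n * exp (\<gamma> * n + 2 * \<eta> * n) * \<bar>E - E0\<bar>"
          unfolding \<Delta>E \<Delta>0 by simp
        let ?q = "(1 - exp (- (real n * g)))\<^sup>2"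
        have "exp (real n * g) * ?q \<le> n * exp (\<gamma> * n + 2 * \<eta> * n) * \<bar>E - E0\<bar>"
          using 1 two_cosh_bounds(2)[OF ng] by simp
        also have "\<dots> \<le> exp (14 * \<eta> * n) * exp (\<gamma> * n + 2 * \<eta> * n) * \<bar>E - E0\<bar>"
          using e2(3) by (intro mult_right_mono) auto
        also have "\<dots> = exp ((\<gamma> + 16 * \<eta>) * n) * \<bar>E - E0\<bar>"
          by (simp add: exp_add[symmetric] algebra_simps)
        finally have "exp (- ((\<gamma> + 16 * \<eta>) * n)) * (exp (real n * g) * ?q)
            \<le> exp (- ((\<gamma> + 16 * \<eta>) * n)) * (exp ((\<gamma> + 16 * \<eta>) * n) * \<bar>E - E0\<bar>)"
          by (intro mult_left_mono) auto
        then have "exp (- ((\<gamma> + 16 * \<eta>) * n)) * exp (real n * g) * ?q \<le> \<bar>E - E0\<bar>"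
          by (simp add: mult.assoc[symmetric] exp_add[symmetric])
        moreover have "exp (- ((\<gamma> + 16 * \<eta>) * n)) * exp (real n * g) = exp (- ((\<gamma> - g + \<epsilon>) * n))"
          by (simp add: exp_add[symmetric] \<eta>(2) algebra_simps)
        ultimately show ?thesis unfolding dist Re0 by (simp add: mult.commute)
      qed
    qed
  qed
  then show ?thesis using cc by (intro exI[of _ cc] conjI)
qed

end

section \<open>Transfer to the given random variables\<close>

lemma onorm_mat2_bounds:
  fixes A :: "real^2^2"
  shows "onorm ((*v) A) \<le> norm A" "norm A \<le> 2 * onorm ((*v) A)"
proof -
  show "onorm ((*v) A) \<le> norm A" by (rule onorm_le) (rule norm_mat2_mult_vec_le)
  obtain i j where "norm A \<le> 2 * \<bar>A $ i $ j\<bar>" using norm_mat2_le_entry by blast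
  then show "norm A \<le> 2 * onorm ((*v) A)" using matrix_component_le_onorm[of A i j] by linarith
qed

text \<open>The operator norm is 1-Lipschitz for the Frobenius norm; this yields measurability of
  the integrand in the Lyapunov exponent.\<close>

lemma continuous_on_onorm_mat2: "continuous_on UNIV (\<lambda>A::real^2^2. onorm ((*v) A))"
proof -
  have *: "onorm ((*v) A) \<le> onorm ((*v) B) + norm (A - B)" for A B :: "real^2^2"
  proof (rule onorm_le)
    fix x :: "real^2"
    have "A *v x = B *v x + (A - B) *v x" by (simp add: matrix_vector_mult_diff_rdistrib)
    then have "norm (A *v x) \<le> norm (B *v x) + norm ((A - B) *v x)" using norm_triangle_ineq by metis
    also have "\<dots> \<le> onorm ((*v) B) * norm x + norm (A - B) * norm x"
      by (intro add_mono norm_mat2_mult_vec_le onorm matrix_vector_mul_bounded_linear)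
    finally show "norm (A *v x) \<le> (onorm ((*v) B) + norm (A - B)) * norm x" by (simp add: distrib_right)
  qed
  show ?thesis
    unfolding continuous_on_iff
  proof (intro ballI allI impI)
    fix A :: "real^2^2" and e :: real assume "0 < e"
    moreover have "dist (onorm ((*v) B)) (onorm ((*v) A)) \<le> dist B A" for B :: "real^2^2"
      using *[of A B] *[of B A] by (simp add: dist_norm norm_minus_commute abs_le_iff)
    ultimately show "\<exists>d>0. \<forall>B\<in>UNIV. dist B A < d \<longrightarrow> dist (onorm ((*v) B)) (onorm ((*v) A)) < e"
      by (intro exI[of _ e]) (meson le_less_trans)
  qed
qed

lemma borel_measurable_mat2:
  fixes f :: "'a \<Rightarrow> real^2^2"
  assumes "\<And>i j. (\<lambda>x. f x $ i $ j) \<in> borel_measurable M"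
  shows "f \<in> borel_measurable M"
  unfolding borel_measurable_euclidean_space[of f]
proof
  fix b :: "real^2^2" assume "b \<in> Basis"
  then obtain i j where "b = axis i (axis j 1)" by (auto simp: Basis_vec_def)
  then have "(\<lambda>x. inner (f x) b) = (\<lambda>x. f x $ i $ j)" by (simp add: inner_axis)
  then show "(\<lambda>x. inner (f x) b) \<in> borel_measurable M" using assms by simp
qed

lemma transfer_product_eq: "transfer_product E x n = schr_prod (\<lambda>i. E - x (Suc i)) n"
  by (induction n) (simp_all add: transfer_matrix_def schr_step_def)

lemma hatano_nelson_cong:
  assumes "\<And>k. 1 \<le> k \<Longrightarrow> k \<le> n \<Longrightarrow> x k = x' k"
  shows "hatano_nelson x n g = hatano_nelson x' n g"
  unfolding hatano_nelson_def by (rule cong_mat) (use assms in auto)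

text \<open>An almost sure property need not define a measurable set, so a measurable null set
  containing its failures is removed from the event.\<close>

lemma (in prob_space) ae_event:
  assumes "AE \<omega> in M. P \<omega>" "B \<in> sets M"
  obtains A where "A \<in> sets M" "A \<subseteq> B" "measure M B \<le> measure M A" "\<And>\<omega>. \<omega> \<in> A \<Longrightarrow> P \<omega>"
proof -
  obtain N where N: "{\<omega>\<in>space M. \<not> P \<omega>} \<subseteq> N" "emeasure M N = 0" "N \<in> sets M"
    using assms(1) by (rule AE_E)
  show ?thesis
  proof (rule that[of "B - N"])
    have "measure M B \<le> measure M ((B - N) \<union> N)" using assms N by (intro finite_measure_mono) auto
    also have "\<dots> \<le> measure M (B - N) + measure M N" using assms N by (intro measure_Un_le) auto
    finally show "measure M B \<le> measure M (B - N)" using N by (simp add: measure_def)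
    show "P \<omega>" if "\<omega> \<in> B - N" for \<omega>
      using that N(1) sets.sets_into_space[OF assms(2)] by auto
  qed (use assms N in auto)
qed

text \<open>\<open>Sp\<close> is the support of the law of \<open>c\<close>. It carries the law,
  because every value outside lies in one of countably many null intervals with rational ends.
  Either it is one point, or it supplies \<open>a\<close> and \<open>b\<close>.\<close>

lemma (in random_potential) support_dichotomy:
  "(\<exists>a. \<bar>a\<bar> \<le> K \<and> (AE t in \<nu>. c t = a)) \<or>
   (\<exists>a b. a < b \<and> \<bar>a\<bar> \<le> K \<and> \<bar>b\<bar> \<le> K \<and> (\<forall>r>0. 0 < measure \<nu> {t. \<bar>c t - a\<bar> < r}) \<and>
     (\<forall>r>0. 0 < measure \<nu> {t. \<bar>c t - b\<bar> < r}))"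
proof -
  define Sp where "Sp = {a. \<forall>r>0. 0 < measure \<nu> {t. \<bar>c t - a\<bar> < r}}"
  have sp: "space \<nu> = UNIV" using sets_eq_imp_space_eq[OF sets_\<nu>] by simp
  have set1: "{t. \<bar>c t - q\<bar> < r} \<in> sets \<nu>" for q r
  proof -
    have "{t\<in>space borel. \<bar>c t - q\<bar> < r} \<in> sets borel" by measurable
    then show ?thesis by (simp add: sets_\<nu>)
  qed
  have set2: "{t. p < c t \<and> c t < q} \<in> sets \<nu>" for p q
  proof -
    have "{t\<in>space borel. p < c t \<and> c t < q} \<in> sets borel" by measurable
    then show ?thesis by (simp add: sets_\<nu>)
  qed
  have bound: "\<bar>a\<bar> \<le> K" if "a \<in> Sp" for a
  proof (rule ccontr)
    assume "\<not> ?thesis"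
    then have r: "0 < \<bar>a\<bar> - K" by simp
    then have "0 < measure \<nu> {t. \<bar>c t - a\<bar> < \<bar>a\<bar> - K}" using that unfolding Sp_def by blast
    moreover have "\<not> \<bar>c t - a\<bar> < \<bar>a\<bar> - K" for t using c_bound[of t] by linarith
    ultimately show False by simp
  qed
  have ae: "AE t in \<nu>. c t \<in> Sp"
  proof -
    define Q where "Q = {pq \<in> \<rat> \<times> \<rat>. measure \<nu> {t. fst pq < c t \<and> c t < snd pq} = 0}"
    have "countable Q"
      unfolding Q_def by (rule countable_subset[of _ "\<rat> \<times> \<rat>"]) (auto intro: countable_rat countable_SIGMA)
    moreover have "AE t in \<nu>. \<not> (fst pq < c t \<and> c t < snd pq)" if "pq \<in> Q" for pq
      using that set2[of "fst pq" "snd pq"] sp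
      by (intro AE_I[of _ _ "{t. fst pq < c t \<and> c t < snd pq}"]) (auto simp: Q_def nu.emeasure_eq_measure)
    ultimately have "AE t in \<nu>. \<forall>pq\<in>Q. \<not> (fst pq < c t \<and> c t < snd pq)"
      by (subst AE_ball_countable) auto
    then show ?thesis
    proof (rule AE_mp, intro AE_I2 impI)
      fix t assume t: "\<forall>pq\<in>Q. \<not> (fst pq < c t \<and> c t < snd pq)"
      show "c t \<in> Sp"
      proof (rule ccontr)
        assume "c t \<notin> Sp"
        then obtain r where r: "0 < r" "measure \<nu> {s. \<bar>c s - c t\<bar> < r} = 0"
          unfolding Sp_def using measure_nonneg[of \<nu>] by (auto simp: not_less order_antisym)
        obtain p where p: "p \<in> \<rat>" "c t - r < p" "p < c t" using Rats_dense_in_real[of "c t - r" "c t"] r by auto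
        obtain q where q: "q \<in> \<rat>" "c t < q" "q < c t + r" using Rats_dense_in_real[of "c t" "c t + r"] r by auto
        have "measure \<nu> {s. p < c s \<and> c s < q} \<le> measure \<nu> {s. \<bar>c s - c t\<bar> < r}"
          by (rule nu.finite_measure_mono) (use p q set1 in auto)
        then have "measure \<nu> {s. p < c s \<and> c s < q} = 0" using r(2) measure_nonneg[of \<nu>] by (metis order_antisym)
        then have "(p, q) \<in> Q" using p q by (simp add: Q_def)
        then show False using t p q by force
      qed
    qed
  qed
  obtain t0 where t0: "c t0 \<in> Sp"
  proof -
    have "\<exists>t. c t \<in> Sp"
    proof (rule ccontr)
      assume "\<not> ?thesis"
      then have "AE t in \<nu>. False" using ae by simp
      then show False by simp
    qed
    then show ?thesis using that by blast
  qed
  show ?thesis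
  proof (cases "\<exists>b\<in>Sp. b \<noteq> c t0")
    case True
    then obtain b where b: "b \<in> Sp" "b \<noteq> c t0" by blast
    have Sp: "\<forall>r>0. 0 < measure \<nu> {t. \<bar>c t - a\<bar> < r}" if "a \<in> Sp" for a
      using that by (simp add: Sp_def)
    show ?thesis
    proof (cases "b < c t0")
      case True
      then show ?thesis using Sp[OF t0] Sp[OF b(1)] bound[OF t0] bound[OF b(1)]
        by (intro disjI2 exI[of _ b] exI[of _ "c t0"] conjI)
    next
      case False
      then have "c t0 < b" using b(2) by simp
      then show ?thesis using Sp[OF t0] Sp[OF b(1)] bound[OF t0] bound[OF b(1)]
        by (intro disjI2 exI[of _ "c t0"] exI[of _ b] conjI)
    qed
  next
    case False
    then have "AE t in \<nu>. c t = c t0" using ae by (auto elim: eventually_mono)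
    then show ?thesis using bound[OF t0] by blast
  qed
qed

text \<open>The quadratic form p^2 - \<tau> p q + q^2 is conserved along each column. For |\<tau>| =
  2 it degenerates, but still bounds the growth of a column by 1 per step, so the linear bound
  covers the closed spectrum.\<close>

lemma norm_schr_prod_elliptic_le:
  fixes \<tau> :: real
  assumes "\<bar>\<tau>\<bar> \<le> 2"
  shows "norm (schr_prod (\<lambda>_. \<tau>) n) \<le> 2 * (real n + 1)"
proof -
  let ?V = "schr_prod (\<lambda>_. \<tau>)"
  have inv: "(?V m $ 1 $ j)\<^sup>2 - \<tau> * ?V m $ 1 $ j * ?V m $ 2 $ j + (?V m $ 2 $ j)\<^sup>2 = 1" for m j
  proof (induction m)
    case 0
    have "j = 1 \<or> j = 2" using exhaust_2 by auto
    then show ?case by (auto simp: mat2_one_nth)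
  next
    case (Suc m)
    then show ?case by (simp add: power2_eq_square algebra_simps)
  qed
  have step: "\<bar>?V m $ 1 $ j\<bar> \<le> \<bar>?V m $ 2 $ j\<bar> + 1" for m j
  proof -
    let ?p = "?V m $ 1 $ j" and ?q = "?V m $ 2 $ j"
    have "(?p - \<tau> / 2 * ?q)\<^sup>2 + (1 - \<tau>\<^sup>2 / 4) * ?q\<^sup>2 = ?p\<^sup>2 - \<tau> * ?p * ?q + ?q\<^sup>2"
      by (simp add: power2_eq_square field_simps)
    then have e: "(?p - \<tau> / 2 * ?q)\<^sup>2 + (1 - \<tau>\<^sup>2 / 4) * ?q\<^sup>2 = 1" by (simp only: inv)
    have "\<tau>\<^sup>2 \<le> 2\<^sup>2" using assms abs_le_square_iff[of \<tau> 2] by simp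
    then have "0 \<le> (1 - \<tau>\<^sup>2 / 4) * ?q\<^sup>2" by (intro mult_nonneg_nonneg) auto
    then have "(?p - \<tau> / 2 * ?q)\<^sup>2 \<le> 1\<^sup>2" using e by simp
    then have "\<bar>?p - \<tau> / 2 * ?q\<bar> \<le> 1" using abs_le_square_iff[of "?p - \<tau> / 2 * ?q" 1] by simp
    moreover have "\<bar>\<tau> / 2 * ?q\<bar> \<le> 1 * \<bar>?q\<bar>" unfolding abs_mult using assms by (intro mult_right_mono) auto
    ultimately show ?thesis by linarith
  qed
  have lin: "\<bar>?V m $ 1 $ j\<bar> \<le> real m + 1 \<and> \<bar>?V m $ 2 $ j\<bar> \<le> real m + 1" for m j
  proof (induction m)
    case 0
    show ?case by (simp add: mat2_one_nth)
  next
    case (Suc m)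
    have "?V (Suc m) $ 2 $ j = ?V m $ 1 $ j" by simp
    then show ?case using Suc step[of "Suc m" j] by (simp only: of_nat_Suc) linarith
  qed
  obtain i j where ij: "norm (?V n) \<le> 2 * \<bar>?V n $ i $ j\<bar>" using norm_mat2_le_entry by blast
  have "i = 1 \<or> i = 2" using exhaust_2 by auto
  then have "\<bar>?V n $ i $ j\<bar> \<le> real n + 1" using lin[of n j] by auto
  then have "2 * \<bar>?V n $ i $ j\<bar> \<le> 2 * (real n + 1)" by simp
  with ij show ?thesis by (rule order_trans)
qed

text \<open>Joins the given variables to the canonical product space. Sites start at 1 for
  \<open>v\<close> and at 0 for sequences, hence the \<open>Suc\<close>; the truncation
  \<open>c\<close> changes no value almost surely.\<close>

locale iid_realization = random_potential \<nu> c K R + prob_space M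
  for \<nu> :: "real measure" and c K R and M :: "'a measure" +
  fixes v :: "nat \<Rightarrow> 'a \<Rightarrow> real"
  assumes v_measurable: "\<And>k. 1 \<le> k \<Longrightarrow> v k \<in> borel_measurable M"
    and v_distr: "\<And>k. 1 \<le> k \<Longrightarrow> distr M borel (v k) = \<nu>"
    and Y_measurable: "(\<lambda>\<omega> i. v (Suc i) \<omega>) \<in> measurable M S"
    and Y_distr: "distr M S (\<lambda>\<omega> i. v (Suc i) \<omega>) = S"
    and v_clip: "AE \<omega> in M. \<forall>k\<ge>1. c (v k \<omega>) = v k \<omega>"
begin

abbreviation Y :: "'a \<Rightarrow> nat \<Rightarrow> real" where "Y \<omega> \<equiv> \<lambda>i. v (Suc i) \<omega>"

lemma norm_V_Y_measurable: "(\<lambda>\<omega>. norm (V E (Y \<omega>) n)) \<in> borel_measurable M"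
  using measurable_compose[OF Y_measurable norm_V_measurable, of E n] .

lemma mean_log_eq: "mean_log n E = (\<integral>\<omega>. ln (norm (V E (Y \<omega>) n)) \<partial>M)"
proof -
  have "mean_log n E = (\<integral>x. ln (norm (V E x n)) \<partial>distr M S (\<lambda>\<omega> i. v (Suc i) \<omega>))"
    unfolding mean_log_def Y_distr ..
  also have "\<dots> = (\<integral>\<omega>. ln (norm (V E (Y \<omega>) n)) \<partial>M)"
    by (rule integral_distr[OF Y_measurable]) measurable
  finally show ?thesis .
qed

lemma transfer_product_AE: "AE \<omega> in M. transfer_product E (\<lambda>k. v k \<omega>) n = V E (Y \<omega>) n"
  using v_clip by eventually_elim (simp add: transfer_product_eq)

text \<open>Operator and Frobenius norm differ by a factor of at most 2, so the logarithms differ by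
  at most \<open>ln 2\<close>, which vanishes after division by \<open>n\<close>.\<close>

lemma lyapunov_exponent_eqI:
  assumes E: "\<bar>E\<bar> \<le> R" and lim: "(\<lambda>n. mean_log n E / n) \<longlonglongrightarrow> l"
  shows "lyapunov_exponent M v E = l"
proof -
  define f where "f n \<omega> = ln (onorm ((*v) (transfer_product E (\<lambda>k. v k \<omega>) n)))" for n \<omega>
  define h where "h n \<omega> = ln (norm (V E (Y \<omega>) n))" for n \<omega>
  have f_meas: "f n \<in> borel_measurable M" for n
  proof -
    have ent: "(\<lambda>\<omega>. transfer_product E (\<lambda>k. v k \<omega>) n $ i $ j) \<in> borel_measurable M" for i j
      unfolding transfer_product_eq
    proof (induction n arbitrary: i j)
      case (Suc n i j)
      note [measurable] = Suc v_measurable[of "Suc n", simplified]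
      have "i = 1 \<or> i = 2" using exhaust_2 by auto
      then show ?case by (elim disjE) simp_all
    qed simp
    have "(\<lambda>\<omega>. onorm ((*v) (transfer_product E (\<lambda>k. v k \<omega>) n))) \<in> borel_measurable M"
      using measurable_compose[OF borel_measurable_mat2[OF ent] borel_measurable_continuous_onI[OF continuous_on_onorm_mat2]] .
    then show ?thesis unfolding f_def[abs_def] by measurable
  qed
  have h_meas: "h n \<in> borel_measurable M" for n
    unfolding h_def[abs_def] using norm_V_Y_measurable by measurable
  have hb: "\<bar>h n \<omega>\<bar> \<le> log_bound n" for n \<omega> unfolding h_def by (rule ln_norm_V_le(1)[OF E])
  have fh: "AE \<omega> in M. \<bar>f n \<omega> - h n \<omega>\<bar> \<le> ln 2" for n
    using transfer_product_AE[of E n]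
  proof eventually_elim
    case (elim \<omega>)
    let ?A = "V E (Y \<omega>) n"
    have p: "1 \<le> norm ?A" "onorm ((*v) ?A) \<le> norm ?A" "norm ?A \<le> 2 * onorm ((*v) ?A)"
      using onorm_mat2_bounds[of ?A] by simp_all
    then have o: "0 < onorm ((*v) ?A)" by linarith
    have "ln (onorm ((*v) ?A)) \<le> ln (norm ?A)" using p o by (intro iffD2[OF ln_le_cancel_iff]) auto
    moreover have "ln (norm ?A) \<le> ln (2 * onorm ((*v) ?A))" using p o by (intro iffD2[OF ln_le_cancel_iff]) auto
    moreover have "ln (2 * onorm ((*v) ?A)) = ln 2 + ln (onorm ((*v) ?A))" using o by (simp add: ln_mult)
    ultimately show ?case unfolding f_def h_def elim by linarith
  qed
  have h_int: "integrable M (h n)" for n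
    by (rule integrable_const_bound[of _ "log_bound n"]) (use hb h_meas in auto)
  have f_int: "integrable M (f n)" for n
  proof (rule integrable_const_bound[of _ "log_bound n + ln 2"])
    show "AE \<omega> in M. norm (f n \<omega>) \<le> log_bound n + ln 2"
      using fh[of n]
    proof eventually_elim
      case (elim \<omega>)
      then show ?case using hb[of n \<omega>] by simp
    qed
  qed (rule f_meas)
  have d: "\<bar>(\<integral>\<omega>. f n \<omega> \<partial>M) - mean_log n E\<bar> \<le> ln 2" for n
  proof -
    have "(\<integral>\<omega>. f n \<omega> \<partial>M) - mean_log n E = (\<integral>\<omega>. (f n \<omega> - h n \<omega>) \<partial>M)"
      unfolding mean_log_eq using f_int h_int by (simp add: h_def[symmetric])
    moreover have "\<bar>\<integral>\<omega>. (f n \<omega> - h n \<omega>) \<partial>M\<bar> \<le> (\<integral>\<omega>. \<bar>f n \<omega> - h n \<omega>\<bar> \<partial>M)"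
      by (rule integral_abs_bound)
    moreover have "(\<integral>\<omega>. \<bar>f n \<omega> - h n \<omega>\<bar> \<partial>M) \<le> ln 2"
      by (rule integral_le_const) (use f_int h_int fh in auto)
    ultimately show ?thesis by (simp only:)
  qed
  have "(\<lambda>n. ((\<integral>\<omega>. f n \<omega> \<partial>M) - mean_log n E) / n) \<longlonglongrightarrow> 0"
  proof (rule Lim_null_comparison)
    show "\<forall>\<^sub>F n in sequentially. norm (((\<integral>\<omega>. f n \<omega> \<partial>M) - mean_log n E) / real n) \<le> ln 2 / real n"
      using d by (intro always_eventually allI) (simp add: divide_right_mono)
    show "(\<lambda>n. ln 2 / real n) \<longlonglongrightarrow> 0" by real_asymp
  qed
  from tendsto_add[OF this lim] have "(\<lambda>n. (\<integral>\<omega>. f n \<omega> \<partial>M) / n) \<longlonglongrightarrow> l"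
    by (simp add: add_divide_distrib[symmetric])
  then show ?thesis unfolding lyapunov_exponent_def f_def by (rule limI)
qed

end

text \<open>The radius is \<open>K + 3\<close>: the Hermitian spectrum lies within
  \<open>K + 2\<close>, and 1 is left for the neighbourhoods of eigenvalues.\<close>

lemma iid_realization_intro:
  assumes M: "prob_space M" and iid: "iid_sequence M v"
    and C: "\<And>k. 1 \<le> k \<Longrightarrow> AE \<omega> in M. \<bar>v k \<omega>\<bar> \<le> C"
  defines "K \<equiv> \<bar>C\<bar>"
  shows "iid_realization (distr M borel (v 1)) (\<lambda>t. max (- K) (min K t)) K (K + 3) M v"
proof -
  interpret prob_space M by (rule M)
  let ?\<nu> = "distr M borel (v 1)"
  let ?c = "\<lambda>t. max (- K) (min K t)"
  have ind: "indep_vars (\<lambda>_. borel) v {1..}" and dist: "\<And>k. 1 \<le> k \<Longrightarrow> distr M borel (v k) = ?\<nu>"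
    using iid unfolding iid_sequence_def by blast+
  have rv: "v k \<in> borel_measurable M" if "1 \<le> k" for k
    using ind that by (auto simp: indep_vars_def)
  interpret rp: random_potential ?\<nu> ?c K "K + 3"
  proof (rule random_potential.intro)
    show "prob_space ?\<nu>" using rv[of 1] by (intro prob_space_distr) simp
    show "\<bar>?c t\<bar> \<le> K" for t unfolding K_def by linarith
    show "sets ?\<nu> = sets borel" by simp
    show "?c \<in> borel_measurable borel" by measurable
    show "0 \<le> K + 3" by (simp add: K_def)
  qed
  have sets1: "sets (PiM {1..} (\<lambda>_::nat. ?\<nu>)) = sets (PiM {1..} (\<lambda>_::nat. borel :: real measure))"
    by (rule sets_PiM_cong) auto
  let ?X = "\<lambda>\<omega>. \<lambda>i\<in>{1..}. v i \<omega>"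
  have X_meas: "?X \<in> measurable M (PiM {1..} (\<lambda>_. borel))"
    by (rule measurable_restrict) (use rv in auto)
  have "distr M (PiM {1..} (\<lambda>_. borel)) ?X = PiM {1..} (\<lambda>i. distr M borel (v i))"
  proof (rule iffD1[OF indep_vars_iff_distr_eq_PiM' ind])
    show "{1::nat..} \<noteq> {}" by simp
    show "v k \<in> borel_measurable M" if "k \<in> {1..}" for k using rv that by simp
  qed
  also have "\<dots> = PiM {1..} (\<lambda>_. ?\<nu>)" by (rule PiM_cong[OF refl]) (rule dist, simp)
  finally have dX: "distr M (PiM {1..} (\<lambda>_. borel)) ?X = PiM {1..} (\<lambda>_. ?\<nu>)" .
  let ?f = "\<lambda>x::nat \<Rightarrow> real. \<lambda>n\<in>UNIV. x (Suc n)"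
  have f_meas: "?f \<in> measurable (PiM {1..} (\<lambda>_. ?\<nu>)) rp.S"
    by (rule measurable_restrict) (rule measurable_component_singleton, simp)
  have fX: "?f \<circ> ?X = (\<lambda>\<omega> i. v (Suc i) \<omega>)" by (auto simp: fun_eq_iff)
  have X_meas': "?X \<in> measurable M (PiM {1..} (\<lambda>_. ?\<nu>))"
    using X_meas sets1 by (simp cong: measurable_cong_sets)
  have Ym: "(\<lambda>\<omega> i. v (Suc i) \<omega>) \<in> measurable M rp.S"
    using measurable_comp[OF X_meas' f_meas] unfolding fX .
  have "distr M rp.S (\<lambda>\<omega> i. v (Suc i) \<omega>) = distr (distr M (PiM {1..} (\<lambda>_. ?\<nu>)) ?X) rp.S ?f"
    unfolding fX[symmetric] by (rule distr_distr[symmetric, OF f_meas X_meas'])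
  also have "distr M (PiM {1..} (\<lambda>_. ?\<nu>)) ?X = PiM {1..} (\<lambda>_. ?\<nu>)"
  proof -
    have "distr M (PiM {1..} (\<lambda>_. ?\<nu>)) ?X = distr M (PiM {1..} (\<lambda>_. borel)) ?X"
      by (rule distr_cong[OF refl sets1 refl])
    then show ?thesis using dX by (rule trans)
  qed
  also have "distr (PiM {1..} (\<lambda>_. ?\<nu>)) rp.S ?f = rp.S"
  proof (rule distr_PiM_reindex[of "{1..}" "\<lambda>_. ?\<nu>" Suc UNIV])
    show "prob_space ?\<nu>" by (rule rp.prob_\<nu>)
  qed auto
  finally have Yd: "distr M rp.S (\<lambda>\<omega> i. v (Suc i) \<omega>) = rp.S" .
  have clip: "AE \<omega> in M. \<forall>k\<ge>1. ?c (v k \<omega>) = v k \<omega>"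
  proof -
    have "AE \<omega> in M. \<forall>k\<in>{1..}. ?c (v k \<omega>) = v k \<omega>"
    proof (subst AE_ball_countable)
      show "\<forall>k\<in>{1..}. AE \<omega> in M. ?c (v k \<omega>) = v k \<omega>"
      proof
        fix k :: nat assume "k \<in> {1..}"
        then show "AE \<omega> in M. ?c (v k \<omega>) = v k \<omega>"
          using C[of k] by (auto elim!: eventually_mono simp: K_def)
      qed
    qed simp
    then show ?thesis by (auto elim!: eventually_mono)
  qed
  show ?thesis
  proof (intro iid_realization.intro iid_realization_axioms.intro rp.random_potential_axioms M)
    show "v k \<in> borel_measurable M" if "1 \<le> k" for k by (rule rv[OF that])
    show "distr M borel (v k) = ?\<nu>" if "1 \<le> k" for k by (rule dist[OF that])
  qed (rule Ym Yd clip)+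
qed

theorem theorem1:
  fixes M :: "'a measure" and v :: "nat \<Rightarrow> 'a \<Rightarrow> real"
  assumes "prob_space M"
    and "iid_sequence M v"
    and "bounded_sequence M v"
  shows "\<exists>\<epsilon>0>0. \<forall>\<epsilon>::real. 0 < \<epsilon> \<and> \<epsilon> < \<epsilon>0 \<longrightarrow>
    (\<exists>c>0. \<exists>N0::nat. \<forall>n>N0.
      \<exists>A\<in>sets M. measure M A > 1 - exp (- (c * real n)) \<and>
        (\<forall>\<omega>\<in>A. \<forall>\<Lambda>. eigenvalue_branches (\<lambda>k. v k \<omega>) n \<Lambda> \<longrightarrow>
          (\<forall>j\<in>{1..n}. \<forall>g. 0 \<le> g \<and> g \<le> lyapunov_exponent M v (Re (\<Lambda> j 0)) - \<epsilon> \<longrightarrow>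
            \<Lambda> j g \<in> \<real> \<and>
            (1 - exp (- (real n * g)))\<^sup>2 *
                exp (- ((lyapunov_exponent M v (Re (\<Lambda> j 0)) - g + \<epsilon>) * real n))
              \<le> cmod (\<Lambda> j g - \<Lambda> j 0) \<and>
            cmod (\<Lambda> j g - \<Lambda> j 0)
              < exp (- ((lyapunov_exponent M v (Re (\<Lambda> j 0)) - g - \<epsilon>) * real n)))))"
proof -
  obtain C where C: "\<And>k. 1 \<le> k \<Longrightarrow> AE \<omega> in M. \<bar>v k \<omega>\<bar> \<le> C"
    using assms(3) by (auto simp: bounded_sequence_def)
  define K where "K = \<bar>C\<bar>"
  define cl where "cl = (\<lambda>t. max (- K) (min K t))"
  define \<nu> where "\<nu> = distr M borel (v 1)"
  interpret ir: iid_realization \<nu> cl K "K + 3" M v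
    using iid_realization_intro[OF assms(1,2) C] unfolding \<nu>_def cl_def K_def .
  have main: "\<exists>c>0. \<exists>N0::nat. \<forall>n>N0.
      \<exists>A\<in>sets M. measure M A > 1 - exp (- (c * real n)) \<and>
        (\<forall>\<omega>\<in>A. \<forall>\<Lambda>. eigenvalue_branches (\<lambda>k. v k \<omega>) n \<Lambda> \<longrightarrow>
          (\<forall>j\<in>{1..n}. branch_estimates (lyapunov_exponent M v (Re (\<Lambda> j 0))) \<epsilon> n (\<Lambda> j)))" (is "?goal")
    if \<epsilon>: "0 < \<epsilon>" for \<epsilon> :: real
    using ir.support_dichotomy
  proof (elim disjE exE conjE)
    \<comment> \<open>For a constant potential every \<lambda>_j(0) lies within 2 of
      \<open>v0\<close>, where the exponent is 0. Then 0 \<le> g \<le> - \<epsilon> is impossible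
      and the claim is void on an event of probability 1.\<close>
    fix v0 assume v0: "\<bar>v0\<bar> \<le> K" and ae: "AE t in \<nu>. cl t = v0"
    have "AE \<omega> in M. \<forall>k\<in>{1..}. cl (v k \<omega>) = v0"
    proof (subst AE_ball_countable)
      show "\<forall>k\<in>{1..}. AE \<omega> in M. cl (v k \<omega>) = v0"
      proof
        fix k :: nat assume k: "k \<in> {1..}"
        then have "distr M borel (v k) = \<nu>" by (intro ir.v_distr) simp
        then have "AE t in distr M borel (v k). cl t = v0" by (rule ssubst) (rule ae)
        have "v k \<in> borel_measurable M" using k by (intro ir.v_measurable) simp
        from AE_distrD[OF this \<open>AE t in distr M borel (v k). cl t = v0\<close>]
        show "AE \<omega> in M. cl (v k \<omega>) = v0" .
      qed
    qed simp
    then have aecl: "AE \<omega> in M. \<forall>k\<ge>1. cl (v k \<omega>) = v0" by (auto elim!: eventually_mono)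
    then have aev: "AE \<omega> in M. \<forall>k\<ge>1. v k \<omega> = v0" using ir.v_clip by eventually_elim simp
    have zero: "lyapunov_exponent M v E = 0" if E: "\<bar>E - v0\<bar> \<le> 2" for E
    proof (rule ir.lyapunov_exponent_eqI)
      show ER: "\<bar>E\<bar> \<le> K + 3" using E v0 by linarith
      have "ir.mean_log n E \<le> ln (2 * (real n + 1))" for n
        unfolding ir.mean_log_eq
      proof (rule ir.integral_le_const)
        show "integrable M (\<lambda>\<omega>. ln (norm (ir.V E (ir.Y \<omega>) n)))"
        proof (rule ir.integrable_const_bound[of _ "ir.log_bound n"])
          show "AE \<omega> in M. norm (ln (norm (ir.V E (ir.Y \<omega>) n))) \<le> ir.log_bound n"
            using ir.ln_norm_V_le(1)[OF ER] by (intro AE_I2) (simp only: real_norm_def)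
          show "(\<lambda>\<omega>. ln (norm (ir.V E (ir.Y \<omega>) n))) \<in> borel_measurable M"
            by (rule borel_measurable_ln[OF ir.norm_V_Y_measurable])
        qed
        show "AE \<omega> in M. ln (norm (ir.V E (ir.Y \<omega>) n)) \<le> ln (2 * (real n + 1))"
          using aecl
        proof eventually_elim
          case (elim \<omega>)
          have "ir.V E (ir.Y \<omega>) n = schr_prod (\<lambda>_. E - v0) n" using elim by (intro schr_prod_cong) simp
          then have "norm (ir.V E (ir.Y \<omega>) n) \<le> 2 * (real n + 1)"
            using norm_schr_prod_elliptic_le[OF E, of n] by simp
          then show ?case by (intro iffD2[OF ln_le_cancel_iff]) auto
        qed
      qed
      then have ub: "ir.mean_log n E / real n \<le> ln (2 * (real n + 1)) / real n" for n
        by (intro divide_right_mono) auto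
      have lb: "0 \<le> ir.mean_log n E / real n" for n using ir.mean_log_nonneg[OF ER] by simp
      show "(\<lambda>n. ir.mean_log n E / real n) \<longlonglongrightarrow> 0"
      proof (rule tendsto_sandwich[OF _ _ tendsto_const])
        show "(\<lambda>n. ln (2 * (real n + 1)) / real n) \<longlonglongrightarrow> 0" by real_asymp
      qed (use lb ub in auto)
    qed
    obtain A where A: "A \<in> sets M" "measure M (space M) \<le> measure M A" "\<And>\<omega>. \<omega> \<in> A \<Longrightarrow> \<forall>k\<ge>1. v k \<omega> = v0"
      by (rule ir.ae_event[OF aev sets.top]) (rule that; assumption)
    have vac: "lyapunov_exponent M v (Re (\<Lambda> j 0)) = 0"
      if w: "\<omega> \<in> A" and br: "eigenvalue_branches (\<lambda>k. v k \<omega>) n \<Lambda>" and j: "j \<in> {1..n}" for \<omega> n \<Lambda> j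
    proof -
      obtain E where "\<Lambda> j 0 = complex_of_real E" "\<bar>E - v0\<bar> \<le> 0 + 2"
        using hermitian_eigenvalue[OF eigenvalue_branches_root[OF br j order_refl], of v0 0] A(3)[OF w] by auto
      then show ?thesis using zero by simp
    qed
    have vac': Q if "\<omega> \<in> A" "eigenvalue_branches (\<lambda>k. v k \<omega>) n \<Lambda>" "j \<in> {1..n}"
        "0 \<le> g \<and> g \<le> lyapunov_exponent M v (Re (\<Lambda> j 0)) - \<epsilon>" for \<omega> n \<Lambda> j g Q
      using vac[OF that(1-3)] that(4) \<epsilon> by simp
    show ?goal
    proof (intro exI[of _ "1::real"] exI[of _ "0::nat"] conjI allI impI bexI[of _ A] A(1))
      fix n :: nat
      show "measure M A > 1 - exp (- (1 * real n))" using A(2) ir.prob_space exp_gt_zero[of "- (1 * real n)"] by linarith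
    qed (simp, intro ballI allI impI, erule (3) vac')
  next
    fix a b assume ab: "a < b" "\<bar>a\<bar> \<le> K" "\<bar>b\<bar> \<le> K"
      "\<forall>r>0. 0 < measure \<nu> {t. \<bar>cl t - a\<bar> < r}" "\<forall>r>0. 0 < measure \<nu> {t. \<bar>cl t - b\<bar> < r}"
    interpret nd: nondegenerate_potential \<nu> cl K "K + 3" a b
      by unfold_locales (use ab in auto)
    have lyap: "lyapunov_exponent M v E = ir.lyap E" if "\<bar>E\<bar> \<le> K + 3" for E
      by (rule ir.lyapunov_exponent_eqI[OF that nd.lyap_limit[OF that]])
    obtain cc :: real where cc: "0 < cc" and ev: "\<forall>\<^sub>F n in sequentially. \<exists>Z\<in>sets ir.S. measure ir.S Z \<le> exp (- (cc * n)) \<and> (\<forall>x. x \<notin> Z \<longrightarrow>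
    (\<forall>\<Lambda>. eigenvalue_branches (\<lambda>k. cl (x (k - 1))) n \<Lambda> \<longrightarrow>
      (\<forall>j\<in>{1..n}. \<bar>Re (\<Lambda> j 0)\<bar> \<le> K + 3 \<and> branch_estimates (ir.lyap (Re (\<Lambda> j 0))) \<epsilon> n (\<Lambda> j))))"
      using nd.real_eigenvalues[OF \<epsilon> order_refl] by (elim exE conjE) (rule that)
    then obtain N where N: "\<forall>n\<ge>N. \<exists>Z\<in>sets ir.S. measure ir.S Z \<le> exp (- (cc * real n)) \<and> (\<forall>x. x \<notin> Z \<longrightarrow>
    (\<forall>\<Lambda>. eigenvalue_branches (\<lambda>k. cl (x (k - 1))) n \<Lambda> \<longrightarrow>
      (\<forall>j\<in>{1..n}. \<bar>Re (\<Lambda> j 0)\<bar> \<le> K + 3 \<and> branch_estimates (ir.lyap (Re (\<Lambda> j 0))) \<epsilon> n (\<Lambda> j))))"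
      unfolding eventually_sequentially by (elim exE) (rule that)
    show ?goal
    \<comment> \<open>Halving the rate makes the probability bound strict, as \<open>n\<close> is
      positive.\<close>
    proof (intro exI[of _ "cc / 2"] exI[of _ N] conjI allI impI)
      show "0 < cc / 2" using cc by simp
      fix n assume n: "N < n"
      from N[rule_format, OF less_imp_le[OF n]] obtain Z where Z: "Z \<in> sets ir.S" "measure ir.S Z \<le> exp (- (cc * real n))"
        and good: "\<forall>x. x \<notin> Z \<longrightarrow> (\<forall>\<Lambda>. eigenvalue_branches (\<lambda>k. cl (x (k - 1))) n \<Lambda> \<longrightarrow>
      (\<forall>j\<in>{1..n}. \<bar>Re (\<Lambda> j 0)\<bar> \<le> K + 3 \<and> branch_estimates (ir.lyap (Re (\<Lambda> j 0))) \<epsilon> n (\<Lambda> j)))"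
        by (elim bexE conjE) (rule that)
      define B where "B = ir.Y -` (UNIV - Z) \<inter> space M"
      have cZ: "UNIV - Z \<in> sets ir.S" using sets.compl_sets[OF Z(1)] by simp
      have B: "B \<in> sets M" unfolding B_def by (rule measurable_sets[OF ir.Y_measurable cZ])
      have "measure M B = measure ir.S (UNIV - Z)"
        unfolding B_def using measure_distr[OF ir.Y_measurable cZ] unfolding ir.Y_distr by simp
      also have "\<dots> = 1 - measure ir.S Z" using ir.P.prob_compl[OF Z(1)] by simp
      finally have mB: "measure M B = 1 - measure ir.S Z" .
      obtain A where A: "A \<in> sets M" "A \<subseteq> B" "measure M B \<le> measure M A"
        "\<And>\<omega>. \<omega> \<in> A \<Longrightarrow> \<forall>k\<ge>1. cl (v k \<omega>) = v k \<omega>"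
        by (rule ir.ae_event[OF ir.v_clip B]) (rule that; assumption)
      show "\<exists>A\<in>sets M. measure M A > 1 - exp (- (cc / 2 * real n)) \<and>
        (\<forall>\<omega>\<in>A. \<forall>\<Lambda>. eigenvalue_branches (\<lambda>k. v k \<omega>) n \<Lambda> \<longrightarrow>
          (\<forall>j\<in>{1..n}. branch_estimates (lyapunov_exponent M v (Re (\<Lambda> j 0))) \<epsilon> n (\<Lambda> j)))"
      proof (rule bexI[OF _ A(1)], intro conjI ballI allI impI)
        have "exp (- (cc * real n)) < exp (- (cc / 2 * real n))" using cc n by simp
        then show "measure M A > 1 - exp (- (cc / 2 * real n))" using A(3) mB Z(2) by linarith
        fix \<omega> \<Lambda> j g
        assume w: "\<omega> \<in> A" and br: "eigenvalue_branches (\<lambda>k. v k \<omega>) n \<Lambda>" and j: "j \<in> {1..n}"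
          and g: "0 \<le> g \<and> g \<le> lyapunov_exponent M v (Re (\<Lambda> j 0)) - \<epsilon>"
        have nZ: "ir.Y \<omega> \<notin> Z" using w A(2) by (auto simp: B_def)
        have "hatano_nelson (\<lambda>k. cl (ir.Y \<omega> (k - 1))) n g = hatano_nelson (\<lambda>k. v k \<omega>) n g" for g
          by (rule hatano_nelson_cong) (use A(4)[OF w] in auto)
        then have "eigenvalue_branches (\<lambda>k. cl (ir.Y \<omega> (k - 1))) n \<Lambda>"
          using br by (simp add: eigenvalue_branches_def)
        from good[rule_format, OF nZ this j] have
          Re: "\<bar>Re (\<Lambda> j 0)\<bar> \<le> K + 3" and
          concl: "branch_estimates (ir.lyap (Re (\<Lambda> j 0))) \<epsilon> n (\<Lambda> j)"
          by blast+
        note c = concl[rule_format, OF g[unfolded lyap[OF Re]]]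
        show "\<Lambda> j g \<in> \<real>" using c by blast
        show "(1 - exp (- (real n * g)))\<^sup>2 *
                exp (- ((lyapunov_exponent M v (Re (\<Lambda> j 0)) - g + \<epsilon>) * real n)) \<le> cmod (\<Lambda> j g - \<Lambda> j 0)"
          unfolding lyap[OF Re] using c by blast
        show "cmod (\<Lambda> j g - \<Lambda> j 0) < exp (- ((lyapunov_exponent M v (Re (\<Lambda> j 0)) - g - \<epsilon>) * real n))"
          unfolding lyap[OF Re] using c by blast
      qed
    qed
  qed
  \<comment> \<open>The value 1 for \<epsilon>0 is an arbitrary choice, since \<open>main\<close>
    treats every positive \<epsilon>.\<close>
  show ?thesis by (rule exI[of _ "1::real"], rule conjI, simp, intro allI impI, rule main, simp)
qed

end
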